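(* Assume the 1-vs-2-cycle conjecture. Then any MPC algorithm with $n^{1-\Omega(1)}$ space per machine and $\mathrm{poly}(n)$ total space requires $\Omega\left(\log\frac{1}{\varepsilon}\right)$ rounds to compute a $(1+\varepsilon)$-approximate minimum spanning tree of an $n$-point metric, for any $1/n\le \varepsilon\le 1$; this holds even when restricted to $(1,2)$-metrics, i.e. metrics in which every pairwise distance is either $1$ or $2$.
   Context: MPC model: the input is distributed among machines, each with local memory $S$ words; computation proceeds in synchronous rounds in which each machine does arbitrary local computation and then sends messages, with the total size of messages sent and received by each machine per round at most $S$. The input metric is given by all pairwise distances. A $(1+\varepsilon)$-approximate MST is a spanning tree of the complete graph on the points of total weight at most $(1+\varepsilon)$ times the minimum. The 1-vs-2-cycle conjecture: there is no MPC algorithm with $S=n^{1-\Omega(1)}$ local space and $\mathrm{poly}(n)$ machines that can distinguish, in $o(\log n)$ rounds, whether the input graph is a single cycle on $2n$ vertices or two disjoint cycles on $n$ vertices each. *)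

theory Defs
  imports "HOL-Analysis.Analysis" "HOL-Library.Landau_Symbols"
begin

section \<open>The MPC model\<close>

text \<open>
  An algorithm for one fixed input size.  Machines and rounds are numbered from 0, and a word is
  a natural number below \<open>word_bound\<close>.  In round \<open>t\<close>, machine \<open>i\<close> with memory \<open>w\<close> sends the
  (possibly empty) message \<open>send A t i w j\<close> to machine \<open>j\<close>; \<open>receive A t i w inbox\<close> is its memory
  after it has got the message \<open>inbox j\<close> from every machine \<open>j\<close>.  Both are arbitrary functions,
  i.e. local computation is unrestricted; whether they obey the space and communication limits is
  a separate condition, \<open>obeys_limits\<close> below.
\<close>

record mpc =
  machines :: nat
  local_space :: nat
  word_bound :: nat
  rounds :: nat
  send :: "nat \<Rightarrow> nat \<Rightarrow> nat list \<Rightarrow> nat \<Rightarrow> nat list"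
  receive :: "nat \<Rightarrow> nat \<Rightarrow> nat list \<Rightarrow> (nat \<Rightarrow> nat list) \<Rightarrow> nat list"

definition fits :: "mpc \<Rightarrow> nat list \<Rightarrow> bool" where
  "fits A ws \<longleftrightarrow> length ws \<le> local_space A \<and> (\<forall>w\<in>set ws. w < word_bound A)"

text \<open>\<open>memory A m t i\<close> is the memory of machine \<open>i\<close> after \<open>t\<close> rounds, from initial memories \<open>m\<close>.\<close>

primrec memory :: "mpc \<Rightarrow> (nat \<Rightarrow> nat list) \<Rightarrow> nat \<Rightarrow> nat \<Rightarrow> nat list" where
  "memory A m 0 = m"
| "memory A m (Suc t) =
    (\<lambda>i. receive A t i (memory A m t i)
           (\<lambda>j. if j < machines A then send A t j (memory A m t j) i else []))"

definition obeys_limits :: "mpc \<Rightarrow> (nat \<Rightarrow> nat list) \<Rightarrow> bool" where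
  "obeys_limits A m \<longleftrightarrow>
     (\<forall>i<machines A. \<forall>t\<le>rounds A. fits A (memory A m t i)) \<and>
     (\<forall>i<machines A. \<forall>t<rounds A.
        fits A (concat (map (\<lambda>j. send A t i (memory A m t i) j) [0..<machines A])) \<and>
        fits A (concat (map (\<lambda>j. send A t j (memory A m t j) i) [0..<machines A])))"

text \<open>
  An input is a finite set of items, each a list of words.  Initially every item is on exactly one
  machine, in an arbitrary arrangement in which each machine's share fits into its memory.
\<close>

definition distribution :: "mpc \<Rightarrow> nat list set \<Rightarrow> (nat \<Rightarrow> nat list) \<Rightarrow> bool" where
  "distribution A X m \<longleftrightarrow>
     (\<exists>B :: nat \<Rightarrow> nat list list.
        (\<forall>i<machines A. m i = concat (B i) \<and> fits A (m i)) \<and>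
        distinct (concat (map B [0..<machines A])) \<and>
        set (concat (map B [0..<machines A])) = X)"

text \<open>
  The output is what the machines hold after the last round.  The first conjunct says that the
  machines are able to store the input at all; without it an algorithm with too little total
  space would be correct vacuously.
\<close>

definition solves :: "mpc \<Rightarrow> nat list set \<Rightarrow> ((nat \<Rightarrow> nat list) \<Rightarrow> bool) \<Rightarrow> bool" where
  "solves A X Q \<longleftrightarrow>
     (\<exists>m. distribution A X m) \<and>
     (\<forall>m. distribution A X m \<longrightarrow> obeys_limits A m \<and> Q (memory A m (rounds A)))"

text \<open>
  An algorithm for all sizes is a family \<open>A :: nat \<Rightarrow> mpc\<close>; asymptotic conditions are taken along
  a filter \<open>F\<close> on the sizes.  For such a family the number of machines, the limits and the functions
  themselves may depend on the size in any way (non-uniform, deterministic algorithms).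
\<close>

definition sublinear_space :: "nat filter \<Rightarrow> (nat \<Rightarrow> mpc) \<Rightarrow> bool" where
  "sublinear_space F A \<longleftrightarrow>
     (\<exists>\<delta>>0. \<forall>\<^sub>F n in F. real (local_space (A n)) \<le> real n powr (1 - \<delta>))"

definition poly_bounded :: "nat filter \<Rightarrow> (nat \<Rightarrow> nat) \<Rightarrow> bool" where
  "poly_bounded F f \<longleftrightarrow> (\<exists>k. \<forall>\<^sub>F n in F. f n \<le> n ^ k)"


section \<open>The 1-vs-2-cycle conjecture\<close>

definition is_cycle :: "nat set \<Rightarrow> nat set set \<Rightarrow> bool" where
  "is_cycle V E \<longleftrightarrow>
     (\<exists>xs. distinct xs \<and> set xs = V \<and> length xs \<ge> 3 \<and>
           E = {{xs ! i, xs ! (Suc i mod length xs)} | i. i < length xs})"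

definition one_cycle :: "nat \<Rightarrow> nat set set \<Rightarrow> bool" where
  "one_cycle n E \<longleftrightarrow> is_cycle {..<2 * n} E"

definition two_cycles :: "nat \<Rightarrow> nat set set \<Rightarrow> bool" where
  "two_cycles n E \<longleftrightarrow>
     (\<exists>V\<^sub>1 V\<^sub>2 E\<^sub>1 E\<^sub>2. V\<^sub>1 \<union> V\<^sub>2 = {..<2 * n} \<and> V\<^sub>1 \<inter> V\<^sub>2 = {} \<and> card V\<^sub>1 = n \<and> card V\<^sub>2 = n \<and>
        is_cycle V\<^sub>1 E\<^sub>1 \<and> is_cycle V\<^sub>2 E\<^sub>2 \<and> E = E\<^sub>1 \<union> E\<^sub>2)"

definition graph_input :: "nat set set \<Rightarrow> nat list set" where
  "graph_input E = {[u, v] | u v. u < v \<and> {u, v} \<in> E}"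

text \<open>The answer is given by machine 0.\<close>

definition distinguishes_cycles :: "nat \<Rightarrow> mpc \<Rightarrow> bool" where
  "distinguishes_cycles n A \<longleftrightarrow>
     (\<forall>E. (one_cycle n E \<longrightarrow> solves A (graph_input E) (\<lambda>out. out 0 = [1])) \<and>
          (two_cycles n E \<longrightarrow> solves A (graph_input E) (\<lambda>out. out 0 = [0])))"

text \<open>
  \<open>N\<close> is the set of sizes on which the algorithm is run.  Polynomially bounded words are words of
  \<open>O(log n)\<close> bits.
\<close>

definition no_fast_cycle_algorithm_on :: "nat set \<Rightarrow> bool" where
  "no_fast_cycle_algorithm_on N \<longleftrightarrow>
     (let F = inf sequentially (principal N) in
      \<not> (\<exists>A :: nat \<Rightarrow> mpc.
           sublinear_space F A \<and>
           poly_bounded F (\<lambda>n. machines (A n)) \<and>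
           poly_bounded F (\<lambda>n. word_bound (A n)) \<and>
           (\<forall>\<^sub>F n in F. distinguishes_cycles n (A n)) \<and>
           (\<lambda>n. real (rounds (A n))) \<in> o[F](\<lambda>n. ln (real n))))"

definition one_vs_two_cycle_conjecture :: bool where
  "one_vs_two_cycle_conjecture \<longleftrightarrow> no_fast_cycle_algorithm_on UNIV"

text \<open>
  The conjecture above only refutes algorithms that are fast on all large sizes.  The following
  form also refutes algorithms that are fast only on some infinite set of sizes, i.e. it says that
  \<open>\<Omega>(log n)\<close> rounds, in the sense of a bound for all large \<open>n\<close>, are required.
\<close>

definition one_vs_two_cycle_conjecture_all_sizes :: bool where
  "one_vs_two_cycle_conjecture_all_sizes \<longleftrightarrow>
     (\<forall>N. infinite N \<longrightarrow> no_fast_cycle_algorithm_on N)"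


section \<open>Approximate minimum spanning trees of finite metrics\<close>

text \<open>Points are \<open>0, \<dots>, n - 1\<close>; distances are words, hence natural numbers.\<close>

definition is_metric :: "nat \<Rightarrow> (nat \<Rightarrow> nat \<Rightarrow> nat) \<Rightarrow> bool" where
  "is_metric n d \<longleftrightarrow> Metric_space {..<n} (\<lambda>i j. real (d i j))"

definition is_one_two_metric :: "nat \<Rightarrow> (nat \<Rightarrow> nat \<Rightarrow> nat) \<Rightarrow> bool" where
  "is_one_two_metric n d \<longleftrightarrow>
     is_metric n d \<and> (\<forall>i<n. \<forall>j<n. i \<noteq> j \<longrightarrow> d i j \<in> {1, 2})"

definition metric_input :: "nat \<Rightarrow> (nat \<Rightarrow> nat \<Rightarrow> nat) \<Rightarrow> nat list set" where
  "metric_input n d = {[i, j, d i j] | i j. i < j \<and> j < n}"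

definition spanning_tree :: "nat \<Rightarrow> nat set set \<Rightarrow> bool" where
  "spanning_tree n T \<longleftrightarrow>
     T \<subseteq> {{u, v} | u v. u < n \<and> v < n \<and> u \<noteq> v} \<and>
     (\<forall>u<n. \<forall>v<n. (u, v) \<in> {(x, y). {x, y} \<in> T}\<^sup>*) \<and>
     \<not> (\<exists>V C. is_cycle V C \<and> C \<subseteq> T)"

definition weight :: "(nat \<Rightarrow> nat \<Rightarrow> nat) \<Rightarrow> nat set set \<Rightarrow> nat" where
  "weight d T = (\<Sum>(i, j) | i < j \<and> {i, j} \<in> T. d i j)"

definition approx_mst :: "real \<Rightarrow> nat \<Rightarrow> (nat \<Rightarrow> nat \<Rightarrow> nat) \<Rightarrow> nat set set \<Rightarrow> bool" where
  "approx_mst \<epsilon> n d T \<longleftrightarrow>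
     spanning_tree n T \<and>
     real (weight d T) \<le> (1 + \<epsilon>) * real (Min (weight d ` {T'. spanning_tree n T'}))"

text \<open>
  Each machine outputs a list of edges, written as consecutive pairs of words; the tree is the
  union of these lists.
\<close>

definition outputs_edges :: "nat \<Rightarrow> (nat \<Rightarrow> nat list) \<Rightarrow> nat set set \<Rightarrow> bool" where
  "outputs_edges p out T \<longleftrightarrow>
     (\<exists>es :: nat \<Rightarrow> (nat \<times> nat) list.
        (\<forall>i<p. out i = concat (map (\<lambda>(u, v). [u, v]) (es i))) \<and>
        T = (\<Union>i<p. {{u, v} | u v. (u, v) \<in> set (es i)}))"

text \<open>
  \<open>P\<close> is the class of metrics on which the algorithm has to be correct, among those whose
  distances fit into a word.  Words must at least be able to name the points (and so, for
  \<open>n \<ge> 3\<close>, to hold the distances 1 and 2), as otherwise there might be no such metric at all.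
\<close>

definition computes_approx_mst ::
  "(nat \<Rightarrow> (nat \<Rightarrow> nat \<Rightarrow> nat) \<Rightarrow> bool) \<Rightarrow> real \<Rightarrow> nat \<Rightarrow> mpc \<Rightarrow> bool" where
  "computes_approx_mst P \<epsilon> n A \<longleftrightarrow>
     n \<le> word_bound A \<and>
     (\<forall>d. P n d \<and> (\<forall>i<n. \<forall>j<n. d i j < word_bound A) \<longrightarrow>
        solves A (metric_input n d)
          (\<lambda>out. \<exists>T. outputs_edges (machines A) out T \<and> approx_mst \<epsilon> n d T))"

end

theory Submission
  imports Defs "HOL-Combinatorics.Permutations"
begin

text \<open>
  A fast spanning tree algorithm is turned into a fast cycle algorithm.  The darts of the input graph
  form a permutation \<open>\<pi>\<close> on at most \<open>m\<close> points, and whether there are two cycles of length \<open>N\<close>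
  is read off from \<open>\<pi>\<^sup>N\<close>.  This power is computed by Horner's scheme in a base \<open>k\<close> that is a small
  power of \<open>1 / \<epsilon>\<close>, so that there are \<open>O(log N / log k)\<close> stages, each of which composes \<open>O(k)\<close>
  known permutations in as many rounds as the spanning tree algorithm takes, up to a constant.

  To compose them, unroll the composition \<open>g\<close> into \<open>m\<close> disjoint paths with \<open>L = O(k)\<close> vertices which
  go there and back; for each \<open>b\<close>, add one edge that closes the path of the \<open>a\<close> with \<open>g a = b\<close> into
  a cycle.  Give edges length 1 and all other pairs length 2.  An approximate minimum
  spanning tree is acyclic and misses at most \<open>1 + 2 \<epsilon> n\<close> edges.  Under a random relabelling of the
  vertices every edge of the cycle is missed with probability at least \<open>1 / L\<close>, but an edge of a
  given path, as there are \<open>m - 1\<close> isomorphic ones, with probability at most \<open>2 \<epsilon> n / (m - 1)\<close>, which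
  is much less.  So counting misses over polynomially many relabellings, all run in parallel,
  determines \<open>g\<close>; a union bound yields fixed relabellings that work for all inputs.

  The additive constant per stage is harmless because algorithms without communication do not
  exist, whence \<open>1 / \<epsilon>\<close> and \<open>k\<close> tend to infinity when the rounds are \<open>o(log (1 / \<epsilon>))\<close>.
\<close>

section \<open>Forests, components and approximate spanning trees\<close>

text \<open>An approximate tree may drop about \<open>2 * \<epsilon> * n\<close> edges wrongly, at
  places of its choice, so a single edge of a single run says nothing. Symmetry is the remedy:
  random labels hide which of many isomorphic edges is examined. The graphs have cyclomatic number
  1, and the one drop that this permits is spent on the cycle, so the paths share only the wrong
  drops. The gap between \<open>1 / L\<close> and \<open>2 * \<epsilon> * n / (m - 1)\<close>, with
  \<open>m\<close> about \<open>n / L\<close>, asks for a small \<open>\<epsilon> * L^2\<close>;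
  this limits the base \<open>k\<close>. Going there and back makes the instance for each
  \<open>b\<close> writable without knowing \<open>g\<close>: a distance depends on at most two bits
  of known permutations, the extra edge on \<open>b\<close> alone, and the examined edge of start
  \<open>a\<close> sits at the same place for all words. The price is that the graph has an unknown
  labelling; the union bound over all \<open>n!\<close> of them explains the \<open>n^2\<close> in
  the number of samples. Bits are copied and counted in trees of arity about
  \<open>n powr (1 - \<delta>)\<close>, whose height is constant.\<close>

definition reach :: "nat set set \<Rightarrow> (nat \<times> nat) set" where
  "reach T = {(x, y). {x, y} \<in> T}\<^sup>*"

definition acyclic_edges :: "nat set set \<Rightarrow> bool" where
  "acyclic_edges T \<longleftrightarrow> \<not> (\<exists>V C. is_cycle V C \<and> C \<subseteq> T)"

definition complete_edges :: "nat \<Rightarrow> nat set set" where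
  "complete_edges n = {{u, v} | u v. u < n \<and> v < n \<and> u \<noteq> v}"

lemma spanning_tree_alt:
  "spanning_tree n T \<longleftrightarrow>
     T \<subseteq> complete_edges n \<and> (\<forall>u<n. \<forall>v<n. (u, v) \<in> reach T) \<and> acyclic_edges T"
  unfolding spanning_tree_def complete_edges_def reach_def acyclic_edges_def by simp

lemma finite_complete_edges [simp]: "finite (complete_edges n)"
proof -
  have "complete_edges n \<subseteq> Pow {..<n}" unfolding complete_edges_def by auto
  then show ?thesis using finite_subset by blast
qed

lemma reach_refl [simp]: "(x, x) \<in> reach T"
  unfolding reach_def by simp

lemma reach_trans: "(x, y) \<in> reach T \<Longrightarrow> (y, z) \<in> reach T \<Longrightarrow> (x, z) \<in> reach T"
  unfolding reach_def by (rule rtrancl_trans)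

lemma reach_sym: "(x, y) \<in> reach T \<Longrightarrow> (y, x) \<in> reach T"
proof -
  have "sym {(x, y). {x, y} \<in> T}" by (auto simp: sym_def insert_commute)
  then show "(x, y) \<in> reach T \<Longrightarrow> (y, x) \<in> reach T"
    unfolding reach_def using sym_rtrancl symD by metis
qed

lemma reach_edge: "{x, y} \<in> T \<Longrightarrow> (x, y) \<in> reach T"
  unfolding reach_def by auto

lemma reach_mono: "S \<subseteq> T \<Longrightarrow> reach S \<subseteq> reach T"
  unfolding reach_def by (rule rtrancl_mono) auto

lemma reach_induct [consumes 1, case_names refl step]:
  assumes "(x, y) \<in> reach T" "P x"
    "\<And>y z. (x, y) \<in> reach T \<Longrightarrow> {y, z} \<in> T \<Longrightarrow> P y \<Longrightarrow> P z"
  shows "P y"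
  using assms(1) unfolding reach_def
proof (induction rule: rtrancl_induct)
  case base
  then show ?case using assms(2) .
next
  case (step y z)
  then show ?case using assms(3) unfolding reach_def by auto
qed

lemma reach_insert:
  "(x, y) \<in> reach (insert {u, v} T) \<longleftrightarrow>
     (x, y) \<in> reach T \<or> (x, u) \<in> reach T \<and> (v, y) \<in> reach T \<or>
     (x, v) \<in> reach T \<and> (u, y) \<in> reach T" (is "?L \<longleftrightarrow> ?R y")
proof
  show "?L \<Longrightarrow> ?R y"
  proof (induction rule: reach_induct)
    case refl
    then show ?case by simp
  next
    case (step y z)
    show ?case
    proof (cases "{y, z} \<in> T")
      case True
      then show ?thesis using step(3) reach_edge reach_trans by meson
    next
      case False
      then have "y = u \<and> z = v \<or> y = v \<and> z = u" using step(2) by (auto simp: doubleton_eq_iff)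
      then show ?thesis using step(3) by auto
    qed
  qed
next
  assume R: "?R y"
  have m: "reach T \<subseteq> reach (insert {u, v} T)" by (rule reach_mono) auto
  have e: "(u, v) \<in> reach (insert {u, v} T)" by (rule reach_edge) auto
  show ?L using R m e reach_sym[OF e] reach_trans by (meson subsetD)
qed

lemma reach_distinct_path:
  assumes "(u, v) \<in> reach T"
  shows "\<exists>xs. xs \<noteq> [] \<and> distinct xs \<and> hd xs = u \<and> last xs = v \<and>
           (\<forall>i. Suc i < length xs \<longrightarrow> {xs ! i, xs ! Suc i} \<in> T)"
  using assms
proof (induction rule: reach_induct)
  case refl
  show ?case by (rule exI[of _ "[u]"]) auto
next
  case (step y z)
  then obtain xs where xs: "xs \<noteq> []" "distinct xs" "hd xs = u" "last xs = y"
    and edges: "\<And>i. Suc i < length xs \<Longrightarrow> {xs ! i, xs ! Suc i} \<in> T" by blast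
  show ?case
  proof (cases "z \<in> set xs")
    case True
    then obtain k where k: "k < length xs" "xs ! k = z" by (auto simp: in_set_conv_nth)
    have "last (take (Suc k) xs) = z" using k by (simp add: take_Suc_conv_app_nth)
    then show ?thesis using xs k edges
      by (intro exI[of _ "take (Suc k) xs"]) (auto simp: hd_take)
  next
    case False
    have "{(xs @ [z]) ! i, (xs @ [z]) ! Suc i} \<in> T" if "Suc i < length (xs @ [z])" for i
    proof (cases "Suc i < length xs")
      case True
      then show ?thesis using edges by (simp add: nth_append)
    next
      case False
      then have "i = length xs - 1" "i < length xs" using that xs(1) by auto
      then have "(xs @ [z]) ! i = y" "(xs @ [z]) ! Suc i = z"
        using xs(1,4) by (auto simp: nth_append last_conv_nth)
      then show ?thesis using step(2) by simp
    qed
    then show ?thesis using xs False by (intro exI[of _ "xs @ [z]"]) auto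
  qed
qed

text \<open>The new edge closes a simple path from \<open>u\<close> to \<open>v\<close>. That path
  has at least three vertices: one vertex would give \<open>u = v\<close>, and two would put
  \<open>{u, v}\<close> into \<open>T\<close>.\<close>

lemma ex_cycle_insert:
  assumes "(u, v) \<in> reach T" "u \<noteq> v" "{u, v} \<notin> T"
  shows "\<exists>V C. is_cycle V C \<and> C \<subseteq> insert {u, v} T"
proof -
  obtain xs where xs: "xs \<noteq> []" "distinct xs" "hd xs = u" "last xs = v"
    and edges: "\<And>i. Suc i < length xs \<Longrightarrow> {xs ! i, xs ! Suc i} \<in> T"
    using reach_distinct_path[OF assms(1)] by blast
  have u: "u = xs ! 0" using xs by (simp add: hd_conv_nth)
  have v: "v = xs ! (length xs - 1)" using xs by (simp add: last_conv_nth)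
  have l1: "length xs \<noteq> 1" using u v assms(2) by auto
  have l2: "length xs \<noteq> 2" using u v assms(3) edges[of 0] by auto
  have "length xs \<noteq> 0" using xs(1) by simp
  then have l: "length xs \<ge> 3" using l1 l2 by linarith
  let ?C = "{{xs ! i, xs ! (Suc i mod length xs)} | i. i < length xs}"
  have "{xs ! i, xs ! (Suc i mod length xs)} \<in> insert {u, v} T" if "i < length xs" for i
  proof (cases "Suc i < length xs")
    case True
    then show ?thesis using edges by simp
  next
    case False
    then have i: "i = length xs - 1" "Suc i = length xs" using that by auto
    have "Suc i mod length xs = 0" using i(2) by simp
    then show ?thesis using u v i(1) by auto
  qed
  then have "?C \<subseteq> insert {u, v} T" by blast
  moreover have "is_cycle (set xs) ?C" unfolding is_cycle_def using xs(2) l by blast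
  ultimately show ?thesis by blast
qed

lemma mod_add_left_cancel:
  "(i + a) mod L = (i + b) mod L \<Longrightarrow> a mod L = b mod (L :: nat)"
  by (simp add: nat_mod_eq_iff add.assoc)

text \<open>The cycle must use \<open>{u, v}\<close>, and its remaining edges lead round from one
  end of it to the other inside \<open>T\<close>.\<close>

lemma reach_of_cycle:
  assumes "is_cycle V C" "C \<subseteq> insert {u, v} T" "\<not> C \<subseteq> T"
  shows "(u, v) \<in> reach T"
proof -
  obtain xs where xs: "distinct xs" "length xs \<ge> 3"
    and C: "C = {{xs ! i, xs ! (Suc i mod length xs)} | i. i < length xs}"
    using assms(1) unfolding is_cycle_def by blast
  let ?L = "length xs"
  have "{u, v} \<in> C" using assms(2,3) by blast
  then obtain i where i: "i < ?L" "{u, v} = {xs ! i, xs ! (Suc i mod ?L)}" using C by blast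
  \<comment> \<open>Position \<open>i\<close> holds the edge \<open>{u, v}\<close>. The
    \<open>length xs - 1\<close> edges after it differ from it as sets; that the same two vertices
    recur in the opposite order is excluded by the length being at least 3.\<close>
  have step: "{xs ! ((Suc i + j) mod ?L), xs ! (Suc (Suc i + j) mod ?L)} \<in> T" if j: "Suc j < ?L" for j
  proof -
    let ?p = "(Suc i + j) mod ?L" and ?q = "Suc (Suc i + j) mod ?L"
    have pq: "?p < ?L" "?q < ?L" using i(1) by (auto intro!: mod_less_divisor)
    have "Suc ?p mod ?L = ?q" by (simp add: mod_Suc_eq)
    moreover have "{xs ! ?p, xs ! (Suc ?p mod ?L)} \<in> C" using C pq(1) by blast
    ultimately have inC: "{xs ! ?p, xs ! ?q} \<in> C" by (rule subst)
    have "?p \<noteq> i"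
    proof
      assume "?p = i"
      then have "(Suc i + j) mod ?L = i mod ?L" using i(1) by simp
      then have "(i + Suc j) mod ?L = (i + 0) mod ?L" by simp
      then have "Suc j mod ?L = 0 mod ?L" by (metis mod_add_left_cancel)
      then show False using j by simp
    qed
    moreover have "?p = Suc i mod ?L \<Longrightarrow> ?q \<noteq> i"
    proof
      assume p: "?p = Suc i mod ?L" and q: "?q = i"
      have "(Suc i + j) mod ?L = (Suc i + 0) mod ?L" using p by simp
      then have "j mod ?L = 0 mod ?L" by (metis mod_add_left_cancel)
      then have j0: "j = 0" using j by simp
      have "(i + 2) mod ?L = (i + 0) mod ?L" using q i(1) j0 by simp
      then have "2 mod ?L = 0 mod ?L" by (metis mod_add_left_cancel)
      then show False using xs(2) by simp
    qed
    moreover have "Suc i mod ?L < ?L" using i(1) by (auto intro!: mod_less_divisor)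
    ultimately have "{xs ! ?p, xs ! ?q} \<noteq> {u, v}"
      unfolding i(2) using pq i(1) xs(1) by (auto simp: doubleton_eq_iff nth_eq_iff_index_eq)
    then show ?thesis using inC assms(2) by blast
  qed
  have "(xs ! (Suc i mod ?L), xs ! ((Suc i + j) mod ?L)) \<in> reach T" if "j < ?L" for j
    using that
  proof (induction j)
    case 0
    then show ?case by simp
  next
    case (Suc j)
    then have 1: "(xs ! (Suc i mod ?L), xs ! ((Suc i + j) mod ?L)) \<in> reach T" by simp
    have 2: "(xs ! ((Suc i + j) mod ?L), xs ! (Suc (Suc i + j) mod ?L)) \<in> reach T"
      using step Suc.prems by (intro reach_edge) auto
    show ?case using reach_trans[OF 1 2] by (simp only: add_Suc_right)
  qed
  from this[of "?L - 1"] have "(xs ! (Suc i mod ?L), xs ! ((Suc i + (?L - 1)) mod ?L)) \<in> reach T"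
    using xs(2) by simp
  moreover have "Suc i + (?L - 1) = i + ?L" using xs(2) by simp
  then have "(Suc i + (?L - 1)) mod ?L = i" using i(1) by simp
  ultimately have "(xs ! (Suc i mod ?L), xs ! i) \<in> reach T" by simp
  then show ?thesis using i(2) reach_sym by (auto simp: doubleton_eq_iff)
qed

lemma acyclic_edges_empty [simp]: "acyclic_edges {}"
proof -
  have "C \<noteq> {}" if cyc: "is_cycle V C" for V C
  proof -
    obtain xs where "length xs \<ge> 3" "C = {{xs ! i, xs ! (Suc i mod length xs)} | i. i < length xs}"
      using cyc unfolding is_cycle_def by blast
    moreover from this(1) have "0 < length xs" by linarith
    ultimately show ?thesis by blast
  qed
  then show ?thesis unfolding acyclic_edges_def by auto
qed

lemma acyclic_edges_subset: "acyclic_edges T \<Longrightarrow> S \<subseteq> T \<Longrightarrow> acyclic_edges S"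
  unfolding acyclic_edges_def by blast

lemma acyclic_edges_insertI:
  "acyclic_edges T \<Longrightarrow> (u, v) \<notin> reach T \<Longrightarrow> acyclic_edges (insert {u, v} T)"
  using reach_of_cycle unfolding acyclic_edges_def by blast

lemma acyclic_edges_insertD:
  "acyclic_edges (insert {u, v} T) \<Longrightarrow> {u, v} \<notin> T \<Longrightarrow> u \<noteq> v \<Longrightarrow> (u, v) \<notin> reach T"
  using ex_cycle_insert unfolding acyclic_edges_def by blast

text \<open>Components are represented by their least elements; isolated vertices are components as
  well.\<close>

definition roots :: "nat \<Rightarrow> nat set set \<Rightarrow> nat set" where
  "roots n T = {x. x < n \<and> (\<forall>y. (x, y) \<in> reach T \<longrightarrow> x \<le> y)}"

lemma roots_empty: "roots n {} = {..<n}"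
  unfolding roots_def reach_def by auto

lemma finite_roots [simp]: "finite (roots n T)"
  unfolding roots_def by auto

lemma ex_root:
  assumes "u < n"
  shows "\<exists>a\<in>roots n T. (u, a) \<in> reach T"
proof -
  let ?a = "LEAST y. (u, y) \<in> reach T"
  have a: "(u, ?a) \<in> reach T" by (rule LeastI[of _ u]) simp
  have min: "?a \<le> y" if "(u, y) \<in> reach T" for y using that by (rule Least_le)
  have "?a \<le> u" using min[of u] by simp
  moreover have "?a \<le> y" if "(?a, y) \<in> reach T" for y using min reach_trans[OF a that] by blast
  ultimately show ?thesis using a assms unfolding roots_def by (intro bexI[of _ ?a]) auto
qed

lemma roots_unique: "a \<in> roots n T \<Longrightarrow> b \<in> roots n T \<Longrightarrow> (a, b) \<in> reach T \<Longrightarrow> a = b"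
  using reach_sym[of a b T] unfolding roots_def by (force intro: le_antisym)

text \<open>When two components merge, the larger of their minima disappears and no other minimum is
  affected.\<close>

lemma roots_insert_not_reach:
  assumes "u < n" "v < n" "(u, v) \<notin> reach T"
  shows "\<exists>z\<in>roots n T. roots n (insert {u, v} T) = roots n T - {z}"
proof -
  have main: "\<exists>z\<in>roots n T. roots n (insert {u, v} T) = roots n T - {z}"
    if a: "a \<in> roots n T" "(u, a) \<in> reach T" and b: "b \<in> roots n T" "(v, b) \<in> reach T"
      and ab: "a < b" for a b u v
  proof (intro bexI[of _ b] set_eqI iffI)
    fix x assume x: "x \<in> roots n (insert {u, v} T)"
    have m: "reach T \<subseteq> reach (insert {u, v} T)" by (rule reach_mono) auto
    then have "x \<in> roots n T" using x unfolding roots_def by auto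
    moreover have "(b, a) \<in> reach (insert {u, v} T)"
      unfolding reach_insert using a(2) reach_sym[OF b(2)] by blast
    then have "x \<noteq> b" using x ab unfolding roots_def by auto
    ultimately show "x \<in> roots n T - {b}" by simp
  next
    fix x assume x: "x \<in> roots n T - {b}"
    have "x \<le> y" if xy: "(x, y) \<in> reach (insert {u, v} T)" for y
    proof -
      consider "(x, y) \<in> reach T" | "(x, u) \<in> reach T" "(v, y) \<in> reach T" | "(x, v) \<in> reach T"
        using xy unfolding reach_insert by blast
      then show ?thesis
      proof cases
        case 1
        then show ?thesis using x unfolding roots_def by auto
      next
        case 2
        have "x = a" using roots_unique x a reach_trans[OF 2(1) a(2)] by blast
        moreover have "b \<le> y" using b(1) reach_trans[OF reach_sym[OF b(2)] 2(2)]
          unfolding roots_def by auto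
        ultimately show ?thesis using ab by simp
      next
        case 3
        then have "x = b" using roots_unique x b reach_trans[OF 3 b(2)] by blast
        then show ?thesis using x by simp
      qed
    qed
    then show "x \<in> roots n (insert {u, v} T)" using x unfolding roots_def by auto
  next
    show "b \<in> roots n T" using b by simp
  qed
  obtain a where a: "a \<in> roots n T" "(u, a) \<in> reach T" using ex_root assms(1) by blast
  obtain b where b: "b \<in> roots n T" "(v, b) \<in> reach T" using ex_root assms(2) by blast
  have "a \<noteq> b" using assms(3) reach_trans[OF a(2)] reach_sym[OF b(2)] by auto
  then consider "a < b" | "b < a" by linarith
  then show ?thesis
  proof cases
    case 1
    then show ?thesis using main[OF a b] by simp
  next
    case 2
    then show ?thesis using main[OF b a] by (simp add: insert_commute)
  qed
qed

lemma complete_edgesE: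
  assumes "e \<in> complete_edges n"
  obtains u v where "e = {u, v}" "u < n" "v < n" "u \<noteq> v"
  using assms unfolding complete_edges_def by blast

text \<open>Each new edge of a forest joins two different components, so it lowers the number of
  components, initially \<open>n\<close>, by one.\<close>

lemma card_roots_acyclic:
  assumes "T \<subseteq> complete_edges n" "acyclic_edges T"
  shows "card (roots n T) + card T = n"
proof -
  have "finite T" using assms(1) finite_complete_edges finite_subset by blast
  then show ?thesis using assms
  proof (induction T)
    case empty
    then show ?case by (simp add: roots_empty)
  next
    case (insert e T)
    have "e \<in> complete_edges n" using insert.prems by simp
    then obtain u v where e: "e = {u, v}" "u < n" "v < n" "u \<noteq> v" by (rule complete_edgesE)
    have nr: "(u, v) \<notin> reach T" using acyclic_edges_insertD insert e by blast
    then obtain z where z: "z \<in> roots n T" "roots n (insert e T) = roots n T - {z}"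
      using roots_insert_not_reach[OF e(2,3)] e(1) by blast
    then have "Suc (card (roots n (insert e T))) = card (roots n T)"
      using card_Suc_Diff1[OF finite_roots z(1)] by simp
    moreover have "card (roots n T) + card T = n"
      using insert.IH insert.prems acyclic_edges_subset[OF insert.prems(2)] by blast
    ultimately show ?case using insert by simp
  qed
qed

lemma card_roots_connected:
  assumes "\<forall>u<n. \<forall>v<n. (u, v) \<in> reach T" "n > 0"
  shows "card (roots n T) = 1"
proof -
  obtain a where a: "a \<in> roots n T" using ex_root assms(2) by blast
  have "roots n T = {a}" using a roots_unique[OF _ a] assms(1) unfolding roots_def by blast
  then show ?thesis by simp
qed

lemma card_roots_le:
  assumes "finite W" "\<And>x. x < n \<Longrightarrow> \<exists>w\<in>W. (x, w) \<in> reach T"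
  shows "card (roots n T) \<le> card W"
proof -
  obtain f where f: "\<And>x. x < n \<Longrightarrow> f x \<in> W \<and> (x, f x) \<in> reach T" using assms(2) by metis
  have "inj_on f (roots n T)"
  proof (rule inj_onI)
    fix x y assume x: "x \<in> roots n T" and y: "y \<in> roots n T" and "f x = f y"
    then have "(x, y) \<in> reach T" using f reach_trans reach_sym unfolding roots_def
      by (metis (no_types, lifting) mem_Collect_eq)
    then show "x = y" using roots_unique x y by blast
  qed
  moreover have "f ` roots n T \<subseteq> W" using f unfolding roots_def by auto
  ultimately show ?thesis using card_inj_on_le assms(1) by blast
qed

lemma spanning_tree_card:
  assumes "spanning_tree n T" "n > 0"
  shows "card T = n - 1"
  using card_roots_acyclic[of T n] card_roots_connected[of n T] assms
  unfolding spanning_tree_alt by simp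

text \<open>For a maximal acyclic set between \<open>F0\<close> and \<open>H\<close>, no edge of
  \<open>H\<close> can join two of its components. This serves twice below: from the empty set it
  gives a spanning forest of a graph, and from that forest a spanning tree of the complete
  graph.\<close>

lemma ex_maximal_acyclic:
  assumes "H \<subseteq> complete_edges n" "F0 \<subseteq> H" "acyclic_edges F0"
  shows "\<exists>F. F0 \<subseteq> F \<and> F \<subseteq> H \<and> acyclic_edges F \<and> reach F = reach H"
proof -
  have finH: "finite H" using assms(1) finite_complete_edges finite_subset by blast
  define A where "A = {F. F0 \<subseteq> F \<and> F \<subseteq> H \<and> acyclic_edges F}"
  have "finite A" unfolding A_def using finH by (auto intro: finite_subset[of _ "Pow H"])
  moreover have "F0 \<in> A" unfolding A_def using assms by simp
  ultimately obtain F where FA: "F \<in> A" and max: "\<And>F'. F' \<in> A \<Longrightarrow> F \<subseteq> F' \<Longrightarrow> F = F'"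
    using finite_has_maximal2[of A F0] by metis
  have F: "F0 \<subseteq> F" "F \<subseteq> H" "acyclic_edges F" using FA unfolding A_def by auto
  have "(x, y) \<in> reach F" if "(x, y) \<in> reach H" for x y
    using that
  proof (induction rule: reach_induct)
    case refl
    then show ?case by simp
  next
    case (step y z)
    have "(y, z) \<in> reach F"
    proof (rule ccontr)
      assume nr: "(y, z) \<notin> reach F"
      then have "insert {y, z} F \<in> A" unfolding A_def using F step(2) acyclic_edges_insertI by auto
      then have "F = insert {y, z} F" using max by blast
      then show False using nr reach_edge by blast
    qed
    then show ?case using step(3) reach_trans by blast
  qed
  then have "reach F = reach H" using reach_mono[OF F(2)] by auto
  then show ?thesis using F by blast
qed

section \<open>Trees in metrics with distances 1 and 2\<close>

definition dist_of :: "nat set set \<Rightarrow> nat \<Rightarrow> nat \<Rightarrow> nat" where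
  "dist_of H x y = (if x = y then 0 else if {x, y} \<in> H then 1 else 2)"

lemma dist_of_one_two_metric: "is_one_two_metric n (dist_of H)"
  unfolding is_one_two_metric_def is_metric_def dist_of_def
  by (auto intro!: Metric_space.intro simp: insert_commute split: if_splits)

text \<open>Each edge of \<open>T\<close> contributes 2, less 1 if it lies in \<open>H\<close>. The
  subtraction is moved to the other side to stay in \<open>nat\<close>.\<close>

lemma weight_dist_of:
  assumes "T \<subseteq> complete_edges n"
  shows "weight (dist_of H) T + card (T \<inter> H) = 2 * card T"
proof -
  have fin: "finite T" using assms finite_complete_edges finite_subset by blast
  let ?S = "{(i, j). i < j \<and> {i, j} \<in> T}"
  have bij: "bij_betw (\<lambda>(i, j). {i, j}) ?S T"
    unfolding bij_betw_def
  proof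
    show "inj_on (\<lambda>(i, j). {i, j}) ?S" by (auto simp: inj_on_def doubleton_eq_iff)
    show "(\<lambda>(i, j). {i, j}) ` ?S = T"
    proof (intro equalityI subsetI)
      fix e assume e: "e \<in> T"
      then have "e \<in> complete_edges n" using assms by blast
      then obtain u v where uv: "e = {u, v}" "u \<noteq> v" by (rule complete_edgesE)
      then have "e = {min u v, max u v}" "min u v < max u v" by (auto simp: min_def max_def)
      then show "e \<in> (\<lambda>(i, j). {i, j}) ` ?S" using e by (intro image_eqI[of _ _ "(min u v, max u v)"]) auto
    qed auto
  qed
  have "weight (dist_of H) T = (\<Sum>p\<in>?S. if (\<lambda>(i, j). {i, j}) p \<in> H then 1 else 2)"
    unfolding weight_def by (intro sum.cong) (auto simp: dist_of_def)
  also have "\<dots> = (\<Sum>e\<in>T. if e \<in> H then 1 else (2 :: nat))"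
    by (rule sum.reindex_bij_betw[OF bij])
  also have "\<dots> + card (T \<inter> H) = (\<Sum>e\<in>T. (if e \<in> H then 1 else 2) + (if e \<in> H then 1 else 0))"
    unfolding sum.distrib using fin by (simp add: sum.If_cases Int_def)
  also have "\<dots> = (\<Sum>e\<in>T. 2)" by (intro sum.cong) auto
  also have "\<dots> = 2 * card T" by simp
  finally show ?thesis .
qed

text \<open>The term \<open>card H + card (roots n H) - n\<close> is the cyclomatic number of
  \<open>H\<close>, the number of edges that a spanning forest has to drop. A tree extending such a
  forest drops no more, and it weighs at most \<open>2 * n\<close>, so the approximation has slack
  \<open>2 * \<epsilon> * n\<close>; each further dropped edge is replaced by one of length 2 and
  costs 1.\<close>

lemma approx_mst_dropped:
  assumes mst: "approx_mst \<epsilon> n (dist_of H) T" and H: "H \<subseteq> complete_edges n"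
    and n: "n > 0" and eps: "\<epsilon> \<ge> 0"
  shows "real (card (H - T)) \<le> real (card H) + real (card (roots n H)) - real n + 2 * \<epsilon> * real n"
proof -
  have T: "spanning_tree n T"
    and wT: "real (weight (dist_of H) T) \<le>
       (1 + \<epsilon>) * real (Min (weight (dist_of H) ` {T'. spanning_tree n T'}))"
    using mst unfolding approx_mst_def by auto
  obtain F where F: "F \<subseteq> H" "acyclic_edges F" "reach F = reach H"
    using ex_maximal_acyclic[OF H, of "{}"] by auto
  have "H - T \<subseteq> H" by simp
  have "reach H \<subseteq> reach (complete_edges n)" using H by (rule reach_mono)
  obtain T' where T': "F \<subseteq> T'" "T' \<subseteq> complete_edges n" "acyclic_edges T'"
      "reach T' = reach (complete_edges n)"
    using ex_maximal_acyclic[of "complete_edges n" n F] F H by auto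
  have "(u, v) \<in> reach (complete_edges n)" if "u < n" "v < n" for u v
    using that reach_edge[of u v "complete_edges n"] unfolding complete_edges_def
    by (cases "u = v") auto
  then have sT': "spanning_tree n T'" unfolding spanning_tree_alt using T' by auto
  have fin: "finite {T'. spanning_tree n T'}"
    by (rule finite_subset[of _ "Pow (complete_edges n)"]) (auto simp: spanning_tree_alt)
  have "Min (weight (dist_of H) ` {T'. spanning_tree n T'}) \<le> weight (dist_of H) T'"
    using fin sT' by (intro Min_le) auto
  then have w1: "real (weight (dist_of H) T) \<le> (1 + \<epsilon>) * real (weight (dist_of H) T')"
    using wT eps by (smt (verit) mult_left_mono of_nat_le_iff)
  have cF: "card (roots n H) + card F = n"
    using card_roots_acyclic[of F n] F H unfolding roots_def by auto
  have "card F \<le> card (T' \<inter> H)"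
    using F T' finite_subset[OF T'(2)] by (intro card_mono) auto
  then have w2: "weight (dist_of H) T' + card F \<le> 2 * (n - 1)"
    using weight_dist_of[OF T'(2), of H] spanning_tree_card[OF sT' n] by simp
  have TK: "T \<subseteq> complete_edges n" using T unfolding spanning_tree_alt by simp
  have w3: "weight (dist_of H) T + card (T \<inter> H) = 2 * (n - 1)"
    using weight_dist_of[OF TK, of H] spanning_tree_card[OF T n] by simp
  have finH: "finite H" using H finite_complete_edges finite_subset by blast
  have "H - T = H - (T \<inter> H)" by auto
  then have cHT: "real (card (H - T)) = real (card H) - real (card (T \<inter> H))"
    using finH by (simp add: card_Diff_subset card_mono of_nat_diff)
  have "real (weight (dist_of H) T') \<le> 2 * real n" using w2 by linarith
  then have "\<epsilon> * real (weight (dist_of H) T') \<le> 2 * \<epsilon> * real n"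
    using mult_left_mono[OF _ eps] by fastforce
  then have "real (weight (dist_of H) T) \<le> real (weight (dist_of H) T') + 2 * \<epsilon> * real n"
    using w1 by (simp add: algebra_simps)
  then show ?thesis using cHT w2 w3 cF by linarith
qed

section \<open>Concentration of independent samples\<close>

lemma exp_moment_sum:
  fixes g :: "'s \<Rightarrow> real"
  assumes "finite P"
  shows "(\<Sum>s\<in>PiE {..<R} (\<lambda>_. P). \<Prod>i<R. g (s i)) = (\<Sum>\<sigma>\<in>P. g \<sigma>) ^ R"
proof -
  have "(\<Prod>i<R. \<Sum>\<sigma>\<in>P. g \<sigma>) = (\<Sum>s\<in>PiE {..<R} (\<lambda>_. P). \<Prod>i<R. g (s i))"
    using assms by (intro prod_sum_PiE) auto
  then show ?thesis by simp
qed

lemma card_PiE_const: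
  "finite P \<Longrightarrow> card (PiE {..<R::nat} (\<lambda>_. P)) = card P ^ R"
  by (subst card_PiE) auto

text \<open>
  Exponential moments: \<open>c ^ count\<close> has mean \<open>(1 + (c - 1) p)^R\<close> over independent samples that hit
  with probability \<open>p\<close>; \<open>c = 2\<close> bounds the upper tail and \<open>c = 1/2\<close> the lower one.
\<close>

lemma moment_count:
  fixes c :: real
  assumes "finite P"
  shows "(\<Sum>s\<in>PiE {..<R} (\<lambda>_. P). c ^ card {i. i < R \<and> X (s i)}) =
         (real (card P) + (c - 1) * real (card {\<sigma>\<in>P. X \<sigma>})) ^ R"
proof -
  have "c ^ card {i. i < R \<and> X (s i)} = (\<Prod>i<R. if X (s i) then c else 1)" for s :: "nat \<Rightarrow> 'a"
  proof -
    have "(\<Prod>i<R. if X (s i) then c else 1) = (\<Prod>i\<in>{..<R} \<inter> {i. X (s i)}. c)"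
      by (subst prod.If_cases) auto
    also have "\<dots> = c ^ card ({..<R} \<inter> {i. X (s i)})" by simp
    also have "{..<R} \<inter> {i. X (s i)} = {i. i < R \<and> X (s i)}" by auto
    finally show ?thesis by simp
  qed
  then have "(\<Sum>s\<in>PiE {..<R} (\<lambda>_. P). c ^ card {i. i < R \<and> X (s i)}) =
      (\<Sum>\<sigma>\<in>P. if X \<sigma> then c else 1) ^ R"
    using exp_moment_sum[OF assms, of "\<lambda>\<sigma>. if X \<sigma> then c else 1" R] by simp
  also have "(\<Sum>\<sigma>\<in>P. if X \<sigma> then c else 1) = (\<Sum>\<sigma>\<in>P. 1 + (c - 1) * (if X \<sigma> then 1 else 0))"
    by (intro sum.cong) auto
  also have "\<dots> = real (card P) + (c - 1) * (\<Sum>\<sigma>\<in>P. if X \<sigma> then 1 else 0)"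
    by (simp add: sum.distrib sum_distrib_left)
  also have "(\<Sum>\<sigma>\<in>P. if X \<sigma> then 1 else 0) = real (card {\<sigma>\<in>P. X \<sigma>})"
    using assms by (simp add: sum.If_cases Int_def)
  finally show ?thesis .
qed

lemma exp_one_le_4: "exp (1 :: real) \<le> 4"
  using exp_le by linarith

text \<open>At most \<open>80 * L * K / (16 * L) = 5 * K\<close> hits are expected. Markov's
  inequality for \<open>2 ^ count\<close> gives the factor
  \<open>exp (5 * K) / 2 ^ (20 * K)\<close>, and \<open>2 ^ (20 * K) = 4 ^ (10 * K)\<close> is at
  least \<open>exp (10 * K)\<close>.\<close>

lemma upper_tail:
  fixes L K :: nat
  assumes "finite P" and L: "L > 0"
    and low: "16 * L * card {\<sigma>\<in>P. X \<sigma>} \<le> card P"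
  shows "real (card {s\<in>PiE {..<80 * L * K} (\<lambda>_. P). 20 * K \<le> card {i. i < 80 * L * K \<and> X (s i)}})
         \<le> real (card P) ^ (80 * L * K) * exp (- 5 * real K)"
proof -
  let ?R = "80 * L * K" and ?\<Omega> = "PiE {..<80 * L * K} (\<lambda>_. P)"
  let ?cnt = "\<lambda>s. card {i. i < ?R \<and> X (s i)}"
  let ?B = "{s\<in>?\<Omega>. 20 * K \<le> ?cnt s}"
  have fin: "finite ?\<Omega>" using assms(1) by (intro finite_PiE) auto
  have "real (card ?B) * 2 ^ (20 * K) = (\<Sum>s\<in>?B. 2 ^ (20 * K))" by simp
  also have "\<dots> \<le> (\<Sum>s\<in>?B. 2 ^ ?cnt s)" by (intro sum_mono power_increasing) auto
  also have "\<dots> \<le> (\<Sum>s\<in>?\<Omega>. 2 ^ ?cnt s)" using fin by (intro sum_mono2) auto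
  also have "\<dots> = (real (card P) + (2 - 1) * real (card {\<sigma>\<in>P. X \<sigma>})) ^ ?R"
    by (rule moment_count[OF assms(1)])
  also have "\<dots> \<le> (real (card P) * exp (1 / (16 * L))) ^ ?R"
  proof (intro power_mono)
    have "real (16 * L * card {\<sigma>\<in>P. X \<sigma>}) \<le> real (card P)" using low of_nat_le_iff by blast
    then have "real (card {\<sigma>\<in>P. X \<sigma>}) \<le> real (card P) / (16 * L)"
      using L by (simp add: field_simps)
    then have "real (card P) + (2 - 1) * real (card {\<sigma>\<in>P. X \<sigma>}) \<le> real (card P) * (1 + 1 / (16 * L))"
      by (simp add: algebra_simps)
    also have "\<dots> \<le> real (card P) * exp (1 / (16 * L))"
      by (intro mult_left_mono exp_ge_add_one_self) auto
    finally show "real (card P) + (2 - 1) * real (card {\<sigma>\<in>P. X \<sigma>}) \<le> real (card P) * exp (1 / (16 * L))" .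
  qed auto
  also have "\<dots> = real (card P) ^ ?R * exp (5 * real K)"
    using L by (simp add: power_mult_distrib flip: exp_of_nat_mult)
  finally have 1: "real (card ?B) * 2 ^ (20 * K) \<le> real (card P) ^ ?R * exp (5 * real K)" .
  have "exp (10 * real K) = exp 1 ^ (10 * K)" by (simp flip: exp_of_nat_mult)
  also have "\<dots> \<le> 4 ^ (10 * K)" using exp_one_le_4 by (intro power_mono) auto
  also have "\<dots> = (2 ^ 2) ^ (10 * K)" by simp
  also have "\<dots> = 2 ^ (20 * K)" unfolding power_mult[symmetric] by simp
  finally have "real (card ?B) * exp (10 * real K) \<le> real (card ?B) * 2 ^ (20 * K)"
    by (intro mult_left_mono) auto
  then have "real (card ?B) * exp (10 * real K) \<le> real (card P) ^ ?R * exp (5 * real K)" using 1 by linarith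
  then have "real (card ?B) * exp (10 * real K) * exp (- 10 * real K)
      \<le> real (card P) ^ ?R * exp (5 * real K) * exp (- 10 * real K)"
    by (intro mult_right_mono) auto
  then show ?thesis by (simp add: mult.assoc flip: exp_add)
qed

text \<open>Here at least \<open>80 * K\<close> hits are expected. The mean of
  \<open>(1/2) ^ count\<close> is at most \<open>exp (- 40 * K)\<close>, of which Markov's
  inequality gives back \<open>2 ^ (20 * K)\<close>, at most \<open>exp (20 * K)\<close>. The result
  is weakened to the form of \<open>upper_tail\<close>.\<close>

lemma lower_tail:
  fixes L K :: nat
  assumes "finite P" and L: "L > 0"
    and high: "card P \<le> L * card {\<sigma>\<in>P. X \<sigma>}"
  shows "real (card {s\<in>PiE {..<80 * L * K} (\<lambda>_. P). card {i. i < 80 * L * K \<and> X (s i)} < 20 * K})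
         \<le> real (card P) ^ (80 * L * K) * exp (- 5 * real K)"
proof -
  let ?R = "80 * L * K" and ?\<Omega> = "PiE {..<80 * L * K} (\<lambda>_. P)"
  let ?cnt = "\<lambda>s. card {i. i < ?R \<and> X (s i)}"
  let ?B = "{s\<in>?\<Omega>. ?cnt s < 20 * K}"
  have fin: "finite ?\<Omega>" using assms(1) by (intro finite_PiE) auto
  have "real (card ?B) * (1/2) ^ (20 * K) = (\<Sum>s\<in>?B. (1/2) ^ (20 * K))" by simp
  also have "\<dots> \<le> (\<Sum>s\<in>?B. (1/2) ^ ?cnt s)" by (intro sum_mono power_decreasing) auto
  also have "\<dots> \<le> (\<Sum>s\<in>?\<Omega>. (1/2) ^ ?cnt s)" using fin by (intro sum_mono2) auto
  also have "\<dots> = (real (card P) + (1/2 - 1) * real (card {\<sigma>\<in>P. X \<sigma>})) ^ ?R"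
    by (rule moment_count[OF assms(1)])
  also have "\<dots> \<le> (real (card P) * exp (- (1 / (2 * L)))) ^ ?R"
  proof (intro power_mono)
    have "real (card P) \<le> real (L * card {\<sigma>\<in>P. X \<sigma>})" using high of_nat_le_iff by blast
    then have "real (card P) / L \<le> real (card {\<sigma>\<in>P. X \<sigma>})"
      using L by (simp add: field_simps)
    then have "real (card P) + (1/2 - 1) * real (card {\<sigma>\<in>P. X \<sigma>}) \<le> real (card P) * (1 + - (1 / (2 * L)))"
      by (simp add: algebra_simps)
    also have "\<dots> \<le> real (card P) * exp (- (1 / (2 * L)))"
      by (intro mult_left_mono exp_ge_add_one_self) auto
    finally show "real (card P) + (1/2 - 1) * real (card {\<sigma>\<in>P. X \<sigma>}) \<le> real (card P) * exp (- (1 / (2 * L)))" .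
    have "card {\<sigma>\<in>P. X \<sigma>} \<le> card P" using assms(1) by (intro card_mono) auto
    then show "0 \<le> real (card P) + (1/2 - 1) * real (card {\<sigma>\<in>P. X \<sigma>})" by simp
  qed
  also have "\<dots> = real (card P) ^ ?R * exp (- 40 * real K)"
    using L by (simp add: power_mult_distrib flip: exp_of_nat_mult)
  finally have 1: "real (card ?B) * (1/2) ^ (20 * K) \<le> real (card P) ^ ?R * exp (- 40 * real K)" .
  have "(2::real) \<le> exp 1" using exp_ge_add_one_self[of 1] by simp
  then have "(2::real) ^ (20 * K) \<le> exp 1 ^ (20 * K)" by (intro power_mono) auto
  also have "\<dots> = exp (20 * real K)" by (simp flip: exp_of_nat_mult)
  finally have 2: "(2::real) ^ (20 * K) \<le> exp (20 * real K)" .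
  have "real (card ?B) = real (card ?B) * (1/2) ^ (20 * K) * 2 ^ (20 * K)"
    by (simp add: power_one_over)
  also have "\<dots> \<le> (real (card P) ^ ?R * exp (- 40 * real K)) * exp (20 * real K)"
    by (rule mult_mono[OF 1 2]) auto
  also have "\<dots> = real (card P) ^ ?R * exp (- 20 * real K)" by (simp add: mult.assoc flip: exp_add)
  also have "\<dots> \<le> real (card P) ^ ?R * exp (- 5 * real K)" by (intro mult_left_mono) auto
  finally show ?thesis .
qed

text \<open>Union bound: for each \<open>j\<close> at most one of the two alternatives applies, and
  its bad samples are at most a fraction \<open>exp (- 5 * K)\<close> of all. Fewer than
  \<open>exp (5 * K)\<close> indices therefore leave a sample that is good for all of them.\<close>

lemma ex_samples:
  fixes L K :: nat and X :: "'j \<Rightarrow> 's \<Rightarrow> bool"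
  assumes P: "finite P" "P \<noteq> {}" and L: "L > 0" and J: "finite J" "real (card J) < exp (5 * real K)"
  shows "\<exists>s. (\<forall>i<80 * L * K. s i \<in> P) \<and>
     (\<forall>j\<in>J. (16 * L * card {\<sigma>\<in>P. X j \<sigma>} \<le> card P \<longrightarrow>
                card {i. i < 80 * L * K \<and> X j (s i)} < 20 * K) \<and>
             (card P \<le> L * card {\<sigma>\<in>P. X j \<sigma>} \<longrightarrow>
                20 * K \<le> card {i. i < 80 * L * K \<and> X j (s i)}))"
proof -
  let ?R = "80 * L * K" and ?\<Omega> = "PiE {..<80 * L * K} (\<lambda>_. P)"
  let ?cnt = "\<lambda>j s. card {i. i < ?R \<and> X j (s i)}"
  define B where "B j = {s\<in>?\<Omega>.
     16 * L * card {\<sigma>\<in>P. X j \<sigma>} \<le> card P \<and> 20 * K \<le> ?cnt j s \<or>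
     card P \<le> L * card {\<sigma>\<in>P. X j \<sigma>} \<and> ?cnt j s < 20 * K}" for j
  let ?c = "real (card P) ^ ?R * exp (- 5 * real K)"
  have fin: "finite ?\<Omega>" using P by (intro finite_PiE) auto
  have cP: "card P > 0" using P by (simp add: card_gt_0_iff)
  have Bj: "real (card (B j)) \<le> ?c" for j
  proof (cases "card P \<le> L * card {\<sigma>\<in>P. X j \<sigma>}")
    case True
    then have "\<not> 16 * L * card {\<sigma>\<in>P. X j \<sigma>} \<le> card P" using cP by auto
    then have "B j = {s\<in>?\<Omega>. ?cnt j s < 20 * K}" unfolding B_def using True by auto
    then show ?thesis using lower_tail[OF P(1) L True] by simp
  next
    case False
    show ?thesis
    proof (cases "16 * L * card {\<sigma>\<in>P. X j \<sigma>} \<le> card P")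
      case True
      then have "B j = {s\<in>?\<Omega>. 20 * K \<le> ?cnt j s}" unfolding B_def using False by auto
      then show ?thesis using upper_tail[OF P(1) L True] by simp
    next
      case F2: False
      then have "B j = {}" unfolding B_def using False by auto
      then show ?thesis by simp
    qed
  qed
  have "real (card (\<Union>j\<in>J. B j)) \<le> (\<Sum>j\<in>J. real (card (B j)))"
    using card_UN_le[OF J(1), of B] by (metis of_nat_le_iff of_nat_sum)
  also have "\<dots> \<le> real (card J) * ?c" using Bj by (intro sum_bounded_above) auto
  also have "\<dots> < exp (5 * real K) * ?c" using J(2) cP by (intro mult_strict_right_mono) auto
  also have "\<dots> = real (card ?\<Omega>)"
    using P by (simp add: card_PiE_const exp_minus field_simps)
  finally have "card (\<Union>j\<in>J. B j) < card ?\<Omega>" by simp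
  moreover have "finite (B j)" for j unfolding B_def using fin by simp
  then have "finite (\<Union>j\<in>J. B j)" using J(1) by simp
  ultimately have "\<not> ?\<Omega> \<subseteq> (\<Union>j\<in>J. B j)" using card_mono leD by metis
  then obtain s where s: "s \<in> ?\<Omega>" "\<And>j. j \<in> J \<Longrightarrow> s \<notin> B j" by blast
  show ?thesis
  proof (intro exI[of _ s] conjI ballI impI allI)
    fix i assume "i < ?R"
    then show "s i \<in> P" using s(1) by auto
  next
    fix j assume "j \<in> J" "16 * L * card {\<sigma>\<in>P. X j \<sigma>} \<le> card P"
    then show "?cnt j s < 20 * K" using s unfolding B_def by fastforce
  next
    fix j assume "j \<in> J" "card P \<le> L * card {\<sigma>\<in>P. X j \<sigma>}"
    then show "20 * K \<le> ?cnt j s" using s unfolding B_def by fastforce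
  qed
qed

section \<open>Relabelled cycles and paths\<close>

definition relabel :: "(nat \<Rightarrow> nat) \<Rightarrow> nat set set \<Rightarrow> nat set set" where
  "relabel \<sigma> H = (\<lambda>e. \<sigma> ` e) ` H"

lemma relabel_comp: "relabel (\<sigma> \<circ> \<tau>) H = relabel \<sigma> (relabel \<tau> H)"
  unfolding relabel_def image_image by (simp add: image_comp comp_def)

lemma relabel_complete_edges:
  assumes "\<sigma> permutes {..<n}" "H \<subseteq> complete_edges n"
  shows "relabel \<sigma> H \<subseteq> complete_edges n"
proof
  fix e assume "e \<in> relabel \<sigma> H"
  then obtain e' where e': "e' \<in> complete_edges n" "e = \<sigma> ` e'"
    using assms(2) unfolding relabel_def by blast
  obtain u v where "e' = {u, v}" "u < n" "v < n" "u \<noteq> v" using e'(1) by (rule complete_edgesE)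
  then have "e = {\<sigma> u, \<sigma> v}" "\<sigma> u < n" "\<sigma> v < n" "\<sigma> u \<noteq> \<sigma> v"
    using e'(2) permutes_in_image[OF assms(1)] permutes_inj[OF assms(1)]
    by (auto dest: injD)
  then show "e \<in> complete_edges n" unfolding complete_edges_def by blast
qed

lemma inj_image_edges: "inj \<sigma> \<Longrightarrow> inj (\<lambda>e. \<sigma> ` e)"
  by (simp add: inj_image_eq_iff inj_on_def)

lemma reach_relabel:
  "(x, y) \<in> reach H \<Longrightarrow> (\<sigma> x, \<sigma> y) \<in> reach (relabel \<sigma> H)"
proof (induction rule: reach_induct)
  case refl
  then show ?case by simp
next
  case (step y z)
  have "{\<sigma> y, \<sigma> z} \<in> relabel \<sigma> H" using step(2) unfolding relabel_def by (intro image_eqI[of _ _ "{y, z}"]) auto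
  then show ?case using step(3) reach_edge reach_trans by blast
qed

text \<open>
  Vertex \<open>a * L + c\<close> is position \<open>c\<close> of component \<open>a\<close>.  Component \<open>b\<close> is a cycle; all others
  lack the edge between positions \<open>l\<close> and \<open>l + 1\<close> and are paths.
\<close>

definition comp_edge :: "nat \<Rightarrow> nat \<Rightarrow> nat \<Rightarrow> nat set" where
  "comp_edge L a c = {a * L + c, a * L + Suc c mod L}"

definition comp_graph :: "nat \<Rightarrow> nat \<Rightarrow> nat \<Rightarrow> nat \<Rightarrow> nat set set" where
  "comp_graph m L l b = {comp_edge L a c | a c. a < m \<and> c < L \<and> (c \<noteq> l \<or> a = b)}"

lemma comp_vertex_less: "a < m \<Longrightarrow> c < L \<Longrightarrow> m * L \<le> n \<Longrightarrow> a * L + c < (n :: nat)"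
proof -
  assume "a < m" "c < L" "m * L \<le> n"
  have "a * L + c < Suc a * L" using \<open>c < L\<close> by simp
  also have "\<dots> \<le> m * L" using \<open>a < m\<close> by (intro mult_le_mono1) simp
  finally show ?thesis using \<open>m * L \<le> n\<close> by simp
qed

lemma comp_vertex_inj:
  "c < L \<Longrightarrow> c' < L \<Longrightarrow> a * L + c = a' * L + c' \<longleftrightarrow> a = a' \<and> c = (c' :: nat)"
proof
  assume c: "c < L" "c' < L" and eq: "a * L + c = a' * L + c'"
  have "a = (a * L + c) div L" "a' = (a' * L + c') div L" using c by auto
  then have "a = a'" using eq by metis
  then show "a = a' \<and> c = c'" using eq by simp
qed simp

lemma Suc_mod_neq: "c < L \<Longrightarrow> 2 \<le> L \<Longrightarrow> Suc c mod L \<noteq> (c :: nat)"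
  by (cases "Suc c = L") auto

lemma Suc_mod_inj: "c < L \<Longrightarrow> c' < L \<Longrightarrow> Suc c mod L = Suc c' mod L \<longleftrightarrow> c = (c' :: nat)"
  by (cases "Suc c = L"; cases "Suc c' = L") auto

lemma comp_edge_inj:
  assumes "c < L" "c' < L" "3 \<le> L" "comp_edge L a c = comp_edge L a' c'"
  shows "a = a' \<and> c = c'"
proof -
  have m: "Suc c mod L < L" "Suc c' mod L < L" using assms by (auto intro: mod_less_divisor)
  have "\<not> (c = Suc c' mod L \<and> Suc c mod L = c')"
    using assms(1,2,3) by (cases "Suc c = L"; cases "Suc c' = L") auto
  then show ?thesis using assms m unfolding comp_edge_def
    by (auto simp: doubleton_eq_iff comp_vertex_inj)
qed

text \<open>By \<open>Suc l < L\<close> the edge at position \<open>L - 1\<close>, which closes up a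
  component, differs from the one at position \<open>l\<close>, so every component has it. The
  vertices from \<open>m * L\<close> on are isolated padding.\<close>

locale comp_graph_params =
  fixes n m L l :: nat
  assumes L: "3 \<le> L" and l: "Suc l < L" and mL: "m * L \<le> n"
begin

abbreviation G where "G \<equiv> comp_graph m L l"

lemma comp_graph_complete: "G b \<subseteq> complete_edges n"
proof
  fix e assume "e \<in> G b"
  then obtain a c where e: "e = comp_edge L a c" "a < m" "c < L" unfolding comp_graph_def by blast
  have s: "Suc c mod L < L" using L by (intro mod_less_divisor) simp
  have "a * L + c < n" "a * L + Suc c mod L < n"
    using comp_vertex_less[OF e(2) _ mL] e(3) s by auto
  moreover have "a * L + c \<noteq> a * L + Suc c mod L" using Suc_mod_neq[OF e(3)] L by simp
  ultimately show "e \<in> complete_edges n" unfolding e(1) comp_edge_def complete_edges_def by blast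
qed

text \<open>Together with \<open>card_roots_relabel\<close> this bounds the cyclomatic number by
  1.\<close>

lemma card_comp_graph: "card (G b) \<le> m * (L - 1) + 1"
proof -
  have "G b \<subseteq> (\<lambda>(a, c). comp_edge L a c) ` ({..<m} \<times> ({..<L} - {l}) \<union> {(b, l)})"
    unfolding comp_graph_def by auto
  then have "card (G b) \<le> card ((\<lambda>(a, c). comp_edge L a c) ` ({..<m} \<times> ({..<L} - {l}) \<union> {(b, l)}))"
    by (intro card_mono) auto
  also have "\<dots> \<le> card ({..<m} \<times> ({..<L} - {l}) \<union> {(b, l)})" by (intro card_image_le) auto
  also have "\<dots> \<le> card ({..<m} \<times> ({..<L} - {l})) + card {(b, l)}" by (rule card_Un_le)
  also have "\<dots> = m * (L - 1) + 1" using l by (simp add: card_cartesian_product)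
  finally show ?thesis .
qed

lemma comp_graph_edge:
  assumes "a < m" "c < L" "c \<noteq> l"
  shows "(a * L + c, a * L + Suc c mod L) \<in> reach (G b)"
  using assms by (intro reach_edge) (auto simp: comp_graph_def comp_edge_def)

lemma comp_graph_reach:
  assumes a: "a < m" and c: "c < L"
  shows "(a * L, a * L + c) \<in> reach (G b)"
proof (cases "c \<le> l")
  case True
  then show ?thesis
  proof (induction c)
    case 0
    then show ?case by simp
  next
    case (Suc c)
    then have "(a * L + c, a * L + Suc c) \<in> reach (G b)"
      using comp_graph_edge[OF a, of c b] l by simp
    then show ?case using Suc reach_trans by (meson Suc_leD)
  qed
next
  case False
  have "(a * L, a * L + c) \<in> reach (G b)" if "l < c" "c \<le> L - 1"
    using that(2,1)
  proof (induction rule: inc_induct)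
    case base
    have "(a * L + (L - 1), a * L + Suc (L - 1) mod L) \<in> reach (G b)"
      using comp_graph_edge[OF a, of "L - 1" b] l by simp
    then show ?case using L reach_sym by simp
  next
    case (step c)
    then have "(a * L + c, a * L + Suc c) \<in> reach (G b)"
      using comp_graph_edge[OF a, of c b] l by simp
    then show ?case using step reach_trans reach_sym by (meson less_SucI)
  qed
  then show ?thesis using False c by simp
qed

lemma card_roots_relabel:
  assumes "\<sigma> permutes {..<n}"
  shows "card (roots n (relabel \<sigma> (G b))) \<le> m + (n - m * L)"
proof -
  let ?W = "\<sigma> ` ((\<lambda>a. a * L) ` {..<m} \<union> {m * L..<n})"
  have "card (roots n (relabel \<sigma> (G b))) \<le> card ?W"
  proof (rule card_roots_le)
    fix x assume "x < n"
    then obtain y where y: "y < n" "x = \<sigma> y"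
      using permutes_image[OF assms] by (metis imageE lessThan_iff)
    show "\<exists>w\<in>?W. (x, w) \<in> reach (relabel \<sigma> (G b))"
    proof (cases "y < m * L")
      case True
      have d: "y div L < m" using True L by (simp add: less_mult_imp_div_less)
      have "y = y div L * L + y mod L" by simp
      then have "(y div L * L, y) \<in> reach (G b)"
        using comp_graph_reach[OF d, of "y mod L" b] L by simp
      then have "(x, \<sigma> (y div L * L)) \<in> reach (relabel \<sigma> (G b))"
        using y(2) reach_relabel reach_sym by blast
      then show ?thesis using d by blast
    next
      case False
      then show ?thesis using y by (intro bexI[of _ x]) auto
    qed
  qed auto
  also have "\<dots> \<le> card ((\<lambda>a. a * L) ` {..<m} \<union> {m * L..<n})" by (intro card_image_le) auto
  also have "\<dots> \<le> card ((\<lambda>a. a * L) ` {..<m}) + card {m * L..<n}" by (rule card_Un_le)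
  also have "card ((\<lambda>a. a * L) ` {..<m}) \<le> m" using card_image_le[of "{..<m}"] by simp
  finally show ?thesis by simp
qed

lemma relabel_cycle:
  assumes "\<sigma> permutes {..<n}"
  shows "\<exists>V. is_cycle V ((\<lambda>c. \<sigma> ` comp_edge L b c) ` {..<L})"
proof -
  let ?xs = "map (\<lambda>c. \<sigma> (b * L + c)) [0..<L]"
  have inj: "inj \<sigma>" using assms permutes_inj by blast
  have "inj (\<lambda>c. \<sigma> (b * L + c))" by (intro injI) (auto dest: injD[OF inj])
  then have d: "distinct ?xs" by (simp add: distinct_map inj_on_subset[of _ UNIV])
  have e: "{?xs ! i, ?xs ! (Suc i mod length ?xs)} = \<sigma> ` comp_edge L b i" if "i < length ?xs" for i
  proof -
    have "Suc i mod L < L" using L by (intro mod_less_divisor) simp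
    then show ?thesis using that unfolding comp_edge_def by simp
  qed
  have "(\<lambda>c. \<sigma> ` comp_edge L b c) ` {..<L} = {\<sigma> ` comp_edge L b i | i. i < length ?xs}" by auto
  also have "\<dots> = {{?xs ! i, ?xs ! (Suc i mod length ?xs)} | i. i < length ?xs}"
    by (intro Collect_cong ex_cong1) (metis e)
  finally have "(\<lambda>c. \<sigma> ` comp_edge L b c) ` {..<L}
      = {{?xs ! i, ?xs ! (Suc i mod length ?xs)} | i. i < length ?xs}" .
  then show ?thesis unfolding is_cycle_def using d L by (intro exI[of _ "set ?xs"] exI[of _ ?xs]) simp
qed

section \<open>Symmetries of the component graphs\<close>

definition rotate_comp :: "nat \<Rightarrow> nat \<Rightarrow> nat" where
  "rotate_comp b x = (if x div L = b then b * L + Suc (x mod L) mod L else x)"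

definition swap_comp :: "nat \<Rightarrow> nat \<Rightarrow> nat \<Rightarrow> nat" where
  "swap_comp a a' x = (if x < m * L then Transposition.transpose a a' (x div L) * L + x mod L else x)"

lemma comp_divmod: "c < L \<Longrightarrow> (a * L + c) div L = a" "c < L \<Longrightarrow> (a * L + c) mod L = c"
  by auto

lemma rotate_comp_vertex:
  "c < L \<Longrightarrow> rotate_comp b (a * L + c) = (if a = b then b * L + Suc c mod L else a * L + c)"
  unfolding rotate_comp_def by (simp add: comp_divmod)

lemma swap_comp_vertex:
  "a'' < m \<Longrightarrow> c < L \<Longrightarrow> swap_comp a a' (a'' * L + c) = Transposition.transpose a a' a'' * L + c"
  using comp_vertex_less[of a'' m c L "m * L"] unfolding swap_comp_def by (simp add: comp_divmod)

lemma rotate_comp_permutes: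
  assumes "b < m"
  shows "rotate_comp b permutes {..<n}"
proof (rule bij_imp_permutes)
  have L0: "L > 0" using L by simp
  show "bij_betw (rotate_comp b) {..<n} {..<n}"
  proof (rule bij_betw_imageI)
    have rdiv: "rotate_comp b x div L = x div L" for x
      unfolding rotate_comp_def using L0 by (simp add: comp_divmod)
    show inj: "inj_on (rotate_comp b) {..<n}"
    proof (rule inj_onI)
      fix x y assume eq: "rotate_comp b x = rotate_comp b y"
      then have d: "x div L = y div L" using rdiv by metis
      show "x = y"
      proof (cases "x div L = b")
        case True
        then have "Suc (x mod L) mod L = Suc (y mod L) mod L"
          using eq d unfolding rotate_comp_def by simp
        then have "x mod L = y mod L" using Suc_mod_inj L0 by simp
        then show ?thesis using d div_mult_mod_eq by metis
      next
        case False
        then show ?thesis using eq d unfolding rotate_comp_def by simp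
      qed
    qed
    have "rotate_comp b x < n" if "x < n" for x
      using that comp_vertex_less[OF assms _ mL] L0 unfolding rotate_comp_def by auto
    then have "rotate_comp b ` {..<n} \<subseteq> {..<n}" by auto
    then show "rotate_comp b ` {..<n} = {..<n}" using inj endo_inj_surj[of "{..<n}"] by blast
  qed
next
  fix x assume "x \<notin> {..<n}"
  then have "m * L div L \<le> x div L" using mL by (intro div_le_mono) simp
  then have "x div L \<noteq> b" using assms L by simp
  then show "rotate_comp b x = x" unfolding rotate_comp_def by simp
qed

lemma swap_comp_permutes:
  assumes "a < m" "a' < m"
  shows "swap_comp a a' permutes {..<n}"
proof (rule bij_imp_permutes)
  have L0: "L > 0" using L by simp
  have t: "Transposition.transpose a a' q < m" if "q < m" for q using that assms by (auto simp: Transposition.transpose_def)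
  have less: "swap_comp a a' x < m * L \<longleftrightarrow> x < m * L" for x
    using comp_vertex_less[of _ m "x mod L" L "m * L"] t[of "x div L"] L0
    unfolding swap_comp_def by (simp add: less_mult_imp_div_less)
  have inv: "swap_comp a a' (swap_comp a a' x) = x" for x
  proof (cases "x < m * L")
    case True
    have "swap_comp a a' x = Transposition.transpose a a' (x div L) * L + x mod L"
      using True unfolding swap_comp_def by simp
    then have "swap_comp a a' (swap_comp a a' x) = Transposition.transpose a a' (Transposition.transpose a a' (x div L)) * L + x mod L"
      using swap_comp_vertex[of "Transposition.transpose a a' (x div L)" "x mod L" a a'] t[of "x div L"] True L0
      by (simp add: less_mult_imp_div_less)
    then show ?thesis by simp
  next
    case False
    then show ?thesis unfolding swap_comp_def by simp
  qed
  have "swap_comp a a' x < n" if "x < n" for x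
  proof (cases "x < m * L")
    case True
    then show ?thesis using less[of x] mL by simp
  next
    case False
    then show ?thesis using that unfolding swap_comp_def by simp
  qed
  then show "bij_betw (swap_comp a a') {..<n} {..<n}"
    using inv by (intro bij_betw_byWitness[of _ "swap_comp a a'"]) auto
next
  fix x assume "x \<notin> {..<n}"
  then show "swap_comp a a' x = x" using mL unfolding swap_comp_def by simp
qed

lemma rotate_comp_edge:
  assumes "c < L"
  shows "rotate_comp b ` comp_edge L a c =
     (if a = b then comp_edge L b (Suc c mod L) else comp_edge L a c)"
proof -
  have "Suc c mod L < L" using L by (intro mod_less_divisor) simp
  then show ?thesis using assms unfolding comp_edge_def by (simp add: rotate_comp_vertex)
qed

lemma swap_comp_edge:
  assumes "c < L" "a'' < m"
  shows "swap_comp a a' ` comp_edge L a'' c = comp_edge L (Transposition.transpose a a' a'') c"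
proof -
  have "Suc c mod L < L" using L by (intro mod_less_divisor) simp
  then show ?thesis using assms unfolding comp_edge_def by (simp add: swap_comp_vertex)
qed

lemma finite_comp_graph: "finite (G b)"
  using comp_graph_complete finite_complete_edges finite_subset by blast

text \<open>An injective map of a finite set into itself is onto.\<close>

lemma relabel_eq_of_subset:
  assumes "inj \<sigma>" "relabel \<sigma> (G b) \<subseteq> G b"
  shows "relabel \<sigma> (G b) = G b"
  using assms finite_comp_graph inj_image_edges[OF assms(1)] unfolding relabel_def
  by (intro endo_inj_surj) (auto intro: inj_on_subset)

text \<open>Component \<open>b\<close> is a full cycle, so a rotation moves each of its edges to
  another one that is present.\<close>

lemma rotate_comp_auto:
  assumes "b < m"
  shows "relabel (rotate_comp b) (G b) = G b"
proof (rule relabel_eq_of_subset)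
  show "inj (rotate_comp b)" using rotate_comp_permutes[OF assms] permutes_inj by blast
  have s: "Suc c mod L < L" for c using L by (intro mod_less_divisor) simp
  show "relabel (rotate_comp b) (G b) \<subseteq> G b"
  proof
    fix e assume "e \<in> relabel (rotate_comp b) (G b)"
    then obtain a c where ac: "a < m" "c < L" "c \<noteq> l \<or> a = b" "e = rotate_comp b ` comp_edge L a c"
      unfolding relabel_def comp_graph_def by auto
    then have "e = (if a = b then comp_edge L b (Suc c mod L) else comp_edge L a c)"
      using rotate_comp_edge by simp
    then have "e = comp_edge L b (Suc c mod L) \<and> a = b \<or> e = comp_edge L a c" by presburger
    then show "e \<in> G b" using ac s[of c] assms unfolding comp_graph_def by blast
  qed
qed

lemma swap_comp_auto:
  assumes "a < m" "a' < m" "a \<noteq> b" "a' \<noteq> b"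
  shows "relabel (swap_comp a a') (G b) = G b"
proof (rule relabel_eq_of_subset)
  show "inj (swap_comp a a')" using swap_comp_permutes[OF assms(1,2)] permutes_inj by blast
  have t: "Transposition.transpose a a' q < m" if "q < m" for q using that assms by (auto simp: Transposition.transpose_def)
  have tb: "Transposition.transpose a a' b = b" using assms by (auto simp: Transposition.transpose_def)
  show "relabel (swap_comp a a') (G b) \<subseteq> G b"
  proof
    fix e assume "e \<in> relabel (swap_comp a a') (G b)"
    then obtain q c where qc: "q < m" "c < L" "c \<noteq> l \<or> q = b" "e = swap_comp a a' ` comp_edge L q c"
      unfolding relabel_def comp_graph_def by auto
    then have "e = comp_edge L (Transposition.transpose a a' q) c" using swap_comp_edge by simp
    moreover have "c \<noteq> l \<or> Transposition.transpose a a' q = b" using qc(3) tb by auto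
    ultimately show "e \<in> G b" using qc t unfolding comp_graph_def by blast
  qed
qed

end

text \<open>\<open>T\<close> abstracts the algorithm, for a fixed arrangement of its input, as a
  function of the graph. The constant in \<open>eps\<close> is \<open>2 * 16\<close>: a closing edge
  of a path is missed with frequency at most \<open>2 * \<epsilon> * n / (m - 1)\<close>, which has
  to be at most \<open>1 / (16 * L)\<close> for \<open>ex_samples\<close>.\<close>

locale approx_tree = comp_graph_params +
  fixes T :: "nat set set \<Rightarrow> nat set set" and \<epsilon> :: real
  assumes acyclic: "H \<subseteq> complete_edges n \<Longrightarrow> acyclic_edges (T H)"
    and dropped: "H \<subseteq> complete_edges n \<Longrightarrow>
      real (card (H - T H)) \<le> real (card H) + real (card (roots n H)) - real n + 2 * \<epsilon> * real n"
    and eps: "32 * \<epsilon> * real n * real L \<le> real m - 1" and m: "2 \<le> m"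
begin

abbreviation S where "S \<equiv> {\<sigma>. \<sigma> permutes {..<n}}"

definition missed :: "nat \<Rightarrow> nat set \<Rightarrow> (nat \<Rightarrow> nat) \<Rightarrow> bool" where
  "missed b e \<sigma> \<longleftrightarrow> \<sigma> ` e \<notin> T (relabel \<sigma> (G b))"

definition misses :: "nat \<Rightarrow> nat set \<Rightarrow> nat" where
  "misses b e = card {\<sigma>\<in>S. missed b e \<sigma>}"

lemma finite_S: "finite S"
  by (rule finite_permutations) simp

text \<open>Composition with \<open>\<alpha>\<close> on the right permutes the relabellings and
  leaves the relabelled graph, hence also its tree, as it was; only the edge looked at
  changes.\<close>

lemma misses_auto:
  assumes "\<alpha> permutes {..<n}" "relabel \<alpha> (G b) = G b"
  shows "misses b (\<alpha> ` e) = misses b e"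
proof -
  have iff: "missed b (\<alpha> ` e) \<sigma> \<longleftrightarrow> missed b e (\<sigma> \<circ> \<alpha>)" for \<sigma>
    unfolding missed_def relabel_comp assms(2) by (simp add: image_comp)
  have "bij_betw (\<lambda>\<sigma>. \<sigma> \<circ> \<alpha>) {\<sigma>\<in>S. missed b (\<alpha> ` e) \<sigma>} {\<sigma>\<in>S. missed b e \<sigma>}"
  proof (rule bij_betw_byWitness[of _ "\<lambda>\<sigma>. \<sigma> \<circ> inv \<alpha>"])
    have "inv \<alpha> \<circ> \<alpha> = id" "\<alpha> \<circ> inv \<alpha> = id" using permutes_inv_o[OF assms(1)] by auto
    then show "\<forall>\<sigma>\<in>{\<sigma>\<in>S. missed b (\<alpha> ` e) \<sigma>}. (\<sigma> \<circ> \<alpha>) \<circ> inv \<alpha> = \<sigma>"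
      and 2: "\<forall>\<sigma>\<in>{\<sigma>\<in>S. missed b e \<sigma>}. (\<sigma> \<circ> inv \<alpha>) \<circ> \<alpha> = \<sigma>"
      by (simp_all add: comp_assoc)
    show "(\<lambda>\<sigma>. \<sigma> \<circ> \<alpha>) ` {\<sigma>\<in>S. missed b (\<alpha> ` e) \<sigma>} \<subseteq> {\<sigma>\<in>S. missed b e \<sigma>}"
      using iff permutes_compose[OF assms(1)] by auto
    show "(\<lambda>\<sigma>. \<sigma> \<circ> inv \<alpha>) ` {\<sigma>\<in>S. missed b e \<sigma>} \<subseteq> {\<sigma>\<in>S. missed b (\<alpha> ` e) \<sigma>}"
      using iff permutes_compose[OF permutes_inv[OF assms(1)]] 2 by auto
  qed
  then show ?thesis unfolding misses_def by (rule bij_betw_same_card)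
qed

lemma sum_misses:
  assumes "finite E"
  shows "(\<Sum>e\<in>E. misses b e) = (\<Sum>\<sigma>\<in>S. card {e\<in>E. missed b e \<sigma>})"
proof -
  have "(\<Sum>e\<in>E. misses b e) = (\<Sum>e\<in>E. \<Sum>\<sigma>\<in>S. if missed b e \<sigma> then 1 else 0)"
    unfolding misses_def using finite_S by (simp add: sum.If_cases Int_def)
  also have "\<dots> = (\<Sum>\<sigma>\<in>S. \<Sum>e\<in>E. if missed b e \<sigma> then 1 else 0)" by (rule sum.swap)
  also have "\<dots> = (\<Sum>\<sigma>\<in>S. card {e\<in>E. missed b e \<sigma>})"
    using assms by (simp add: sum.If_cases Int_def)
  finally show ?thesis .
qed

lemma misses_cycle:
  assumes "\<sigma> \<in> S" "b < m"
  shows "\<exists>c<L. missed b (comp_edge L b c) \<sigma>"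
proof (rule ccontr)
  assume neg: "\<not> ?thesis"
  obtain V where V: "is_cycle V ((\<lambda>c. \<sigma> ` comp_edge L b c) ` {..<L})"
    using relabel_cycle assms(1) by blast
  have "(\<lambda>c. \<sigma> ` comp_edge L b c) ` {..<L} \<subseteq> T (relabel \<sigma> (G b))"
    using neg unfolding missed_def by auto
  moreover have "acyclic_edges (T (relabel \<sigma> (G b)))"
    using acyclic relabel_complete_edges comp_graph_complete assms(1) by blast
  ultimately show False using V unfolding acyclic_edges_def by blast
qed

lemma card_missed_le:
  assumes "\<sigma> \<in> S"
  shows "real (card {e\<in>G b. missed b e \<sigma>}) \<le> 1 + 2 * \<epsilon> * real n"
proof -
  let ?H = "relabel \<sigma> (G b)"
  have sub: "?H \<subseteq> complete_edges n"
    using relabel_complete_edges comp_graph_complete assms by blast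
  then have fin: "finite (?H - T ?H)" using finite_complete_edges finite_subset by blast
  have inj: "inj (\<lambda>e. \<sigma> ` e)" using assms permutes_inj inj_image_edges by blast
  have "(\<lambda>e. \<sigma> ` e) ` {e\<in>G b. missed b e \<sigma>} \<subseteq> ?H - T ?H"
    unfolding missed_def relabel_def by auto
  then have "card {e\<in>G b. missed b e \<sigma>} \<le> card (?H - T ?H)"
    using card_inj_on_le[OF inj_on_subset[OF inj] _ fin] by blast
  then have "real (card {e\<in>G b. missed b e \<sigma>}) \<le>
      real (card ?H) + real (card (roots n ?H)) - real n + 2 * \<epsilon> * real n"
    using dropped[OF sub] by linarith
  moreover have "card ?H \<le> m * (L - 1) + 1"
    using card_image_le[OF finite_comp_graph, of "\<lambda>e. \<sigma> ` e" b] card_comp_graph[of b]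
    unfolding relabel_def by linarith
  moreover have "card (roots n ?H) \<le> m + (n - m * L)" using card_roots_relabel assms by blast
  \<comment> \<open>Edges plus components exceed the number of vertices by at most one, which is the
    1 in the bound.\<close>
  moreover have "m * (L - 1) + 1 + (m + (n - m * L)) = n + 1"
  proof -
    have "m * (L - 1) + m = m * L" using L by (cases L) auto
    then show ?thesis using mL by simp
  qed
  ultimately show ?thesis by linarith
qed

text \<open>Every relabelling misses some edge of the cycle, as the tree is acyclic, and by rotation
  all \<open>L\<close> edges of the cycle are missed equally often.\<close>

lemma misses_high:
  assumes "b < m"
  shows "card S \<le> L * misses b (comp_edge L b (L - 1))"
proof -
  have rot: "misses b (comp_edge L b (Suc c mod L)) = misses b (comp_edge L b c)" if "c < L" for c
    using misses_auto[OF rotate_comp_permutes[OF assms] rotate_comp_auto[OF assms], of "comp_edge L b c"]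
      rotate_comp_edge[OF that, of b b] by simp
  have 0: "misses b (comp_edge L b c) = misses b (comp_edge L b 0)" if "c < L" for c
    using that
  proof (induction c)
    case (Suc c)
    then show ?case using rot[of c] by simp
  qed simp
  let ?E = "comp_edge L b ` {..<L}"
  have inj: "inj_on (comp_edge L b) {..<L}" using comp_edge_inj L by (auto simp: inj_on_def)
  have "card S = (\<Sum>\<sigma>\<in>S. 1)" by simp
  also have "\<dots> \<le> (\<Sum>\<sigma>\<in>S. card {e\<in>?E. missed b e \<sigma>})"
  proof (rule sum_mono)
    fix \<sigma> assume "\<sigma> \<in> S"
    then obtain c where "c < L" "missed b (comp_edge L b c) \<sigma>" using misses_cycle assms by blast
    then have "{e\<in>?E. missed b e \<sigma>} \<noteq> {}" by blast
    then show "1 \<le> card {e\<in>?E. missed b e \<sigma>}" by (simp add: Suc_le_eq card_gt_0_iff)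
  qed
  also have "\<dots> = (\<Sum>e\<in>?E. misses b e)" by (rule sum_misses[symmetric]) simp
  also have "\<dots> = (\<Sum>c<L. misses b (comp_edge L b c))" by (simp add: sum.reindex[OF inj])
  also have "\<dots> = (\<Sum>c<L. misses b (comp_edge L b (L - 1)))"
  proof (rule sum.cong)
    fix c assume "c \<in> {..<L}"
    then have "misses b (comp_edge L b c) = misses b (comp_edge L b 0)" by (intro 0) simp
    also have "\<dots> = misses b (comp_edge L b (L - 1))" using 0[of "L - 1"] L by simp
    finally show "misses b (comp_edge L b c) = misses b (comp_edge L b (L - 1))" .
  qed simp
  finally show ?thesis by simp
qed

text \<open>Of the at most \<open>1 + 2 * \<epsilon> * n\<close> missed edges one lies on the cycle.
  The rest bounds the misses among the \<open>m - 1\<close> closing edges of the other components,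
  which are missed equally often because these components can be swapped.\<close>

lemma misses_low:
  assumes "a < m" "b < m" "a \<noteq> b"
  shows "16 * L * misses b (comp_edge L a (L - 1)) \<le> card S"
proof -
  let ?e = "\<lambda>a. comp_edge L a (L - 1)"
  have L1: "L - 1 < L" using L by simp
  have eq: "misses b (?e a') = misses b (?e a)" if a': "a' < m" "a' \<noteq> b" for a'
    using misses_auto[OF swap_comp_permutes[OF assms(1) a'(1)] swap_comp_auto[OF assms(1) a'(1) assms(3) a'(2)], of "?e a"]
      swap_comp_edge[OF L1 assms(1), of a a'] by simp
  let ?E1 = "?e ` ({..<m} - {b})" and ?E2 = "comp_edge L b ` {..<L}"
  have "?e a' \<in> G b" if "a' < m" for a'
    unfolding comp_graph_def using that L1 l by (intro CollectI exI[of _ a'] exI[of _ "L - 1"]) auto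
  moreover have "?E2 \<subseteq> G b" unfolding comp_graph_def using assms(2) by auto
  ultimately have sub: "?E1 \<union> ?E2 \<subseteq> G b" by auto
  have dis: "?E1 \<inter> ?E2 = {}"
  proof -
    have "?e a' \<noteq> comp_edge L b c" if "a' \<noteq> b" "c < L" for a' c
      using that comp_edge_inj[OF L1 that(2) L] by blast
    then show ?thesis by auto
  qed
  have inj: "inj_on ?e ({..<m} - {b})" using comp_edge_inj[OF L1 L1 L] by (auto simp: inj_on_def)
  have "real (card {e\<in>?E1. missed b e \<sigma>}) \<le> 2 * \<epsilon> * real n" if \<sigma>: "\<sigma> \<in> S" for \<sigma>
  proof -
    obtain c where c: "c < L" "missed b (comp_edge L b c) \<sigma>" using misses_cycle \<sigma> assms(2) by blast
    let ?M = "{e\<in>G b. missed b e \<sigma>}"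
    have "insert (comp_edge L b c) {e\<in>?E1. missed b e \<sigma>} \<subseteq> ?M" using c sub by auto
    moreover have "finite ?M" using finite_comp_graph by simp
    ultimately have "card (insert (comp_edge L b c) {e\<in>?E1. missed b e \<sigma>}) \<le> card ?M"
      by (intro card_mono)
    moreover have "comp_edge L b c \<notin> {e\<in>?E1. missed b e \<sigma>}" using dis c(1) by blast
    ultimately have "Suc (card {e\<in>?E1. missed b e \<sigma>}) \<le> card ?M" by simp
    then show ?thesis using card_missed_le[OF \<sigma>, of b] by linarith
  qed
  then have "(\<Sum>\<sigma>\<in>S. real (card {e\<in>?E1. missed b e \<sigma>})) \<le> real (card S) * (2 * \<epsilon> * real n)"
    by (rule sum_bounded_above)
  then have bound: "real (\<Sum>\<sigma>\<in>S. card {e\<in>?E1. missed b e \<sigma>}) \<le> real (card S) * (2 * \<epsilon> * real n)"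
    by simp
  have "(\<Sum>\<sigma>\<in>S. card {e\<in>?E1. missed b e \<sigma>}) = (\<Sum>e\<in>?E1. misses b e)"
    by (rule sum_misses[symmetric]) simp
  also have "(\<Sum>e\<in>?E1. misses b e) = (\<Sum>a'\<in>{..<m} - {b}. misses b (?e a'))"
    by (subst sum.reindex[OF inj]) (simp add: comp_def)
  also have "\<dots> = (\<Sum>a'\<in>{..<m} - {b}. misses b (?e a))"
    using eq by (intro sum.cong) auto
  also have "\<dots> = (m - 1) * misses b (?e a)" using assms(2) by simp
  finally have 1: "real (m - 1) * real (misses b (?e a)) \<le> real (card S) * (2 * \<epsilon> * real n)"
    using bound by (simp only: of_nat_mult)
  have m1: "real (m - 1) = real m - 1" "real (m - 1) > 0" using m by auto
  have "real (m - 1) * real (16 * L * misses b (?e a)) = 16 * real L * (real (m - 1) * real (misses b (?e a)))"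
    by simp
  also have "\<dots> \<le> 16 * real L * (real (card S) * (2 * \<epsilon> * real n))"
    using 1 by (intro mult_left_mono) auto
  also have "\<dots> = real (card S) * (32 * \<epsilon> * real n * real L)" by simp
  also have "\<dots> \<le> real (card S) * real (m - 1)" using eps m1 by (intro mult_left_mono) auto
  also have "\<dots> = real (m - 1) * real (card S)" by simp
  finally have "real (16 * L * misses b (?e a)) \<le> real (card S)" using m1(2)
    by (rule mult_left_le_imp_le)
  then show ?thesis by (rule of_nat_le_iff[THEN iffD1])
qed

text \<open>As \<open>\<sigma> \<circ> \<tau>\<close> runs through all permutations together with
  \<open>\<sigma>\<close>, the frequencies of misses are the same for every \<open>\<tau>\<close>.
  The events are indexed by \<open>\<tau>\<close>, \<open>a\<close> and \<open>b\<close>; there are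
  \<open>fact n * m^2\<close> of them, at most \<open>exp (n * (n + 2))\<close>, so
  \<open>K = n^2\<close> is large enough in \<open>ex_samples\<close>.\<close>

lemma ex_relabellings:
  "\<exists>\<sigma>. (\<forall>i<80 * L * n\<^sup>2. \<sigma> i permutes {..<n}) \<and>
     (\<forall>\<tau> a b. \<tau> permutes {..<n} \<longrightarrow> a < m \<longrightarrow> b < m \<longrightarrow>
        20 * n\<^sup>2 \<le> card {i. i < 80 * L * n\<^sup>2 \<and>
            \<sigma> i ` (\<tau> ` comp_edge L a (L - 1)) \<notin> T (relabel (\<sigma> i) (relabel \<tau> (G b)))} \<longleftrightarrow> a = b)"
proof -
  define J where "J = S \<times> {..<m} \<times> {..<m}"
  define X where "X = (\<lambda>(\<tau> :: nat \<Rightarrow> nat, a, b) \<sigma> :: nat \<Rightarrow> nat. missed b (comp_edge L a (L - 1)) (\<sigma> \<circ> \<tau>))"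
  have L0: "0 < L" using L by simp
  have "2 * 3 \<le> m * L" using m L by (intro mult_le_mono) auto
  then have n0: "n > 0" using mL by simp
  have mn: "m \<le> n" using mL L le_trans[of m "m * L" n] by simp
  have cX: "card {\<sigma>\<in>S. X (\<tau>, a, b) \<sigma>} = misses b (comp_edge L a (L - 1))" if \<tau>: "\<tau> \<in> S" for \<tau> a b
  proof -
    have \<tau>': "\<tau> permutes {..<n}" using \<tau> by simp
    have "bij_betw (\<lambda>\<sigma>. \<sigma> \<circ> \<tau>) {\<sigma>\<in>S. X (\<tau>, a, b) \<sigma>} {\<sigma>\<in>S. missed b (comp_edge L a (L - 1)) \<sigma>}"
    proof (rule bij_betw_byWitness[of _ "\<lambda>\<sigma>. \<sigma> \<circ> inv \<tau>"])
      have "inv \<tau> \<circ> \<tau> = id" "\<tau> \<circ> inv \<tau> = id" using permutes_inv_o[OF \<tau>'] by auto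
      then show "\<forall>\<sigma>\<in>{\<sigma>\<in>S. X (\<tau>, a, b) \<sigma>}. (\<sigma> \<circ> \<tau>) \<circ> inv \<tau> = \<sigma>"
        and 2: "\<forall>\<sigma>\<in>{\<sigma>\<in>S. missed b (comp_edge L a (L - 1)) \<sigma>}. (\<sigma> \<circ> inv \<tau>) \<circ> \<tau> = \<sigma>"
        by (simp_all add: comp_assoc)
      show "(\<lambda>\<sigma>. \<sigma> \<circ> \<tau>) ` {\<sigma>\<in>S. X (\<tau>, a, b) \<sigma>} \<subseteq> {\<sigma>\<in>S. missed b (comp_edge L a (L - 1)) \<sigma>}"
        unfolding X_def using permutes_compose[OF \<tau>'] by auto
      show "(\<lambda>\<sigma>. \<sigma> \<circ> inv \<tau>) ` {\<sigma>\<in>S. missed b (comp_edge L a (L - 1)) \<sigma>} \<subseteq> {\<sigma>\<in>S. X (\<tau>, a, b) \<sigma>}"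
        unfolding X_def using permutes_compose[OF permutes_inv[OF \<tau>']] 2 by auto
    qed
    then show ?thesis unfolding misses_def by (rule bij_betw_same_card)
  qed
  have "card S = fact n" by (rule card_permutations) auto
  then have "card J = fact n * m\<^sup>2"
    unfolding J_def by (simp add: card_cartesian_product power2_eq_square)
  also have "\<dots> \<le> n ^ n * n\<^sup>2"
    using fact_le_power[of n, where 'a = nat] mn by (intro mult_le_mono power_mono) auto
  also have "\<dots> = n ^ (n + 2)" by (rule power_add[symmetric])
  finally have "real (card J) \<le> real (n ^ (n + 2))" by (rule of_nat_mono)
  also have "\<dots> = real n ^ (n + 2)" by simp
  also have "\<dots> \<le> exp (real n) ^ (n + 2)"
  proof (rule power_mono)
    show "real n \<le> exp (real n)" using exp_ge_add_one_self[of "real n"] by linarith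
  qed simp
  also have "\<dots> = exp (real ((n + 2) * n))" by (subst exp_of_nat_mult[symmetric]) (simp add: algebra_simps)
  also have "\<dots> < exp (5 * real (n\<^sup>2))"
  proof -
    have "(n + 2) * n < 5 * n\<^sup>2" using n0 by (cases n) (auto simp: power2_eq_square algebra_simps)
    then have "real ((n + 2) * n) < real (5 * n\<^sup>2)" using of_nat_less_iff by blast
    then show ?thesis by simp
  qed
  finally have cJ: "real (card J) < exp (5 * real (n\<^sup>2))" .
  have J: "finite J" unfolding J_def using finite_S by auto
  have "S \<noteq> {}" using permutes_id by blast
  from ex_samples[OF finite_S this L0 J cJ, of X] obtain \<sigma> where \<sigma>: "\<forall>i<80 * L * n\<^sup>2. \<sigma> i \<in> S"
    and lohi: "\<forall>j\<in>J. (16 * L * card {\<sigma>\<in>S. X j \<sigma>} \<le> card S \<longrightarrow>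
                card {i. i < 80 * L * n\<^sup>2 \<and> X j (\<sigma> i)} < 20 * n\<^sup>2) \<and>
             (card S \<le> L * card {\<sigma>\<in>S. X j \<sigma>} \<longrightarrow>
                20 * n\<^sup>2 \<le> card {i. i < 80 * L * n\<^sup>2 \<and> X j (\<sigma> i)})"
    by (elim exE conjE)
  have cnt: "20 * n\<^sup>2 \<le> card {i. i < 80 * L * n\<^sup>2 \<and> X (\<tau>, a, b) (\<sigma> i)} \<longleftrightarrow> a = b"
    if "\<tau> permutes {..<n}" "a < m" "b < m" for \<tau> a b
  proof -
    have j: "(\<tau>, a, b) \<in> J" using that unfolding J_def by simp
    have \<tau>: "\<tau> \<in> S" using that by simp
    show ?thesis
    proof (cases "a = b")
      case True
      then show ?thesis using lohi[rule_format, OF j] misses_high[OF that(3)] cX[OF \<tau>] by simp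
    next
      case False
      then show ?thesis using lohi[rule_format, OF j] misses_low[OF that(2,3)] cX[OF \<tau>] by simp
    qed
  qed
  have eqX: "X (\<tau>, a, b) (\<sigma> i) \<longleftrightarrow>
      \<sigma> i ` (\<tau> ` comp_edge L a (L - 1)) \<notin> T (relabel (\<sigma> i) (relabel \<tau> (G b)))" for \<tau> a b i
    unfolding X_def missed_def by (simp only: case_prod_conv relabel_comp image_comp)
  have "20 * n\<^sup>2 \<le> card {i. i < 80 * L * n\<^sup>2 \<and>
            \<sigma> i ` (\<tau> ` comp_edge L a (L - 1)) \<notin> T (relabel (\<sigma> i) (relabel \<tau> (G b)))} \<longleftrightarrow> a = b"
    if "\<tau> permutes {..<n}" "a < m" "b < m" for \<tau> a b
    using cnt[OF that] unfolding eqX .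
  moreover have "\<forall>i<80 * L * n\<^sup>2. \<sigma> i permutes {..<n}" using \<sigma> by simp
  ultimately show ?thesis by (intro exI[of _ \<sigma>]) blast
qed

end

section \<open>Composing permutations\<close>

text \<open>
  The composition \<open>f (l - 1) \<circ> \<dots> \<circ> f 0\<close> is laid out as \<open>m\<close> components of length \<open>2 * (l + 1)\<close>:
  positions \<open>0, \<dots>, l\<close> follow the maps forwards, positions \<open>l + 1, \<dots>, 2 * l + 1\<close> come back, so that
  the component of start \<open>a\<close> closes up at positions \<open>2 * l + 1\<close> and \<open>0\<close>.  The two halves are joined
  at the turning point only if that is \<open>b\<close>.
\<close>

datatype query = Const bool | Ask nat nat nat

text \<open>An arc always goes from a position to the next one, so it is settled by at most one bit.
  On the way back, position \<open>c\<close> carries the value after \<open>L - 1 - c\<close> maps,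
  so its arc undoes the map with index \<open>L - 2 - c\<close>; hence the exchanged arguments of
  \<open>Ask\<close>.\<close>

definition arc_query :: "nat \<Rightarrow> nat \<Rightarrow> nat \<Rightarrow> nat \<Rightarrow> nat \<Rightarrow> nat \<Rightarrow> query" where
  "arc_query m L l b u v =
     (if m * L \<le> u \<or> m * L \<le> v \<or> v mod L \<noteq> Suc (u mod L) mod L then Const False
      else if u mod L < l then Ask (u mod L) (u div L) (v div L)
      else if u mod L = l then Const (u div L = b \<and> v div L = b)
      else if Suc (u mod L) < L then Ask (L - 2 - u mod L) (v div L) (u div L)
      else Const (u div L = v div L))"

fun answer :: "(nat \<Rightarrow> nat \<Rightarrow> nat) \<Rightarrow> query \<Rightarrow> bool" where
  "answer f (Const x) = x"
| "answer f (Ask c p q) = (f c p = q)"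

definition word_graph :: "nat \<Rightarrow> nat \<Rightarrow> nat \<Rightarrow> (nat \<Rightarrow> nat \<Rightarrow> nat) \<Rightarrow> nat \<Rightarrow> nat set set" where
  "word_graph m L l f b = {{u, v} | u v. answer f (arc_query m L l b u v)}"

primrec word_perm :: "(nat \<Rightarrow> nat \<Rightarrow> nat) \<Rightarrow> nat \<Rightarrow> nat \<Rightarrow> nat" where
  "word_perm f 0 = id"
| "word_perm f (Suc c) = f c \<circ> word_perm f c"

lemma word_perm_permutes:
  "(\<And>c. c < l \<Longrightarrow> f c permutes A) \<Longrightarrow> c \<le> l \<Longrightarrow> word_perm f c permutes A"
proof (induction c)
  case 0
  show ?case by (simp add: permutes_id[unfolded id_def] id_def)
next
  case (Suc c)
  then have "word_perm f c permutes A" "f c permutes A" by simp_all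
  then show ?case unfolding word_perm.simps by (rule permutes_compose)
qed

lemma answer_arc_query_less:
  "answer f (arc_query m L l b u v) \<Longrightarrow> u < m * L \<and> v < m * L \<and> v mod L = Suc (u mod L) mod L"
  unfolding arc_query_def by (auto split: if_splits)

section \<open>Unfolding a word of permutations\<close>

context comp_graph_params
begin

text \<open>Vertex \<open>a * L + c\<close> moves to where start \<open>a\<close> stands at position
  \<open>c\<close>. This renaming turns a standard component graph into the word graph, so the
  counts for arbitrary labellings apply to the latter.\<close>

definition unfold_word :: "(nat \<Rightarrow> nat \<Rightarrow> nat) \<Rightarrow> nat \<Rightarrow> nat" where
  "unfold_word f x = (if x < m * L
     then word_perm f (if x mod L \<le> l then x mod L else L - 1 - x mod L) (x div L) * L + x mod L
     else x)"

context
  fixes f :: "nat \<Rightarrow> nat \<Rightarrow> nat"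
  assumes L_eq: "L = 2 * Suc l" and f: "\<And>c. c < l \<Longrightarrow> f c permutes {..<m}"
begin

private abbreviation h where "h c \<equiv> word_perm f (if c \<le> l then c else L - 1 - c)"

lemma h_permutes: "c < L \<Longrightarrow> h c permutes {..<m}"
  using f L_eq by (intro word_perm_permutes[of l]) auto

lemma h_less: "c < L \<Longrightarrow> h c a < m \<longleftrightarrow> a < m"
  using permutes_in_image[OF h_permutes, of c a] by simp

lemma unfold_word_vertex:
  "a < m \<Longrightarrow> c < L \<Longrightarrow> unfold_word f (a * L + c) = h c a * L + c"
  using comp_vertex_less[of a m c L "m * L"] unfolding unfold_word_def by (simp add: comp_divmod)

lemma unfold_word_permutes: "unfold_word f permutes {..<n}"
proof (rule bij_imp_permutes)
  have L0: "L > 0" using L by simp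
  have mod: "unfold_word f x mod L = x mod L" for x
    unfolding unfold_word_def using L0 by (simp add: comp_divmod)
  have div: "unfold_word f x div L = h (x mod L) (x div L)" if "x < m * L" for x
    unfolding unfold_word_def using L0 that by (simp add: comp_divmod)
  have less: "unfold_word f x < m * L \<longleftrightarrow> x < m * L" for x
  proof (cases "x < m * L")
    case True
    then have "x div L < m" using L0 by (simp add: less_mult_imp_div_less)
    then have "h (x mod L) (x div L) < m" using h_less L0 by simp
    then have "h (x mod L) (x div L) * L + x mod L < m * L"
      using comp_vertex_less[of _ m _ L "m * L"] L0 by simp
    then show ?thesis using True unfolding unfold_word_def by simp
  next
    case False
    then show ?thesis unfolding unfold_word_def by simp
  qed
  have inj: "inj_on (unfold_word f) {..<n}"
  proof (rule inj_onI)
    fix x y assume eq: "unfold_word f x = unfold_word f y"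
    show "x = y"
    proof (cases "x < m * L")
      case True
      then have y: "y < m * L" using less eq by metis
      have m: "x mod L = y mod L" using eq mod by metis
      have "h (x mod L) (x div L) = h (y mod L) (y div L)"
        using div[OF True, symmetric] div[OF y, symmetric] eq by (simp only:)
      then have "h (x mod L) (x div L) = h (x mod L) (y div L)" unfolding m .
      then have "x div L = y div L"
        using permutes_inj[OF h_permutes[of "x mod L"]] L0 by (meson injD mod_less_divisor)
      then show ?thesis using m div_mult_mod_eq by metis
    next
      case False
      then have "\<not> y < m * L" using less eq by metis
      then show ?thesis using eq False unfolding unfold_word_def by simp
    qed
  qed
  have "unfold_word f x < n" if "x < n" for x
  proof (cases "x < m * L")
    case True
    then show ?thesis using less[of x] mL by simp
  next
    case False
    then show ?thesis using that unfolding unfold_word_def by simp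
  qed
  then have "unfold_word f ` {..<n} \<subseteq> {..<n}" by auto
  then have "unfold_word f ` {..<n} = {..<n}" using inj endo_inj_surj[of "{..<n}"] by blast
  then show "bij_betw (unfold_word f) {..<n} {..<n}" using inj by (rule bij_betw_imageI[rotated])
next
  fix x assume "x \<notin> {..<n}"
  then show "unfold_word f x = x" using mL unfolding unfold_word_def by simp
qed

lemma unfold_word_edge:
  assumes "a < m" "c < L"
  shows "unfold_word f ` comp_edge L a c = {h c a * L + c, h (Suc c mod L) a * L + Suc c mod L}"
proof -
  have "Suc c mod L < L" using L by (intro mod_less_divisor) simp
  then show ?thesis using assms unfolding comp_edge_def by (simp add: unfold_word_vertex)
qed

text \<open>At position 0 no map has been applied yet, and at position \<open>L - 1\<close> all of
  them are undone. The edge whose misses are counted can therefore be named without knowing the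
  composition.\<close>

lemma unfold_word_closing_edge:
  assumes "a < m"
  shows "unfold_word f ` comp_edge L a (L - 1) = comp_edge L a (L - 1)"
proof -
  have "\<not> L - 1 \<le> l" "L - 1 < L" "Suc (L - 1) mod L = 0" using L l by auto
  then show ?thesis using unfold_word_edge[OF assms, of "L - 1"] unfolding comp_edge_def by simp
qed

text \<open>An arc is present if its two ends belong to the same start \<open>a\<close>, and at the
  turning point only if that start has arrived at \<open>b\<close>.\<close>

lemma answer_arc_query:
  assumes "c < L" "p < m" "q < m"
  shows "answer f (arc_query m L l b (p * L + c) (q * L + Suc c mod L)) \<longleftrightarrow>
     (\<exists>a<m. p = h c a \<and> q = h (Suc c mod L) a \<and> (c \<noteq> l \<or> p = b))"
proof -
  have s: "Suc c mod L < L" using L by (intro mod_less_divisor) simp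
  have less: "p * L + c < m * L" "q * L + Suc c mod L < m * L"
    using comp_vertex_less[of _ m _ L "m * L"] assms s by auto
  \<comment> \<open>\<open>h c\<close> is a permutation, so only one start is possible.\<close>
  have ex: "(\<exists>a<m. p = h c a \<and> Q a) \<longleftrightarrow> Q (inv (h c) p)" for Q
  proof -
    have "inv (h c) p < m"
      using permutes_in_image[OF permutes_inv[OF h_permutes[OF assms(1)]], of p] assms(2) by simp
    then show ?thesis using permutes_inverses[OF h_permutes[OF assms(1)]] by metis
  qed
  define a where "a = inv (h c) p"
  have p: "p = h c a" unfolding a_def using permutes_inverses[OF h_permutes[OF assms(1)]] by simp
  have "answer f (arc_query m L l b (p * L + c) (q * L + Suc c mod L)) \<longleftrightarrow>
     q = h (Suc c mod L) a \<and> (c \<noteq> l \<or> p = b)"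
  proof -
    consider "c < l" | "c = l" | "l < c" "Suc c < L" | "Suc c = L" using assms(1) by linarith
    then show ?thesis
    proof cases
      case 1
      then have c: "Suc c mod L = Suc c" using l by simp
      have "arc_query m L l b (p * L + c) (q * L + Suc c mod L) = Ask c p q"
        unfolding arc_query_def using less s assms(1) 1 by (simp add: comp_divmod)
      then show ?thesis using 1 p c by auto
    next
      case 2
      then have c: "Suc c mod L = Suc c" using l by simp
      have "arc_query m L l b (p * L + c) (q * L + Suc c mod L) = Const (p = b \<and> q = b)"
        unfolding arc_query_def using less s assms(1) 2 by (simp add: comp_divmod)
      \<comment> \<open>Positions \<open>l\<close> and \<open>l + 1\<close> both carry the value
        after all \<open>l\<close> maps.\<close>
      moreover have "h (Suc c) = h c" using 2 L_eq by simp
      ultimately show ?thesis using 2 p c by auto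
    next
      case 3
      then have c: "Suc c mod L = Suc c" using l by simp
      have "arc_query m L l b (p * L + c) (q * L + Suc c mod L) = Ask (L - 2 - c) q p"
        unfolding arc_query_def using less s assms(1) 3 comp_divmod[of "Suc c" q]
        by (simp add: comp_divmod)
      moreover have "L - 1 - c = Suc (L - 2 - c)" using 3 by simp
      then have "p = f (L - 2 - c) (h (Suc c) a)" using 3 p by simp
      moreover have "L - 2 - c < l" using 3 L_eq by simp
      then have "inj (f (L - 2 - c))" using f permutes_inj by blast
      ultimately show ?thesis using 3 c by (auto dest: injD)
    next
      case 4
      then have c: "Suc c mod L = 0" "\<not> c \<le> l" "c \<noteq> l" using l by auto
      have "arc_query m L l b (p * L + c) (q * L + Suc c mod L) = Const (p = q)"
        unfolding arc_query_def using less s assms(1) 4 c by (simp add: comp_divmod)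
      moreover have "h c = id" using 4 c by simp
      ultimately show ?thesis using p c by auto
    qed
  qed
  then show ?thesis unfolding ex a_def .
qed

lemma relabel_unfold_word:
  assumes "a0 < m"
  shows "relabel (unfold_word f) (G a0) = word_graph m L l f (word_perm f l a0)"
proof (intro equalityI subsetI)
  fix e assume "e \<in> relabel (unfold_word f) (G a0)"
  then obtain a c where ac: "a < m" "c < L" "c \<noteq> l \<or> a = a0" "e = unfold_word f ` comp_edge L a c"
    unfolding relabel_def comp_graph_def by blast
  have s: "Suc c mod L < L" using L by (intro mod_less_divisor) simp
  have "answer f (arc_query m L l (word_perm f l a0) (h c a * L + c) (h (Suc c mod L) a * L + Suc c mod L))"
    using ac h_less[OF ac(2)] h_less[OF s] by (subst answer_arc_query) auto
  then show "e \<in> word_graph m L l f (word_perm f l a0)"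
    unfolding word_graph_def ac(4) unfold_word_edge[OF ac(1,2)] by blast
next
  have L0: "L > 0" using L by simp
  fix e assume "e \<in> word_graph m L l f (word_perm f l a0)"
  then obtain u v where e: "e = {u, v}" and ans: "answer f (arc_query m L l (word_perm f l a0) u v)"
    unfolding word_graph_def by blast
  define c p q where "c = u mod L" and "p = u div L" and "q = v div L"
  have uv: "u < m * L" "v < m * L" "v mod L = Suc c mod L"
    using answer_arc_query_less[OF ans] unfolding c_def by auto
  have u: "u = p * L + c" and v: "v = q * L + Suc c mod L"
    unfolding c_def p_def q_def using uv(3)[symmetric] by (simp_all add: c_def)
  have pq: "p < m" "q < m" "c < L"
    using uv L0 unfolding p_def q_def c_def by (simp_all add: less_mult_imp_div_less)
  obtain a where a: "a < m" "p = h c a" "q = h (Suc c mod L) a" "c \<noteq> l \<or> p = word_perm f l a0"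
    using ans unfolding u v answer_arc_query[OF pq(3,1,2)] by blast
  have "c \<noteq> l \<or> a = a0"
  proof (cases "c = l")
    case True
    then have "word_perm f l a = word_perm f l a0" using a by simp
    moreover have "inj (word_perm f l)"
      using word_perm_permutes[of l f "{..<m}" l] f permutes_inj by blast
    ultimately show ?thesis by (auto dest: injD)
  qed simp
  then have "comp_edge L a c \<in> G a0" unfolding comp_graph_def using a(1) pq(3) by blast
  moreover have "e = unfold_word f ` comp_edge L a c"
    unfolding e u v unfold_word_edge[OF a(1) pq(3)] a(2,3) ..
  ultimately show "e \<in> relabel (unfold_word f) (G a0)" unfolding relabel_def by blast
qed

end

end

text \<open>The word graph for \<open>b\<close> is an unfolded copy of the standard graph whose
  cycle is at the start \<open>a0\<close> with image \<open>b\<close>, so \<open>a = a0\<close>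
  means that the word maps \<open>a\<close> to \<open>b\<close>. The relabellings are chosen before
  the word and can thus be built into the algorithm.\<close>

lemma (in approx_tree) ex_relabellings_word:
  assumes "L = 2 * Suc l"
  shows "\<exists>\<sigma>. (\<forall>i<80 * L * n\<^sup>2. \<sigma> i permutes {..<n}) \<and>
     (\<forall>f a b. (\<forall>c<l. f c permutes {..<m}) \<longrightarrow> a < m \<longrightarrow> b < m \<longrightarrow>
        20 * n\<^sup>2 \<le> card {i. i < 80 * L * n\<^sup>2 \<and>
            \<sigma> i ` comp_edge L a (L - 1) \<notin> T (relabel (\<sigma> i) (word_graph m L l f b))}
        \<longleftrightarrow> word_perm f l a = b)"
proof -
  obtain \<sigma> where \<sigma>: "\<forall>i<80 * L * n\<^sup>2. \<sigma> i permutes {..<n}"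
    and cnt: "\<And>\<tau> a b. \<tau> permutes {..<n} \<Longrightarrow> a < m \<Longrightarrow> b < m \<Longrightarrow>
        20 * n\<^sup>2 \<le> card {i. i < 80 * L * n\<^sup>2 \<and>
            \<sigma> i ` (\<tau> ` comp_edge L a (L - 1)) \<notin> T (relabel (\<sigma> i) (relabel \<tau> (G b)))} \<longleftrightarrow> a = b"
    using ex_relabellings by blast
  have "20 * n\<^sup>2 \<le> card {i. i < 80 * L * n\<^sup>2 \<and>
            \<sigma> i ` comp_edge L a (L - 1) \<notin> T (relabel (\<sigma> i) (word_graph m L l f b))}
        \<longleftrightarrow> word_perm f l a = b"
    if f: "\<forall>c<l. f c permutes {..<m}" and a: "a < m" and b: "b < m" for f a b
  proof -
    have g: "word_perm f l permutes {..<m}" using word_perm_permutes[of l f "{..<m}" l] f by simp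
    define a0 where "a0 = inv (word_perm f l) b"
    have a0: "a0 < m" "word_perm f l a0 = b"
      unfolding a0_def using permutes_in_image[OF permutes_inv[OF g], of b] b permutes_inverses[OF g]
      by auto
    have "a = a0 \<longleftrightarrow> word_perm f l a = b" using a0 permutes_inj[OF g] by (auto dest: injD)
    moreover have f': "\<And>c. c < l \<Longrightarrow> f c permutes {..<m}" using f by blast
    have "unfold_word f permutes {..<n}"
      and "unfold_word f ` comp_edge L a (L - 1) = comp_edge L a (L - 1)"
      and "relabel (unfold_word f) (G a0) = word_graph m L l f b"
      using unfold_word_permutes[of f, OF assms f'] unfold_word_closing_edge[of f, OF assms f' a]
        relabel_unfold_word[of f, OF assms f' a0(1)] unfolding a0(2) by blast+
    ultimately show ?thesis using cnt[of "unfold_word f", OF _ a a0(1)] by simp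
  qed
  then show ?thesis using \<sigma> by (intro exI[of _ \<sigma>]) blast
qed

section \<open>Programs for named machines\<close>

text \<open>Machines carry arbitrary names, which are turned into numbers only by \<open>to_mpc\<close>.\<close>

type_synonym 'i round =
  "('i \<Rightarrow> nat list \<Rightarrow> 'i \<Rightarrow> nat list) \<times> ('i \<Rightarrow> nat list \<Rightarrow> ('i \<Rightarrow> nat list) \<Rightarrow> nat list)"

locale mpc_program =
  fixes X :: "'i set" and S W :: nat
  assumes finite_X: "finite X"
begin

definition ok :: "nat list \<Rightarrow> bool" where
  "ok ws \<longleftrightarrow> length ws \<le> S \<and> (\<forall>w\<in>set ws. w < W)"

definition step :: "'i round \<Rightarrow> ('i \<Rightarrow> nat list) \<Rightarrow> 'i \<Rightarrow> nat list" where
  "step rd M = (\<lambda>i. snd rd i (M i) (\<lambda>j. if j \<in> X then fst rd j (M j) i else []))"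

definition legal :: "'i round \<Rightarrow> ('i \<Rightarrow> nat list) \<Rightarrow> bool" where
  "legal rd M \<longleftrightarrow> (\<forall>i\<in>X. (\<Sum>j\<in>X. length (fst rd i (M i) j)) \<le> S \<and>
     (\<Sum>j\<in>X. length (fst rd j (M j) i)) \<le> S \<and> (\<forall>j\<in>X. \<forall>w\<in>set (fst rd i (M i) j). w < W))"

primrec run :: "'i round list \<Rightarrow> ('i \<Rightarrow> nat list) \<Rightarrow> 'i \<Rightarrow> nat list" where
  "run [] M = M"
| "run (rd # rds) M = run rds (step rd M)"

primrec valid :: "'i round list \<Rightarrow> ('i \<Rightarrow> nat list) \<Rightarrow> bool" where
  "valid [] M = True"
| "valid (rd # rds) M = (legal rd M \<and> (\<forall>i\<in>X. ok (step rd M i)) \<and> valid rds (step rd M))"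

text \<open>Hoare triples that include the space and communication limits. That all memories are
  \<open>ok\<close> is assumed and preserved throughout, so the assertions speak only of
  contents.\<close>

definition triple where
  "triple P rds Q \<longleftrightarrow> (\<forall>M. (\<forall>i\<in>X. ok (M i)) \<longrightarrow> P M \<longrightarrow> valid rds M \<and> Q (run rds M))"

lemma run_append: "run (r1 @ r2) M = run r2 (run r1 M)"
  by (induction r1 arbitrary: M) auto

lemma valid_append: "valid (r1 @ r2) M \<longleftrightarrow> valid r1 M \<and> valid r2 (run r1 M)"
  by (induction r1 arbitrary: M) auto

lemma valid_ok: "valid rds M \<Longrightarrow> \<forall>i\<in>X. ok (M i) \<Longrightarrow> \<forall>i\<in>X. ok (run rds M i)"
  by (induction rds arbitrary: M) auto

lemma triple_append: "triple P r1 Q \<Longrightarrow> triple Q r2 R \<Longrightarrow> triple P (r1 @ r2) R"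
  unfolding triple_def valid_append run_append using valid_ok by blast

lemma triple_single:
  assumes "\<And>M. \<forall>i\<in>X. ok (M i) \<Longrightarrow> P M \<Longrightarrow> legal rd M"
    "\<And>M i. \<forall>i\<in>X. ok (M i) \<Longrightarrow> P M \<Longrightarrow> i \<in> X \<Longrightarrow> ok (step rd M i)"
    "\<And>M. \<forall>i\<in>X. ok (M i) \<Longrightarrow> P M \<Longrightarrow> Q (step rd M)"
  shows "triple P [rd] Q"
  using assms unfolding triple_def by auto

lemma triple_iter:
  assumes "\<And>t. t < h \<Longrightarrow> triple (P t) (rds t) (P (Suc t))"
  shows "triple (P 0) (concat (map rds [0..<h])) (P h)"
  using assms
proof (induction h)
  case 0
  show ?case unfolding triple_def by simp
next
  case (Suc h)
  then have "triple (P 0) (concat (map rds [0..<h])) (P h)" by simp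
  moreover have "triple (P h) (rds h) (P (Suc h))" using Suc.prems by simp
  ultimately show ?case using triple_append by simp
qed

lemma triple_conseq:
  "triple P rds Q \<Longrightarrow> (\<And>M. P' M \<Longrightarrow> P M) \<Longrightarrow> (\<And>M. Q M \<Longrightarrow> Q' M) \<Longrightarrow> triple P' rds Q'"
  unfolding triple_def by blast

text \<open>Only first words are sent, so that the legality of a pull round depends on degrees alone.\<close>

definition pull :: "('i \<Rightarrow> 'i set) \<Rightarrow> ('i \<Rightarrow> nat list \<Rightarrow> ('i \<Rightarrow> nat list) \<Rightarrow> nat list) \<Rightarrow> 'i round" where
  "pull src g = (\<lambda>j w i. if j \<in> src i then take 1 w else [], g)"

lemma step_pull:
  "step (pull src g) M i = g i (M i) (\<lambda>j. if j \<in> X \<and> j \<in> src i then take 1 (M j) else [])"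
proof -
  have "(\<lambda>j. if j \<in> X then if j \<in> src i then take 1 (M j) else [] else []) =
      (\<lambda>j. if j \<in> X \<and> j \<in> src i then take 1 (M j) else [])" by auto
  then show ?thesis unfolding step_def pull_def fst_conv snd_conv by simp
qed

lemma legal_pull:
  assumes "\<forall>i\<in>X. ok (M i)" and "\<And>i. i \<in> X \<Longrightarrow> card {j\<in>X. j \<in> src i} \<le> S"
    "\<And>j. j \<in> X \<Longrightarrow> card {i\<in>X. j \<in> src i} \<le> S"
  shows "legal (pull src g) M"
proof -
  have le: "(\<Sum>j\<in>X. length (if Q j then take 1 (w j) else [])) \<le> card {j\<in>X. Q j}"
    for Q and w :: "'i \<Rightarrow> nat list"
  proof -
    have "(\<Sum>j\<in>X. length (if Q j then take 1 (w j) else [])) \<le> (\<Sum>j\<in>X. if Q j then 1 else 0)"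
      by (intro sum_mono) auto
    also have "\<dots> = card {j\<in>X. Q j}" using finite_X by (simp add: sum.If_cases Int_def)
    finally show ?thesis .
  qed
  have words: "w < W" if "i \<in> X" "w \<in> set (if Q then take 1 (M i) else [])" for i Q w
    using that assms(1) in_set_takeD[of w 1 "M i"] unfolding ok_def by (auto split: if_splits)
  show ?thesis unfolding legal_def pull_def fst_conv
  proof (intro ballI conjI)
    fix i assume i: "i \<in> X"
    show "(\<Sum>j\<in>X. length (if i \<in> src j then take 1 (M i) else [])) \<le> S"
      using le[of "\<lambda>j. i \<in> src j" "\<lambda>_. M i"] assms(3)[OF i] by (rule order_trans)
    show "(\<Sum>j\<in>X. length (if j \<in> src i then take 1 (M j) else [])) \<le> S"
      using le[of "\<lambda>j. j \<in> src i" M] assms(2)[OF i] by (rule order_trans)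
    fix j w assume "w \<in> set (if i \<in> src j then take 1 (M i) else [])"
    then show "w < W" by (rule words[OF i])
  qed
qed

lemma legal_pullI:
  assumes "\<forall>i\<in>X. ok (M i)"
    "\<And>i. i \<in> X \<Longrightarrow> \<exists>Y. {j\<in>X. j \<in> src i} \<subseteq> Y \<and> finite Y \<and> card Y \<le> S"
    "\<And>j. j \<in> X \<Longrightarrow> \<exists>Y. {i\<in>X. j \<in> src i} \<subseteq> Y \<and> finite Y \<and> card Y \<le> S"
  shows "legal (pull src g) M"
  using assms(1)
proof (rule legal_pull)
  fix i assume "i \<in> X"
  then show "card {j\<in>X. j \<in> src i} \<le> S" using assms(2) card_mono order_trans by metis
next
  fix j assume "j \<in> X"
  then show "card {i\<in>X. j \<in> src i} \<le> S" using assms(3) card_mono order_trans by metis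
qed

lemma ok_take: "ok ws \<Longrightarrow> ok (take k ws)"
  unfolding ok_def using in_set_takeD by fastforce

section \<open>Numbering the machines\<close>

definition to_mpc :: "('i \<Rightarrow> nat) \<Rightarrow> 'i round list \<Rightarrow> mpc" where
  "to_mpc enc rds = \<lparr>machines = card X, local_space = S, word_bound = W, rounds = length rds,
     send = (\<lambda>t i w j. fst (rds ! t) (inv_into X enc i) w (inv_into X enc j)),
     receive = (\<lambda>t i w inbox. snd (rds ! t) (inv_into X enc i) w
        (\<lambda>id. if id \<in> X then inbox (enc id) else []))\<rparr>"

lemma to_mpc_simps [simp]:
  "machines (to_mpc enc rds) = card X" "local_space (to_mpc enc rds) = S"
  "word_bound (to_mpc enc rds) = W" "rounds (to_mpc enc rds) = length rds"
  unfolding to_mpc_def by simp_all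

lemma send_to_mpc:
  "send (to_mpc enc rds) t i w j = fst (rds ! t) (inv_into X enc i) w (inv_into X enc j)"
  unfolding to_mpc_def by simp

lemma receive_to_mpc:
  "receive (to_mpc enc rds) t i w inbox =
     snd (rds ! t) (inv_into X enc i) w (\<lambda>id. if id \<in> X then inbox (enc id) else [])"
  unfolding to_mpc_def by simp

lemma fits_to_mpc: "fits (to_mpc enc rds) ws \<longleftrightarrow> ok ws"
  unfolding fits_def ok_def by simp

text \<open>The counterpart of \<open>distribution\<close>; distinct and pairwise disjoint lists
  together mean that every item occurs once.\<close>

definition input_state :: "nat list set \<Rightarrow> ('i \<Rightarrow> nat list) \<Rightarrow> bool" where
  "input_state I M \<longleftrightarrow> (\<exists>B :: 'i \<Rightarrow> nat list list. (\<forall>i\<in>X. M i = concat (B i) \<and> distinct (B i)) \<and>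
     (\<forall>i\<in>X. \<forall>j\<in>X. i \<noteq> j \<longrightarrow> set (B i) \<inter> set (B j) = {}) \<and> (\<Union>i\<in>X. set (B i)) = I)"

context
  fixes enc :: "'i \<Rightarrow> nat"
  assumes enc: "bij_betw enc X {..<card X}"
begin

lemma enc_less: "i \<in> X \<Longrightarrow> enc i < card X"
  using enc bij_betwE by blast

lemma dec_enc: "i \<in> X \<Longrightarrow> inv_into X enc (enc i) = i"
  using enc by (simp add: bij_betw_imp_inj_on)

lemma enc_surj: "k < card X \<Longrightarrow> \<exists>i\<in>X. k = enc i"
  using enc unfolding bij_betw_def by (metis imageE lessThan_iff)

lemma memory_to_mpc:
  assumes "t \<le> length rds" "i \<in> X"
  shows "memory (to_mpc enc rds) m t (enc i) = run (take t rds) (\<lambda>i. m (enc i)) i"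
  using assms
proof (induction t arbitrary: i)
  case 0
  then show ?case by simp
next
  case (Suc t)
  let ?R = "run (take t rds) (\<lambda>i. m (enc i))"
  have IH: "memory (to_mpc enc rds) m t (enc j) = ?R j" if "j \<in> X" for j
    using Suc that by simp
  have "(\<lambda>id. if id \<in> X then (if enc id < machines (to_mpc enc rds)
          then send (to_mpc enc rds) t (enc id) (memory (to_mpc enc rds) m t (enc id)) (enc i)
          else []) else []) = (\<lambda>j. if j \<in> X then fst (rds ! t) j (?R j) i else [])"
    using IH enc_less dec_enc Suc.prems(2) by (auto simp: send_to_mpc)
  then have "memory (to_mpc enc rds) m (Suc t) (enc i) =
      snd (rds ! t) i (?R i) (\<lambda>j. if j \<in> X then fst (rds ! t) j (?R j) i else [])"
    unfolding memory.simps receive_to_mpc IH[OF Suc.prems(2)] dec_enc[OF Suc.prems(2)] by (rule arg_cong)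
  also have "\<dots> = run (take (Suc t) rds) (\<lambda>i. m (enc i)) i"
    using Suc.prems(1) by (simp add: take_Suc_conv_app_nth run_append step_def)
  finally show ?case .
qed

lemma valid_take: "valid rds M \<Longrightarrow> valid (take t rds) M"
  using valid_append[of "take t rds" "drop t rds" M] by simp

lemma valid_nth: "valid rds M \<Longrightarrow> t < length rds \<Longrightarrow> legal (rds ! t) (run (take t rds) M)"
  using valid_append[of "take t rds" "rds ! t # drop (Suc t) rds" M] id_take_nth_drop[of t rds] by simp

lemma length_concat_enc:
  "length (concat (map f [0..<card X])) = (\<Sum>i\<in>X. length (f (enc i)))"
proof -
  have "length (concat (map f [0..<card X])) = (\<Sum>k<card X. length (f k))"
    by (simp add: length_concat comp_def interv_sum_list_conv_sum_set_nat atLeast0LessThan)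
  also have "\<dots> = (\<Sum>i\<in>X. length (f (enc i)))"
    by (rule sum.reindex_bij_betw[OF enc, symmetric])
  finally show ?thesis .
qed

lemma obeys_limits_to_mpc:
  assumes ok: "\<forall>i\<in>X. ok (m (enc i))" and valid: "valid rds (\<lambda>i. m (enc i))"
  shows "obeys_limits (to_mpc enc rds) m"
  unfolding obeys_limits_def to_mpc_simps fits_to_mpc
proof (intro conjI allI impI)
  fix k t assume "k < card X" "t \<le> length rds"
  then obtain i where i: "i \<in> X" "k = enc i" using enc_surj by blast
  then show "ok (memory (to_mpc enc rds) m t k)"
    using memory_to_mpc[OF \<open>t \<le> length rds\<close> i(1)] valid_ok[OF valid_take[OF valid] ok] by simp
next
  fix k t assume "k < card X" and t: "t < length rds"
  then obtain i where i: "i \<in> X" "k = enc i" using enc_surj by blast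
  let ?M = "run (take t rds) (\<lambda>i. m (enc i))"
  have legal: "legal (rds ! t) ?M" using valid_nth[OF valid t] .
  have s: "send (to_mpc enc rds) t (enc a) (memory (to_mpc enc rds) m t (enc a)) (enc b)
      = fst (rds ! t) a (?M a) b" if "a \<in> X" "b \<in> X" for a b
    using memory_to_mpc[of t rds a m] t that dec_enc by (simp add: to_mpc_def)
  have words: "w < W" if "w \<in> set (send (to_mpc enc rds) t x (memory (to_mpc enc rds) m t x) y)"
    and x: "x < card X" and y: "y < card X" for w x y
  proof -
    obtain a where a: "a \<in> X" "x = enc a" using enc_surj[OF x] by blast
    obtain b where b: "b \<in> X" "y = enc b" using enc_surj[OF y] by blast
    show ?thesis using that(1) s[of a b] legal a b unfolding legal_def by auto
  qed
  show "ok (concat (map (\<lambda>j. send (to_mpc enc rds) t k (memory (to_mpc enc rds) m t k) j) [0..<card X]))"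
    unfolding ok_def length_concat_enc
  proof
    show "(\<Sum>j\<in>X. length (send (to_mpc enc rds) t k (memory (to_mpc enc rds) m t k) (enc j))) \<le> S"
      using legal i s unfolding legal_def by simp
  qed (use words \<open>k < card X\<close> in auto)
  show "ok (concat (map (\<lambda>j. send (to_mpc enc rds) t j (memory (to_mpc enc rds) m t j) k) [0..<card X]))"
    unfolding ok_def length_concat_enc
  proof
    show "(\<Sum>j\<in>X. length (send (to_mpc enc rds) t (enc j) (memory (to_mpc enc rds) m t (enc j)) k)) \<le> S"
      using legal i s unfolding legal_def by simp
  qed (use words \<open>k < card X\<close> in auto)
qed

end

end

lemma distinct_concat_map_upt:
  assumes "distinct (concat (map B [0..<p]))"
  shows "k < p \<Longrightarrow> distinct (B k)"
    "k < p \<Longrightarrow> k' < p \<Longrightarrow> k \<noteq> k' \<Longrightarrow> set (B k) \<inter> set (B k') = {}"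
  using assms
proof (induction p)
  case (Suc p)
  { case 1 then show ?case using Suc by (cases "k = p") auto }
  { case 2 then show ?case using Suc by (cases "k = p"; cases "k' = p") (auto 4 4) }
qed auto

section \<open>Simulating the spanning tree algorithm\<close>

lemma (in mpc_program) solves_to_mpc:
  assumes enc: "bij_betw enc X {..<card X}" and i0: "i0 \<in> X" "enc i0 = 0"
    and rds: "triple (input_state I) rds (\<lambda>M. M i0 = v)"
    and I: "finite I" "card I \<le> card X" "\<And>ws. ws \<in> I \<Longrightarrow> ok ws"
  shows "solves (to_mpc enc rds) I (\<lambda>out. out 0 = v)"
  unfolding solves_def
proof (intro conjI allI impI)
  obtain g where g: "bij_betw g {..<card I} I"
    using ex_bij_betw_nat_finite[OF I(1)] by (auto simp: atLeast0LessThan)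
  \<comment> \<open>There are enough machines to give each item one of its own.\<close>
  define B where "B k = (if k < card I then [g k] else [])" for k
  have gI: "g k \<in> I" if "k < card I" for k using g that bij_betwE by blast
  have "concat (map B [0..<q]) = map g [0..<min q (card I)]" for q
    by (induction q) (auto simp: B_def min_def)
  then have c: "concat (map B [0..<card X]) = map g [0..<card I]" using I(2) by (simp add: min_def)
  have "distinct (concat (map B [0..<card X]))" "set (concat (map B [0..<card X])) = I"
    unfolding c using g by (auto simp: bij_betw_def distinct_map atLeast0LessThan)
  moreover have "ok (concat (B k))" for k
    using I(3)[OF gI, of k] unfolding B_def ok_def by auto
  ultimately show "\<exists>m. distribution (to_mpc enc rds) I m"
    unfolding distribution_def to_mpc_simps fits_to_mpc
    by (intro exI[of _ "\<lambda>k. concat (B k)"] exI[of _ B]) simp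
next
  fix m assume "distribution (to_mpc enc rds) I m"
  then obtain B where B: "\<forall>i<card X. m i = concat (B i) \<and> ok (m i)"
      "distinct (concat (map B [0..<card X]))" "set (concat (map B [0..<card X])) = I"
    unfolding distribution_def to_mpc_simps fits_to_mpc by blast
  let ?M = "\<lambda>i. m (enc i)"
  have okM: "\<forall>i\<in>X. ok (?M i)" using B(1) enc_less[OF enc] by blast
  have "input_state I ?M"
    unfolding input_state_def
  proof (intro exI[of _ "\<lambda>i. B (enc i)"] conjI ballI impI)
    fix i assume "i \<in> X"
    then show "m (enc i) = concat (B (enc i))" "distinct (B (enc i))"
      using B enc_less[OF enc] distinct_concat_map_upt(1)[OF B(2)] by blast+
  next
    fix i j assume ij: "i \<in> X" "j \<in> X" "i \<noteq> j"
    then have "enc i \<noteq> enc j" using enc by (meson bij_betw_def inj_on_eq_iff)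
    then show "set (B (enc i)) \<inter> set (B (enc j)) = {}"
      using distinct_concat_map_upt(2)[OF B(2)] ij enc_less[OF enc] by blast
  next
    have "(\<Union>i\<in>X. set (B (enc i))) = (\<Union>k\<in>enc ` X. set (B k))" by simp
    also have "enc ` X = {..<card X}" using enc by (simp add: bij_betw_def)
    finally show "(\<Union>i\<in>X. set (B (enc i))) = I" using B(3) by (simp add: atLeast0LessThan)
  qed
  then have v: "valid rds ?M" "run rds ?M i0 = v" using rds okM unfolding triple_def by auto
  show "obeys_limits (to_mpc enc rds) m" using obeys_limits_to_mpc[OF enc okM v(1)] .
  show "memory (to_mpc enc rds) m (rounds (to_mpc enc rds)) 0 = v"
    using memory_to_mpc[OF enc order_refl i0(1), of rds m] v(2) i0(2) by simp
qed

text \<open>Inverse to writing edges as consecutive words; an unpaired last word is ignored.\<close>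

fun pairs :: "nat list \<Rightarrow> (nat \<times> nat) list" where
  "pairs (x # y # zs) = (x, y) # pairs zs"
| "pairs _ = []"

lemma pairs_concat: "pairs (concat (map (\<lambda>(u, v). [u, v]) es)) = es"
  by (induction es) auto

lemma length_pairs: "2 * length (pairs ws) \<le> length ws"
  by (induction ws rule: pairs.induct) auto

definition edge_set :: "nat list \<Rightarrow> nat set set" where
  "edge_set ws = {{u, v} | u v. (u, v) \<in> set (pairs ws)}"

lemma edge_set_image: "edge_set ws = (\<lambda>(u, v). {u, v}) ` set (pairs ws)"
  unfolding edge_set_def by auto

lemma finite_edge_set [simp]: "finite (edge_set ws)"
  unfolding edge_set_image by simp

lemma card_edge_set: "card (edge_set ws) \<le> length ws"
proof -
  have "card (edge_set ws) \<le> card (set (pairs ws))" unfolding edge_set_image by (intro card_image_le) simp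
  also have "\<dots> \<le> length (pairs ws)" by (rule card_length)
  finally show ?thesis using length_pairs[of ws] by linarith
qed

text \<open>The edge lists can be recovered from the memories, so the tree is unique and each
  machine can tell which edges it contributes.\<close>

lemma outputs_edges_edge_set: "outputs_edges p out T \<Longrightarrow> T = (\<Union>j<p. edge_set (out j))"
  unfolding outputs_edges_def edge_set_def
proof (elim exE conjE)
  fix es :: "nat \<Rightarrow> (nat \<times> nat) list"
  assume out: "\<forall>i<p. out i = concat (map (\<lambda>(u, v). [u, v]) (es i))"
    and T: "T = (\<Union>i<p. {{u, v} | u v. (u, v) \<in> set (es i)})"
  have "pairs (out i) = es i" if "i < p" for i using out that pairs_concat by simp
  then show "T = (\<Union>j<p. {{u, v} | u v. (u, v) \<in> set (pairs (out j))})" unfolding T by simp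
qed

text \<open>
  \<open>Cell k x y t\<close> holds a nonempty memory iff permutation number \<open>k\<close> maps \<open>x\<close> to \<open>y\<close>, and \<open>t\<close>
  numbers the copies of that bit.  \<open>Block b i j\<close> simulates machine \<open>j\<close> of the spanning tree
  algorithm on the \<open>i\<close>-th relabelling of the word graph for \<open>b\<close>.  \<open>Tree q b i a t\<close> are the leaves
  and inner nodes of summation trees.
\<close>

datatype node =
  Home nat | Cell nat nat nat nat | Block nat nat nat | Tree nat nat nat nat nat | Out

text \<open>The placement \<open>items\<close> of the pairs is the same for all graphs
  \<open>H\<close>; only the third word of each item depends on \<open>H\<close>.\<close>

definition metric_state :: "(nat \<Rightarrow> (nat \<times> nat) list) \<Rightarrow> nat set set \<Rightarrow> nat \<Rightarrow> nat list" where
  "metric_state items H j = concat (map (\<lambda>(x, y). [x, y, dist_of H x y]) (items j))"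

definition output_tree :: "mpc \<Rightarrow> (nat \<Rightarrow> (nat \<times> nat) list) \<Rightarrow> nat set set \<Rightarrow> nat set set" where
  "output_tree A items H =
     (\<Union>j<machines A. edge_set (memory A (metric_state items H) (rounds A) j))"

text \<open>\<open>tc\<close> gives every lookup, by a block for an ordered pair of points, its own
  copy of a bit. The \<open>Q = s ^ h\<close> copies are made along a tree of arity \<open>s\<close>
  and height \<open>h\<close>, and sums are taken along trees of the same shape;
  \<open>Q < W\<close> because these sums are stored as words. The bound \<open>8 \<le> S\<close>
  covers the messages of a home in \<open>init_round\<close>.\<close>

locale simulation = comp_graph_params n m L l for n m L l :: nat +
  fixes A :: mpc and N R s h Q S W :: nat
    and items :: "nat \<Rightarrow> (nat \<times> nat) list" and \<sigma> :: "nat \<Rightarrow> nat \<Rightarrow> nat"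
    and tc :: "nat \<times> nat \<times> nat \<times> nat \<times> nat \<Rightarrow> nat"
  assumes L_eq: "L = 2 * Suc l"
    and items: "\<And>j x y. j < machines A \<Longrightarrow> (x, y) \<in> set (items j) \<Longrightarrow> x < y \<and> y < n"
    and items_length: "\<And>j. j < machines A \<Longrightarrow> 3 * length (items j) \<le> local_space A"
    and obeys: "\<And>H. H \<subseteq> complete_edges n \<Longrightarrow> obeys_limits A (metric_state items H)"
    and \<sigma>: "\<And>i. i < R \<Longrightarrow> \<sigma> i permutes {..<n}"
    and tc_inj: "inj_on tc ({..<m} \<times> {..<R} \<times> {..<machines A} \<times> {..<n} \<times> {..<n})"
    and tc_less: "\<And>z. z \<in> {..<m} \<times> {..<R} \<times> {..<machines A} \<times> {..<n} \<times> {..<n} \<Longrightarrow> tc z < Q"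
    and Q: "Q = s ^ h" "R \<le> Q" "machines A \<le> Q" and s: "0 < s"
    and S: "local_space A \<le> S" "s \<le> S" "8 \<le> S"
    and W: "word_bound A \<le> W" "n \<le> W" "Q < W" "2 < W" "2 * N \<le> W"
begin

fun node_ok :: "node \<Rightarrow> bool" where
  "node_ok (Home u) = (u < 2 * N)"
| "node_ok (Cell k x y t) = (k < 3 \<and> x < m \<and> y < m \<and> t < Q)"
| "node_ok (Block b i j) = (b < m \<and> i < R \<and> j < machines A)"
| "node_ok (Tree q b i a t) = (q < 2 \<and> b < m \<and> i < R \<and> a < m \<and> t < Q)"
| "node_ok Out = True"

definition X where "X = {i. node_ok i}"

lemma X_eq: "X = Home ` {..<2 * N} \<union>
    (\<lambda>(k, x, y, t). Cell k x y t) ` ({..<3} \<times> {..<m} \<times> {..<m} \<times> {..<Q}) \<union>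
    (\<lambda>(b, i, j). Block b i j) ` ({..<m} \<times> {..<R} \<times> {..<machines A}) \<union>
    (\<lambda>(q, b, i, a, t). Tree q b i a t) ` ({..<2} \<times> {..<m} \<times> {..<R} \<times> {..<m} \<times> {..<Q}) \<union> {Out}"
  (is "_ = ?U")
proof (intro equalityI subsetI)
  fix i assume "i \<in> X"
  then show "i \<in> ?U" unfolding X_def by (cases i) (auto simp: image_iff)
qed (auto simp: X_def)

lemma finite_X: "finite X"
  unfolding X_eq by simp

lemma card_X: "card X \<le> 2 * N + 3 * m\<^sup>2 * Q + m * R * machines A + 2 * m\<^sup>2 * R * Q + 1"
proof -
  have im: "card (f ` P) \<le> card P" if "finite P" for f :: "'x \<Rightarrow> node" and P
    using card_image_le[OF that] .
  have "card X \<le> card (Home ` {..<2 * N}) +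
      card ((\<lambda>(k, x, y, t). Cell k x y t) ` ({..<3} \<times> {..<m} \<times> {..<m} \<times> {..<Q})) +
      card ((\<lambda>(b, i, j). Block b i j) ` ({..<m} \<times> {..<R} \<times> {..<machines A})) +
      card ((\<lambda>(q, b, i, a, t). Tree q b i a t) ` ({..<2} \<times> {..<m} \<times> {..<R} \<times> {..<m} \<times> {..<Q})) +
      card {Out}"
    unfolding X_eq by (intro order_trans[OF card_Un_le] add_mono order_refl)
  also have "\<dots> \<le> card {..<2 * N} + card ({..<3::nat} \<times> {..<m} \<times> {..<m} \<times> {..<Q}) +
      card ({..<m} \<times> {..<R} \<times> {..<machines A}) +
      card ({..<2::nat} \<times> {..<m} \<times> {..<R} \<times> {..<m} \<times> {..<Q}) + 1"
    by (intro add_mono im) auto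
  also have "\<dots> = 2 * N + 3 * m\<^sup>2 * Q + m * R * machines A + 2 * m\<^sup>2 * R * Q + 1"
    by (simp add: card_cartesian_product power2_eq_square)
  finally show ?thesis .
qed

sublocale mpc_program X S W
  by standard (rule finite_X)

lemma X_simps [simp]:
  "Home u \<in> X \<longleftrightarrow> u < 2 * N"
  "Cell k x y t \<in> X \<longleftrightarrow> k < 3 \<and> x < m \<and> y < m \<and> t < Q"
  "Block b i j \<in> X \<longleftrightarrow> b < m \<and> i < R \<and> j < machines A"
  "Tree q b i a t \<in> X \<longleftrightarrow> q < 2 \<and> b < m \<and> i < R \<and> a < m \<and> t < Q"
  "Out \<in> X"
  unfolding X_def by auto

lemma Q_pos: "0 < Q" unfolding Q(1) using s by simp

lemma S_pos: "1 \<le> S" using S(3) by simp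

lemma div_eq_iff: "t div s = t' \<longleftrightarrow> t' * s \<le> t \<and> t < t' * s + s"
proof
  show "t div s = t' \<Longrightarrow> t' * s \<le> t \<and> t < t' * s + s"
    using s div_times_less_eq_dividend[of t s] dividend_less_div_times[OF s, of t] by auto
  show "t' * s \<le> t \<and> t < t' * s + s \<Longrightarrow> t div s = t'"
    using s by (intro div_nat_eqI) (auto simp: mult.commute)
qed

section \<open>Broadcast of the bits of the permutations\<close>

definition cells :: "(nat \<Rightarrow> nat \<Rightarrow> nat) \<Rightarrow> (node \<Rightarrow> nat list) \<Rightarrow> bool" where
  "cells g M \<longleftrightarrow> (\<forall>k<3. \<forall>x<m. \<forall>y<m. M (Cell k x y 0) \<noteq> [] \<longleftrightarrow> g k x = y)"

lemma cells_cong: "(\<And>k x y. M' (Cell k x y 0) = M (Cell k x y 0)) \<Longrightarrow> cells g M \<Longrightarrow> cells g M'"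
  unfolding cells_def by simp

text \<open>The copies form a tree of arity \<open>s\<close> in which copy 0 is its own parent, so
  the original bit survives and after \<open>e\<close> rounds the copies below \<open>s ^ e\<close>
  are right, whatever they held before.\<close>

definition bc_src :: "node \<Rightarrow> node set" where
  "bc_src i = {j. \<exists>k x y t. i = Cell k x y t \<and> j = Cell k x y (t div s)}"

definition bc_round :: "node round" where
  "bc_round = pull bc_src
     (\<lambda>i w ib. case i of Cell k x y t \<Rightarrow> ib (Cell k x y (t div s)) | _ \<Rightarrow> w)"

definition bc_inv where
  "bc_inv g e M \<longleftrightarrow>
     (\<forall>k<3. \<forall>x<m. \<forall>y<m. \<forall>t<Q. t < s ^ e \<longrightarrow> (M (Cell k x y t) \<noteq> [] \<longleftrightarrow> g k x = y))"

lemma bc_round: "triple (bc_inv g e) [bc_round] (bc_inv g (Suc e))"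
proof (rule triple_single)
  fix M assume M: "\<forall>i\<in>X. ok (M i)" and inv: "bc_inv g e M"
  have div_less: "t div s < Q" if "t < Q" for t using that div_le_dividend le_less_trans by blast
  show "legal bc_round M" unfolding bc_round_def
  proof (rule legal_pullI[OF M])
    fix i assume "i \<in> X"
    show "\<exists>Y. {j\<in>X. j \<in> bc_src i} \<subseteq> Y \<and> finite Y \<and> card Y \<le> S"
    proof (cases i)
      case (Cell k x y t)
      then show ?thesis using S_pos by (intro exI[of _ "{Cell k x y (t div s)}"]) (auto simp: bc_src_def)
    qed (intro exI[of _ "{}"], simp add: bc_src_def)+
    show "\<exists>Y. {j\<in>X. i \<in> bc_src j} \<subseteq> Y \<and> finite Y \<and> card Y \<le> S"
    proof (cases i)
      case (Cell k x y t)
      have "{j\<in>X. i \<in> bc_src j} \<subseteq> Cell k x y ` {t * s..<t * s + s}"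
      proof
        fix j assume "j \<in> {j\<in>X. i \<in> bc_src j}"
        then obtain t1 where "j = Cell k x y t1" "t1 div s = t" using Cell unfolding bc_src_def by auto
        then show "j \<in> Cell k x y ` {t * s..<t * s + s}" using div_eq_iff[of t1 t] by simp
      qed
      moreover have "card (Cell k x y ` {t * s..<t * s + s}) \<le> S"
        using card_image_le[of "{t * s..<t * s + s}" "Cell k x y"] S by simp
      ultimately show ?thesis by blast
    qed (intro exI[of _ "{}"], simp add: bc_src_def)+
  qed
  have stp: "step bc_round M (Cell k x y t) = take 1 (M (Cell k x y (t div s)))"
    if "k < 3" "x < m" "y < m" "t < Q" for k x y t
    using that div_less unfolding bc_round_def step_pull bc_src_def by simp
  show "bc_inv g (Suc e) (step bc_round M)"
    unfolding bc_inv_def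
  proof (intro allI impI)
    fix k x y t :: nat assume t: "k < 3" "x < m" "y < m" "t < Q" "t < s ^ Suc e"
    then have "t div s < s ^ e" by (simp add: less_mult_imp_div_less mult.commute)
    then show "step bc_round M (Cell k x y t) \<noteq> [] \<longleftrightarrow> g k x = y"
      using inv t div_less[OF t(4)] unfolding bc_inv_def stp[OF t(1-4)] by simp
  qed
next
  fix M i assume M: "\<forall>i\<in>X. ok (M i)" and i: "i \<in> X"
  show "ok (step bc_round M i)"
  proof (cases i)
    case (Cell k x y t)
    then show ?thesis unfolding bc_round_def step_pull using M ok_take by (auto simp: ok_def[of "[]"])
  qed (use M i in \<open>auto simp: bc_round_def step_pull\<close>)
qed

lemma broadcast: "triple (cells g) (replicate h bc_round) (bc_inv g h)"
proof -
  have "triple (bc_inv g 0) (concat (map (\<lambda>_. [bc_round]) [0..<h])) (bc_inv g h)"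
    by (rule triple_iter) (rule bc_round)
  also have "concat (map (\<lambda>_. [bc_round]) [0..<h]) = replicate h bc_round"
    by (induction h) (auto simp: replicate_append_same)
  finally show ?thesis
    by (rule triple_conseq) (auto simp: cells_def bc_inv_def)
qed

end

lemma ex_bound_one:
  assumes "\<And>x y. x \<in> Z \<Longrightarrow> y \<in> Z \<Longrightarrow> x = y" "1 \<le> (k :: nat)"
  shows "\<exists>Y. Z \<subseteq> Y \<and> finite Y \<and> card Y \<le> k"
proof (cases "Z = {}")
  case True
  then show ?thesis by (intro exI[of _ "{}"]) simp
next
  case False
  then obtain z where "z \<in> Z" by blast
  then have "Z \<subseteq> {z}" using assms(1) by blast
  then show ?thesis using assms(2) by (intro exI[of _ "{z}"]) simp
qed

lemma mem_relabel:
  assumes "\<sigma> permutes A"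
  shows "{x, y} \<in> relabel \<sigma> H \<longleftrightarrow> {inv \<sigma> x, inv \<sigma> y} \<in> H"
proof
  assume "{x, y} \<in> relabel \<sigma> H"
  then obtain e where e: "e \<in> H" "{x, y} = \<sigma> ` e" unfolding relabel_def by blast
  have "inv \<sigma> ` (\<sigma> ` e) = e" using permutes_inverses(2)[OF assms] by (simp add: image_image)
  moreover have "inv \<sigma> ` (\<sigma> ` e) = {inv \<sigma> x, inv \<sigma> y}" unfolding e(2)[symmetric] by simp
  ultimately show "{inv \<sigma> x, inv \<sigma> y} \<in> H" using e(1) by simp
next
  assume "{inv \<sigma> x, inv \<sigma> y} \<in> H"
  then have "\<sigma> ` {inv \<sigma> x, inv \<sigma> y} \<in> relabel \<sigma> H" unfolding relabel_def by blast
  then show "{x, y} \<in> relabel \<sigma> H" using permutes_inverses(1)[OF assms] by simp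
qed

lemma word_graph_iff:
  "{u, v} \<in> word_graph m L l f b \<longleftrightarrow>
     answer f (arc_query m L l b u v) \<or> answer f (arc_query m L l b v u)"
  unfolding word_graph_def by (auto simp: doubleton_eq_iff)

lemma arc_query_Ask:
  assumes "arc_query m L l b u v = Ask c p q" "L = 2 * Suc l"
  shows "c < l \<and> p < m \<and> q < m"
proof -
  have "u div L < m" if "u < m * L" for u using that by (simp add: less_mult_imp_div_less)
  then show ?thesis using assms unfolding arc_query_def by (auto split: if_splits)
qed

lemma length_concat_upt: "length (concat (map f [0..<p])) = (\<Sum>j<p. length (f j))"
  by (induction p) auto

lemma sum_consecutive_blocks:
  fixes w :: "nat \<Rightarrow> nat"
  shows "(\<Sum>t\<in>{a..<a + k}. \<Sum>u\<in>{t * K..<Suc t * K}. w u) = (\<Sum>u\<in>{a * K..<(a + k) * K}. w u)"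
proof (induction k)
  case (Suc k)
  have "(\<Sum>u\<in>{a * K..<(a + k) * K}. w u) + (\<Sum>u\<in>{(a + k) * K..<Suc (a + k) * K}. w u)
      = (\<Sum>u\<in>{a * K..<Suc (a + k) * K}. w u)"
    by (rule sum.atLeastLessThan_concat) auto
  then show ?case using Suc by simp
qed simp

definition num :: "nat list \<Rightarrow> nat" where
  "num w = (case w of [] \<Rightarrow> 0 | c # _ \<Rightarrow> c)"

section \<open>Loading the metrics and running the tree algorithm on them\<close>

context simulation
begin

definition instance_graph where
  "instance_graph g \<kappa> b i = relabel (\<sigma> i) (word_graph m L l (\<lambda>c. g (\<kappa> c)) b)"

definition blocks_at where
  "blocks_at g \<kappa> t M \<longleftrightarrow> (\<forall>b<m. \<forall>i<R. \<forall>j<machines A.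
     M (Block b i j) = memory A (metric_state items (instance_graph g \<kappa> b i)) t j)"

definition pair_query where
  "pair_query b i x y = arc_query m L l b (inv (\<sigma> i) x) (inv (\<sigma> i) y)"

text \<open>Arc queries are directed while items are unordered pairs, so each item is looked up in
  both orientations.\<close>

definition load_src :: "(nat \<Rightarrow> nat) \<Rightarrow> node \<Rightarrow> node set" where
  "load_src \<kappa> nd = {nd'. \<exists>b i j x y c p q. nd = Block b i j \<and>
     ((x, y) \<in> set (items j) \<or> (y, x) \<in> set (items j)) \<and>
     pair_query b i x y = Ask c p q \<and> nd' = Cell (\<kappa> c) p q (tc (b, i, j, x, y))}"

definition arc_val where
  "arc_val \<kappa> ib b i j x y = (case pair_query b i x y of Const v \<Rightarrow> v
     | Ask c p q \<Rightarrow> ib (Cell (\<kappa> c) p q (tc (b, i, j, x, y))) \<noteq> [])"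

definition load_round :: "(nat \<Rightarrow> nat) \<Rightarrow> node round" where
  "load_round \<kappa> = pull (load_src \<kappa>) (\<lambda>nd w ib. case nd of
     Block b i j \<Rightarrow> concat (map (\<lambda>(x, y).
       [x, y, if arc_val \<kappa> ib b i j x y \<or> arc_val \<kappa> ib b i j y x then 1 else 2]) (items j))
     | _ \<Rightarrow> w)"

lemma load_src_Block:
  "nd' \<in> load_src \<kappa> (Block b i j) \<longleftrightarrow> (\<exists>x y c p q.
     ((x, y) \<in> set (items j) \<or> (y, x) \<in> set (items j)) \<and>
     pair_query b i x y = Ask c p q \<and> nd' = Cell (\<kappa> c) p q (tc (b, i, j, x, y)))"
  unfolding load_src_def by simp

text \<open>A block with \<open>r\<close> items reads at most \<open>2 * r\<close> cells, and its
  memory has room for \<open>3 * r\<close> words. In the other direction a copy is read by at most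
  one block, because its number determines the block by injectivity of \<open>tc\<close>.\<close>

lemma load_round:
  assumes \<kappa>: "\<And>c. c < l \<Longrightarrow> \<kappa> c < 3"
  shows "triple (bc_inv g h) [load_round \<kappa>] (\<lambda>M. cells g M \<and> blocks_at g \<kappa> 0 M)"
proof (rule triple_single)
  fix M assume M: "\<forall>i\<in>X. ok (M i)" and inv: "bc_inv g h M"
  show "legal (load_round \<kappa>) M" unfolding load_round_def
  proof (rule legal_pullI[OF M])
    fix nd assume nd: "nd \<in> X"
    show "\<exists>Y. {nd'\<in>X. nd' \<in> load_src \<kappa> nd} \<subseteq> Y \<and> finite Y \<and> card Y \<le> S"
    proof (cases "\<exists>b i j. nd = Block b i j")
      case True
      then obtain b i j where b: "nd = Block b i j" by blast
      let ?P = "set (items j) \<union> prod.swap ` set (items j)"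
      let ?f = "\<lambda>(x, y). case pair_query b i x y of
          Ask c p q \<Rightarrow> Cell (\<kappa> c) p q (tc (b, i, j, x, y)) | _ \<Rightarrow> Out"
      have "{nd'\<in>X. nd' \<in> load_src \<kappa> nd} \<subseteq> ?f ` ?P"
      proof
        fix nd' assume "nd' \<in> {nd'\<in>X. nd' \<in> load_src \<kappa> nd}"
        then have "nd' \<in> load_src \<kappa> (Block b i j)" unfolding b by blast
        then obtain x y c p q where *: "(x, y) \<in> set (items j) \<or> (y, x) \<in> set (items j)"
            "pair_query b i x y = Ask c p q" "nd' = Cell (\<kappa> c) p q (tc (b, i, j, x, y))"
          unfolding load_src_Block by blast
        then have "(x, y) \<in> ?P" by (auto intro: image_eqI[of _ _ "(y, x)"])
        moreover have "nd' = ?f (x, y)" using * by simp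
        ultimately show "nd' \<in> ?f ` ?P" by (rule rev_image_eqI)
      qed
      moreover have "card (?f ` ?P) \<le> S"
      proof -
        have "card (?f ` ?P) \<le> card ?P" by (rule card_image_le) simp
        also have "\<dots> \<le> card (set (items j)) + card (prod.swap ` set (items j))" by (rule card_Un_le)
        also have "\<dots> \<le> length (items j) + length (items j)"
          using card_image_le[of "set (items j)" prod.swap] card_length[of "items j"] by simp
        also have "\<dots> \<le> local_space A" using items_length[of j] nd b by simp
        finally show ?thesis using S(1) by simp
      qed
      ultimately show ?thesis by blast
    next
      case False
      then have "load_src \<kappa> nd = {}" unfolding load_src_def by auto
      then show ?thesis by (intro exI[of _ "{}"]) simp
    qed
    show "\<exists>Y. {nd'\<in>X. nd \<in> load_src \<kappa> nd'} \<subseteq> Y \<and> finite Y \<and> card Y \<le> S"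
    proof (rule ex_bound_one[OF _ S_pos])
      have tc: "\<exists>b i j x y. nd' = Block b i j \<and> (b, i, j, x, y) \<in> {..<m} \<times> {..<R} \<times> {..<machines A} \<times> {..<n} \<times> {..<n}
          \<and> (\<exists>k p q. nd = Cell k p q (tc (b, i, j, x, y)))"
        if "nd' \<in> {nd'\<in>X. nd \<in> load_src \<kappa> nd'}" for nd'
      proof -
        have "nd \<in> load_src \<kappa> nd'" and ndX: "nd' \<in> X" using that by auto
        then obtain b i j x y c p q where b: "nd' = Block b i j"
            "(x, y) \<in> set (items j) \<or> (y, x) \<in> set (items j)"
            "nd = Cell (\<kappa> c) p q (tc (b, i, j, x, y))"
          unfolding load_src_def mem_Collect_eq by blast
        note * = b(1) ndX b(2,3)
        have "x < n \<and> y < n" using items[of j x y] items[of j y x] *(1-3) by auto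
        then have "(b, i, j, x, y) \<in> {..<m} \<times> {..<R} \<times> {..<machines A} \<times> {..<n} \<times> {..<n}"
          using *(1,2) by simp
        then show ?thesis using *(1,4) by blast
      qed
      fix n1 n2 assume n1: "n1 \<in> {nd'\<in>X. nd \<in> load_src \<kappa> nd'}" and n2: "n2 \<in> {nd'\<in>X. nd \<in> load_src \<kappa> nd'}"
      obtain b i j x y k p q where 1: "n1 = Block b i j" "nd = Cell k p q (tc (b, i, j, x, y))"
        "(b, i, j, x, y) \<in> {..<m} \<times> {..<R} \<times> {..<machines A} \<times> {..<n} \<times> {..<n}" using tc[OF n1] by (elim exE conjE)
      obtain b' i' j' x' y' k' p' q' where 2: "n2 = Block b' i' j'" "nd = Cell k' p' q' (tc (b', i', j', x', y'))"
        "(b', i', j', x', y') \<in> {..<m} \<times> {..<R} \<times> {..<machines A} \<times> {..<n} \<times> {..<n}" using tc[OF n2] by (elim exE conjE)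
      have "tc (b, i, j, x, y) = tc (b', i', j', x', y')" using 1(2) 2(2) by simp
      then have "(b, i, j, x, y) = (b', i', j', x', y')" using inj_onD[OF tc_inj _ 1(3) 2(3)] by blast
      then show "n1 = n2" using 1(1) 2(1) by simp
    qed
  qed
  have av: "arc_val \<kappa> (\<lambda>nd'. if nd' \<in> X \<and> nd' \<in> load_src \<kappa> (Block b i j) then take 1 (M nd') else []) b i j x y
      \<longleftrightarrow> answer (\<lambda>c. g (\<kappa> c)) (pair_query b i x y)"
    if b: "b < m" "i < R" "j < machines A" and xy: "(x, y) \<in> set (items j) \<or> (y, x) \<in> set (items j)" for b i j x y
  proof (cases "pair_query b i x y")
    case (Const v)
    then show ?thesis unfolding arc_val_def by simp
  next
    case (Ask c p q)
    have c: "c < l" "p < m" "q < m" using arc_query_Ask[OF Ask[unfolded pair_query_def] L_eq] by auto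
    have t: "tc (b, i, j, x, y) < Q" using items[OF b(3), of x y] items[OF b(3), of y x] xy b by (intro tc_less) auto
    have k: "\<kappa> c < 3" using \<kappa>[OF c(1)] .
    have src: "Cell (\<kappa> c) p q (tc (b, i, j, x, y)) \<in> load_src \<kappa> (Block b i j)"
      unfolding load_src_def using xy Ask by blast
    have "M (Cell (\<kappa> c) p q (tc (b, i, j, x, y))) \<noteq> [] \<longleftrightarrow> g (\<kappa> c) p = q"
      using inv k c t Q(1) unfolding bc_inv_def by blast
    then show ?thesis unfolding arc_val_def Ask using src k c t by simp
  qed
  have blk: "step (load_round \<kappa>) M (Block b i j) = metric_state items (instance_graph g \<kappa> b i) j"
    if b: "b < m" "i < R" "j < machines A" for b i j
  proof -
    let ?ib = "\<lambda>nd'. if nd' \<in> X \<and> nd' \<in> load_src \<kappa> (Block b i j) then take 1 (M nd') else []"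
    have eq: "[x, y, if arc_val \<kappa> ?ib b i j x y \<or> arc_val \<kappa> ?ib b i j y x then 1 else 2]
        = [x, y, dist_of (instance_graph g \<kappa> b i) x y]" if xy: "(x, y) \<in> set (items j)" for x y
    proof -
      have "{x, y} \<in> instance_graph g \<kappa> b i \<longleftrightarrow>
          answer (\<lambda>c. g (\<kappa> c)) (pair_query b i x y) \<or> answer (\<lambda>c. g (\<kappa> c)) (pair_query b i y x)"
        unfolding instance_graph_def mem_relabel[OF \<sigma>[OF b(2)]] word_graph_iff pair_query_def ..
      then show ?thesis
        using av[OF b, of x y] av[OF b, of y x] xy items[OF b(3) xy] unfolding dist_of_def by simp
    qed
    have "map (\<lambda>(x, y). [x, y, if arc_val \<kappa> ?ib b i j x y \<or> arc_val \<kappa> ?ib b i j y x then 1 else 2]) (items j)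
        = map (\<lambda>(x, y). [x, y, dist_of (instance_graph g \<kappa> b i) x y]) (items j)"
    proof (intro map_cong refl, goal_cases)
      case (1 z)
      then show ?case using eq[of "fst z" "snd z"] by (simp only: case_prod_beta prod.collapse)
    qed
    then show ?thesis unfolding load_round_def step_pull metric_state_def node.case
      by (rule arg_cong[where f = concat])
  qed
  have "cells g (step (load_round \<kappa>) M)"
    using inv Q_pos Q(1) unfolding cells_def bc_inv_def load_round_def step_pull by simp
  then show "cells g (step (load_round \<kappa>) M) \<and> blocks_at g \<kappa> 0 (step (load_round \<kappa>) M)"
    unfolding blocks_at_def using blk by simp
next
  fix M nd assume M: "\<forall>i\<in>X. ok (M i)" and nd: "nd \<in> X"
  show "ok (step (load_round \<kappa>) M nd)"
  proof (cases nd)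
    case (Block b i j)
    then have j: "j < machines A" using nd by simp
    have "length (concat (map (\<lambda>(x, y). [x, y, F x y]) zs)) = 3 * length zs" for F :: "nat \<Rightarrow> nat \<Rightarrow> nat" and zs
      by (induction zs) auto
    then have "length (step (load_round \<kappa>) M nd) \<le> S"
      using items_length[OF j] S(1) unfolding load_round_def step_pull Block by simp
    moreover have "\<forall>w\<in>set (step (load_round \<kappa>) M nd). w < W"
    proof
      fix w assume "w \<in> set (step (load_round \<kappa>) M nd)"
      then obtain x y where "(x, y) \<in> set (items j)" "w = x \<or> w = y \<or> w = 1 \<or> w = 2"
        unfolding load_round_def step_pull Block by (auto split: if_splits)
      then show "w < W" using items[OF j, of x y] W by auto
    qed
    ultimately show ?thesis unfolding ok_def by blast
  qed (use M nd in \<open>auto simp: load_round_def step_pull\<close>)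
qed

text \<open>Blocks that differ in \<open>b\<close> or \<open>i\<close> never exchange messages, so
  every load is that of a single run of \<open>A\<close>.\<close>

definition sim_round :: "nat \<Rightarrow> node round" where
  "sim_round t =
    (\<lambda>nd w nd'. case nd of
       Block b i j \<Rightarrow> (case nd' of
         Block b' i' j' \<Rightarrow> if b = b' \<and> i = i' then send A t j w j' else [] | _ \<Rightarrow> [])
       | _ \<Rightarrow> [],
     \<lambda>nd w ib. case nd of
       Block b i j \<Rightarrow> receive A t j w (\<lambda>j'. if j' < machines A then ib (Block b i j') else [])
       | _ \<Rightarrow> w)"

lemma sim_send: "fst (sim_round t) (Block b i j) w (Block b i j') = send A t j w j'"
  unfolding sim_round_def by simp

lemma sim_receive:
  "snd (sim_round t) (Block b i j) w ib =
     receive A t j w (\<lambda>j'. if j' < machines A then ib (Block b i j') else [])"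
  unfolding sim_round_def by simp

lemma sim_send_eq_Nil:
  "(\<And>b i j j'. nd = Block b i j \<Longrightarrow> nd' = Block b i j' \<Longrightarrow> False) \<Longrightarrow>
     fst (sim_round t) nd w nd' = []"
  by (cases nd; cases nd') (auto simp: sim_round_def)

lemma sum_blocks:
  fixes F :: "node \<Rightarrow> nat"
  assumes "b < m" "i < R" "\<And>nd. nd \<in> X \<Longrightarrow> nd \<notin> Block b i ` {..<machines A} \<Longrightarrow> F nd = 0"
  shows "sum F X = (\<Sum>j<machines A. F (Block b i j))"
proof -
  have "sum F X = sum F (Block b i ` {..<machines A})"
    using assms finite_X by (intro sum.mono_neutral_right) auto
  also have "\<dots> = (\<Sum>j<machines A. F (Block b i j))"
    by (subst sum.reindex) (auto simp: inj_on_def)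
  finally show ?thesis .
qed

lemma word_graph_complete: "word_graph m L l f b \<subseteq> complete_edges n"
proof
  fix e assume "e \<in> word_graph m L l f b"
  then obtain u v where e: "e = {u, v}" and a: "answer f (arc_query m L l b u v)"
    unfolding word_graph_def by blast
  have uv: "u < m * L" "v < m * L" "v mod L = Suc (u mod L) mod L" using answer_arc_query_less[OF a] by auto
  have "v mod L \<noteq> u mod L" unfolding uv(3) using L by (intro Suc_mod_neq) auto
  then have "u \<noteq> v" by auto
  moreover have "u < n" "v < n" using uv(1,2) mL by linarith+
  ultimately show "e \<in> complete_edges n" unfolding complete_edges_def e by blast
qed

lemma obeys_instance: "i < R \<Longrightarrow> obeys_limits A (metric_state items (instance_graph g \<kappa> b i))"
  unfolding instance_graph_def
  by (intro obeys relabel_complete_edges \<sigma> word_graph_complete)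

lemma sim_round:
  assumes t: "t < rounds A"
  shows "triple (\<lambda>M. cells g M \<and> blocks_at g \<kappa> t M) [sim_round t]
    (\<lambda>M. cells g M \<and> blocks_at g \<kappa> (Suc t) M)"
proof (rule triple_single)
  fix M assume M: "\<forall>i\<in>X. ok (M i)" and "cells g M \<and> blocks_at g \<kappa> t M"
  then have cells: "cells g M" and at: "blocks_at g \<kappa> t M" by auto
  let ?m = "\<lambda>b i. metric_state items (instance_graph g \<kappa> b i)"
  have blk: "M (Block b i j) = memory A (?m b i) t j" if "b < m" "i < R" "j < machines A" for b i j
    using at that unfolding blocks_at_def by blast
  have lim: "fits A (concat (map (\<lambda>j'. send A t j (memory A (?m b i) t j) j') [0..<machines A]))"
    "fits A (concat (map (\<lambda>j'. send A t j' (memory A (?m b i) t j') j) [0..<machines A]))"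
    if "i < R" "j < machines A" for b i j
    using obeys_instance[OF that(1), of g \<kappa> b] that(2) t unfolding obeys_limits_def by blast+
  show "legal (sim_round t) M" unfolding legal_def
  proof (intro ballI conjI)
    fix nd assume nd: "nd \<in> X"
    show "(\<Sum>nd'\<in>X. length (fst (sim_round t) nd (M nd) nd')) \<le> S"
    proof (cases "\<exists>b i j. nd = Block b i j")
      case True
      then obtain b i j where Block: "nd = Block b i j" by blast
      then have b: "b < m" "i < R" "j < machines A" using nd by auto
      have "(\<Sum>nd'\<in>X. length (fst (sim_round t) nd (M nd) nd')) =
          (\<Sum>j'<machines A. length (fst (sim_round t) nd (M nd) (Block b i j')))"
        using b by (intro sum_blocks) (auto simp: Block intro!: sim_send_eq_Nil)
      also have "\<dots> = length (concat (map (\<lambda>j'. send A t j (memory A (?m b i) t j) j') [0..<machines A]))"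
        unfolding length_concat_upt using blk[OF b] by (simp add: sim_send Block)
      also have "\<dots> \<le> S" using lim(1)[OF b(2,3), of b] S(1) unfolding fits_def by (meson order_trans)
      finally show ?thesis .
    next
      case False
      then have "fst (sim_round t) nd w nd' = []" for w nd' by (intro sim_send_eq_Nil) blast
      then show ?thesis by simp
    qed
    show "(\<Sum>nd'\<in>X. length (fst (sim_round t) nd' (M nd') nd)) \<le> S"
    proof (cases "\<exists>b i j. nd = Block b i j")
      case True
      then obtain b i j where Block: "nd = Block b i j" by blast
      then have b: "b < m" "i < R" "j < machines A" using nd by auto
      have "(\<Sum>nd'\<in>X. length (fst (sim_round t) nd' (M nd') nd)) =
          (\<Sum>j'<machines A. length (fst (sim_round t) (Block b i j') (M (Block b i j')) nd))"
        using b by (intro sum_blocks) (auto simp: Block intro!: sim_send_eq_Nil)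
      also have "\<dots> = length (concat (map (\<lambda>j'. send A t j' (memory A (?m b i) t j') j) [0..<machines A]))"
        unfolding length_concat_upt using blk b by (simp add: sim_send Block)
      also have "\<dots> \<le> S" using lim(2)[OF b(2,3), of b] S(1) unfolding fits_def by (meson order_trans)
      finally show ?thesis .
    next
      case False
      then have "fst (sim_round t) nd' w nd = []" for w nd' by (intro sim_send_eq_Nil) blast
      then show ?thesis by simp
    qed
    fix nd' w assume nd': "nd' \<in> X" and w: "w \<in> set (fst (sim_round t) nd (M nd) nd')"
    then have "fst (sim_round t) nd (M nd) nd' \<noteq> []" by auto
    then obtain b i j j' where nds: "nd = Block b i j" "nd' = Block b i j'"
      using sim_send_eq_Nil by blast
    then have b: "nd = Block b i j" "nd' = Block b i j'" "w \<in> set (send A t j (M nd) j')"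
      using w sim_send by auto
    then have b': "b < m" "i < R" "j < machines A" "j' < machines A" using nd nd' by auto
    then have "w \<in> set (concat (map (\<lambda>j'. send A t j (memory A (?m b i) t j) j') [0..<machines A]))"
      using b blk by auto
    then have "w < word_bound A" using lim(1)[OF b'(2,3), of b] unfolding fits_def by blast
    then show "w < W" using W(1) by simp
  qed
  have stp: "step (sim_round t) M (Block b i j) = memory A (?m b i) (Suc t) j"
    if b: "b < m" "i < R" "j < machines A" for b i j
  proof -
    have "(\<lambda>j'. if j' < machines A then if Block b i j' \<in> X
          then fst (sim_round t) (Block b i j') (M (Block b i j')) (Block b i j) else [] else [])
        = (\<lambda>j'. if j' < machines A then send A t j' (memory A (?m b i) t j') j else [])"
      using blk b by (auto simp: sim_send)
    then show ?thesis unfolding step_def sim_receive blk[OF b] memory.simps by (rule arg_cong)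
  qed
  have "cells g (step (sim_round t) M)"
    using cells by (rule cells_cong[rotated]) (simp add: step_def sim_round_def)
  then show "cells g (step (sim_round t) M) \<and> blocks_at g \<kappa> (Suc t) (step (sim_round t) M)"
    unfolding blocks_at_def using stp by blast
  fix nd assume nd: "nd \<in> X"
  show "ok (step (sim_round t) M nd)"
  proof (cases nd)
    case (Block b i j)
    then have b: "b < m" "i < R" "j < machines A" using nd by auto
    have "fits A (memory A (?m b i) (Suc t) j)"
      using obeys_instance[OF b(2), of g \<kappa> b] b(3) Suc_leI[OF t] unfolding obeys_limits_def by blast
    then show ?thesis unfolding Block stp[OF b] fits_def ok_def using S(1) W(1) by (meson order_trans order_less_le_trans)
  qed (use M nd in \<open>auto simp: sim_round_def step_def\<close>)
qed

lemma simulate: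
  "triple (\<lambda>M. cells g M \<and> blocks_at g \<kappa> 0 M) (map sim_round [0..<rounds A])
    (\<lambda>M. cells g M \<and> blocks_at g \<kappa> (rounds A) M)"
proof -
  have "triple (\<lambda>M. cells g M \<and> blocks_at g \<kappa> 0 M) (concat (map (\<lambda>t. [sim_round t]) [0..<rounds A]))
    (\<lambda>M. cells g M \<and> blocks_at g \<kappa> (rounds A) M)"
    by (rule triple_iter[where P = "\<lambda>t M. cells g M \<and> blocks_at g \<kappa> t M"]) (rule sim_round)
  also have "concat (map (\<lambda>t. [sim_round t]) [0..<rounds A]) = map sim_round [0..<rounds A]"
    by (simp add: concat_map_singleton)
  finally show ?thesis .
qed

end

section \<open>Counting misses with summation trees\<close>

context simulation
begin

definition closing_edge where
  "closing_edge i a = \<sigma> i ` comp_edge L a (L - 1)"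

text \<open>This round is not a pull: a block cannot address the trees of all \<open>a\<close>, of
  which there may be too many, but only those whose closing edge it holds, and their number is
  bounded by its memory.\<close>

definition reports :: "node \<Rightarrow> nat list \<Rightarrow> node \<Rightarrow> bool" where
  "reports nd w nd' \<longleftrightarrow> (\<exists>b i j a. nd = Block b i j \<and> nd' = Tree 0 b i a j \<and> closing_edge i a \<in> edge_set w)"

definition report_round :: "node round" where
  "report_round = (\<lambda>nd w nd'. if reports nd w nd' then [1] else [],
     \<lambda>nd w ib. case nd of
       Tree q b i a t \<Rightarrow> if q = 0 then [if ib (Block b i t) \<noteq> [] then 1 else 0] else w | _ \<Rightarrow> w)"

text \<open>The tree is evaluated in place: after \<open>e\<close> rounds node \<open>t\<close>
  holds the sum of the \<open>t\<close>-th interval of \<open>s ^ e\<close> leaves. Leaves from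
  \<open>Q\<close> on do not exist and count as 0.\<close>

definition tree_inv where
  "tree_inv q v e M \<longleftrightarrow> (\<forall>b<m. \<forall>i<R. \<forall>a<m. \<forall>t<Q.
     M (Tree q b i a t) = [\<Sum>u\<in>{t * s ^ e..<Suc t * s ^ e}. if u < Q then v b i a u else 0])"

definition in_output where
  "in_output g \<kappa> b i a j = (if j < machines A \<and>
     closing_edge i a \<in> edge_set (memory A (metric_state items (instance_graph g \<kappa> b i)) (rounds A) j)
     then 1 else (0 :: nat))"

lemma inj_closing_edge: "i < R \<Longrightarrow> inj (closing_edge i)"
proof (rule injI)
  fix a a' assume i: "i < R" and eq: "closing_edge i a = closing_edge i a'"
  have "comp_edge L a (L - 1) = comp_edge L a' (L - 1)"
    using eq inj_image_eq_iff[OF permutes_inj[OF \<sigma>[OF i]]] unfolding closing_edge_def by blast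
  moreover have "L - 1 < L" using L by simp
  ultimately show "a = a'" using comp_edge_inj L by blast
qed

lemma report_round:
  "triple (\<lambda>M. cells g M \<and> blocks_at g \<kappa> (rounds A) M) [report_round]
     (\<lambda>M. cells g M \<and> tree_inv 0 (in_output g \<kappa>) 0 M)"
proof (rule triple_single)
  fix M assume M: "\<forall>i\<in>X. ok (M i)" and "cells g M \<and> blocks_at g \<kappa> (rounds A) M"
  then have cells: "cells g M" and at: "blocks_at g \<kappa> (rounds A) M" by auto
  have sum: "(\<Sum>nd\<in>X. length (if B nd then [1::nat] else [])) = card {nd\<in>X. B nd}" for B
    using finite_X by (simp add: if_distrib[of length] sum.If_cases Int_def)
  show "legal report_round M" unfolding legal_def
  proof (intro ballI conjI)
    fix nd assume nd: "nd \<in> X"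
    have "card {nd'\<in>X. reports nd (M nd) nd'} \<le> S"
    proof (cases "\<exists>b i j. nd = Block b i j")
      case True
      then obtain b i j where Block: "nd = Block b i j" by blast
      then have i: "i < R" using nd by simp
      let ?Z = "{a. closing_edge i a \<in> edge_set (M nd)}"
      have inj: "inj_on (closing_edge i) ?Z" using inj_closing_edge[OF i] inj_on_subset by blast
      have sub: "closing_edge i ` ?Z \<subseteq> edge_set (M nd)" by blast
      have fin: "finite ?Z" using inj_on_finite[OF inj sub] by simp
      have "{nd'\<in>X. reports nd (M nd) nd'} \<subseteq> (\<lambda>a. Tree 0 b i a j) ` ?Z"
        unfolding reports_def Block by auto
      then have "card {nd'\<in>X. reports nd (M nd) nd'} \<le> card ((\<lambda>a. Tree 0 b i a j) ` ?Z)"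
        using fin by (intro card_mono) auto
      also have "\<dots> \<le> card ?Z" using fin by (rule card_image_le)
      also have "\<dots> \<le> card (edge_set (M nd))" using card_inj_on_le[OF inj sub] by simp
      also have "\<dots> \<le> S" using card_edge_set[of "M nd"] M nd unfolding ok_def by (meson order_trans)
      finally show ?thesis .
    next
      case False
      then have "{nd'\<in>X. reports nd (M nd) nd'} = {}" unfolding reports_def by blast
      then show ?thesis by (simp only: card.empty)
    qed
    then show "(\<Sum>nd'\<in>X. length (fst report_round nd (M nd) nd')) \<le> S"
      unfolding report_round_def fst_conv sum .
    have "\<exists>Y. {nd'\<in>X. reports nd' (M nd') nd} \<subseteq> Y \<and> finite Y \<and> card Y \<le> S"
      by (rule ex_bound_one[OF _ S_pos]) (auto simp: reports_def)
    then have "card {nd'\<in>X. reports nd' (M nd') nd} \<le> S" using card_mono order_trans by metis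
    then show "(\<Sum>nd'\<in>X. length (fst report_round nd' (M nd') nd)) \<le> S"
      unfolding report_round_def fst_conv sum .
    show "w < W" if "w \<in> set (fst report_round nd (M nd) nd')" for w nd'
      using that W(4) unfolding report_round_def by (auto split: if_splits)
  qed
  have "cells g (step report_round M)"
    using cells by (rule cells_cong[rotated]) (simp add: step_def report_round_def)
  moreover have "step report_round M (Tree 0 b i a t) = [in_output g \<kappa> b i a t]"
    if b: "b < m" "i < R" "a < m" "t < Q" for b i a t
  proof -
    have "reports (Block b i t) w (Tree 0 b i a t) \<longleftrightarrow> closing_edge i a \<in> edge_set w" for w
      unfolding reports_def by simp
    moreover have "M (Block b i t) = memory A (metric_state items (instance_graph g \<kappa> b i)) (rounds A) t"
      if "t < machines A" using at b that unfolding blocks_at_def by blast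
    ultimately show ?thesis using b
      unfolding step_def report_round_def in_output_def by simp
  qed
  then have "tree_inv 0 (in_output g \<kappa>) 0 (step report_round M)" unfolding tree_inv_def by simp
  ultimately show "cells g (step report_round M) \<and> tree_inv 0 (in_output g \<kappa>) 0 (step report_round M)"
    by blast
  fix nd assume nd: "nd \<in> X"
  show "ok (step report_round M nd)"
  proof (cases nd)
    case (Tree q b i a t)
    have "ok [x]" if "x \<le> 1" for x using that S_pos W(4) unfolding ok_def by simp
    then show ?thesis using M nd Tree unfolding step_def report_round_def by simp
  qed (use M nd in \<open>auto simp: step_def report_round_def\<close>)
qed

definition sum_src :: "nat \<Rightarrow> node \<Rightarrow> node set" where
  "sum_src q nd = {nd'. \<exists>b i a t t'. nd = Tree q b i a t \<and> nd' = Tree q b i a t' \<and> t' div s = t}"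

definition sum_round :: "nat \<Rightarrow> node round" where
  "sum_round q = pull (sum_src q) (\<lambda>nd w ib. case nd of
     Tree q' b i a t \<Rightarrow> if q' = q
       then [min Q (\<Sum>t'\<in>{t * s..<t * s + s}. num (ib (Tree q b i a t')))] else w
     | _ \<Rightarrow> w)"

text \<open>The cap \<open>min Q\<close> in the round does not change these sums, which are at most
  \<open>Q\<close> by \<open>v\<close>; it makes the result a legal word for any contents of the
  memories.\<close>

lemma sum_round:
  assumes q: "q < 2" and v: "\<And>b i a u. v b i a u \<le> 1"
  shows "triple (\<lambda>M. cells g M \<and> tree_inv q v e M) [sum_round q]
     (\<lambda>M. cells g M \<and> tree_inv q v (Suc e) M)"
proof (rule triple_single)
  fix M assume M: "\<forall>i\<in>X. ok (M i)" and "cells g M \<and> tree_inv q v e M"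
  then have cells: "cells g M" and inv: "tree_inv q v e M" by auto
  show "legal (sum_round q) M" unfolding sum_round_def
  proof (rule legal_pullI[OF M])
    fix nd assume nd: "nd \<in> X"
    show "\<exists>Y. {nd'\<in>X. nd' \<in> sum_src q nd} \<subseteq> Y \<and> finite Y \<and> card Y \<le> S"
    proof (cases "\<exists>b i a t. nd = Tree q b i a t")
      case True
      then obtain b i a t where t: "nd = Tree q b i a t" by blast
      have "{nd'\<in>X. nd' \<in> sum_src q nd} \<subseteq> Tree q b i a ` {t * s..<t * s + s}"
        unfolding sum_src_def t using div_eq_iff by auto
      moreover have "card (Tree q b i a ` {t * s..<t * s + s}) \<le> S"
        using card_image_le[of "{t * s..<t * s + s}" "Tree q b i a"] S by simp
      ultimately show ?thesis by blast
    next
      case False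
      then have "{nd'\<in>X. nd' \<in> sum_src q nd} \<subseteq> {}" unfolding sum_src_def by blast
      then show ?thesis by (intro exI[of _ "{}"]) simp
    qed
    show "\<exists>Y. {nd'\<in>X. nd \<in> sum_src q nd'} \<subseteq> Y \<and> finite Y \<and> card Y \<le> S"
      by (rule ex_bound_one[OF _ S_pos]) (auto simp: sum_src_def)
  qed
  have "cells g (step (sum_round q) M)"
    using cells by (rule cells_cong[rotated]) (simp add: step_pull sum_round_def)
  moreover have "step (sum_round q) M (Tree q b i a t)
      = [\<Sum>u\<in>{t * s ^ Suc e..<Suc t * s ^ Suc e}. if u < Q then v b i a u else 0]"
    if b: "b < m" "i < R" "a < m" "t < Q" for b i a t
  proof -
    let ?w = "\<lambda>u. if u < Q then v b i a u else 0"
    let ?ib = "\<lambda>nd'. if nd' \<in> X \<and> nd' \<in> sum_src q (Tree q b i a t) then take 1 (M nd') else []"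
    have nm: "num (?ib (Tree q b i a t')) = (\<Sum>u\<in>{t' * s ^ e..<Suc t' * s ^ e}. ?w u)"
      if t': "t' \<in> {t * s..<t * s + s}" for t'
    proof (cases "t' < Q")
      case True
      have "t' div s = t" using t' div_eq_iff by simp
      then have "Tree q b i a t' \<in> sum_src q (Tree q b i a t)" unfolding sum_src_def by simp
      moreover have "Tree q b i a t' \<in> X" using True b q by simp
      ultimately have "?ib (Tree q b i a t') = take 1 (M (Tree q b i a t'))" by simp
      also have "\<dots> = [\<Sum>u\<in>{t' * s ^ e..<Suc t' * s ^ e}. ?w u]"
        using inv b True unfolding tree_inv_def by simp
      finally show ?thesis unfolding num_def by simp
    next
      case False
      \<comment> \<open>A child \<open>t'\<close> that does not exist stands for leaves from
        \<open>t' * s ^ e\<close> on, and these are not below \<open>Q\<close> either.\<close>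
      have "?w u = 0" if "u \<in> {t' * s ^ e..<Suc t' * s ^ e}" for u
      proof -
        have "t' = t' * 1" by simp
        also have "\<dots> \<le> t' * s ^ e" using s by (intro mult_le_mono2) simp
        also have "\<dots> \<le> u" using that by simp
        finally show ?thesis using False by simp
      qed
      then have "(\<Sum>u\<in>{t' * s ^ e..<Suc t' * s ^ e}. ?w u) = 0" by (rule sum.neutral[OF ballI])
      then show ?thesis using False unfolding num_def by simp
    qed
    have "(\<Sum>t'\<in>{t * s..<t * s + s}. num (?ib (Tree q b i a t')))
        = (\<Sum>t'\<in>{t * s..<t * s + s}. \<Sum>u\<in>{t' * s ^ e..<Suc t' * s ^ e}. ?w u)"
      by (rule sum.cong[OF refl nm])
    also have "\<dots> = (\<Sum>u\<in>{t * s * s ^ e..<(t * s + s) * s ^ e}. ?w u)" by (rule sum_consecutive_blocks)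
    also have "\<dots> = (\<Sum>u\<in>{t * s ^ Suc e..<Suc t * s ^ Suc e}. ?w u)"
      by (simp add: algebra_simps)
    finally have 1: "(\<Sum>t'\<in>{t * s..<t * s + s}. num (?ib (Tree q b i a t')))
        = (\<Sum>u\<in>{t * s ^ Suc e..<Suc t * s ^ Suc e}. ?w u)" .
    have "(\<Sum>u\<in>{t * s ^ Suc e..<Suc t * s ^ Suc e}. ?w u)
        = (\<Sum>u\<in>{t * s ^ Suc e..<Suc t * s ^ Suc e} \<inter> {u. u < Q}. v b i a u)"
      by (simp add: sum.If_cases)
    also have "\<dots> \<le> (\<Sum>u\<in>{t * s ^ Suc e..<Suc t * s ^ Suc e} \<inter> {u. u < Q}. 1)"
      using v by (intro sum_mono)
    also have "\<dots> \<le> card {..<Q}" by (simp only: sum_constant mult_1_right of_nat_id, intro card_mono) auto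
    finally have "(\<Sum>u\<in>{t * s ^ Suc e..<Suc t * s ^ Suc e}. ?w u) \<le> Q" by simp
    then have "min Q (\<Sum>t'\<in>{t * s..<t * s + s}. num (?ib (Tree q b i a t')))
        = (\<Sum>u\<in>{t * s ^ Suc e..<Suc t * s ^ Suc e}. ?w u)" unfolding 1 by (rule min_absorb2)
    then show ?thesis unfolding sum_round_def step_pull by (simp only: node.case if_True simp_thms)
  qed
  then have "tree_inv q v (Suc e) (step (sum_round q) M)" unfolding tree_inv_def by blast
  ultimately show "cells g (step (sum_round q) M) \<and> tree_inv q v (Suc e) (step (sum_round q) M)" by blast
  fix nd assume nd: "nd \<in> X"
  show "ok (step (sum_round q) M nd)"
  proof (cases nd)
    case (Tree q' b i a t)
    have "ok [min Q x]" for x using S_pos W(3) unfolding ok_def by simp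
    then show ?thesis using M nd Tree unfolding step_pull sum_round_def by simp
  qed (use M nd in \<open>auto simp: step_pull sum_round_def\<close>)
qed

definition tree_total where
  "tree_total q v M \<longleftrightarrow> (\<forall>b<m. \<forall>i<R. \<forall>a<m. M (Tree q b i a 0) = [sum (v b i a) {..<Q}])"

lemma sum_tree:
  assumes q: "q < 2" and v: "\<And>b i a u. v b i a u \<le> 1"
  shows "triple (\<lambda>M. cells g M \<and> tree_inv q v 0 M) (replicate h (sum_round q))
     (\<lambda>M. cells g M \<and> tree_total q v M)"
proof -
  have "triple (\<lambda>M. cells g M \<and> tree_inv q v 0 M) (concat (map (\<lambda>_. [sum_round q]) [0..<h]))
     (\<lambda>M. cells g M \<and> tree_inv q v h M)"
    by (rule triple_iter[where P = "\<lambda>e M. cells g M \<and> tree_inv q v e M"]) (rule sum_round[OF q v])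
  also have "concat (map (\<lambda>_. [sum_round q]) [0..<h]) = replicate h (sum_round q)"
    by (induction h) (auto simp: replicate_append_same)
  finally show ?thesis
  proof (rule triple_conseq)
    fix M assume M: "cells g M \<and> tree_inv q v h M"
    have set: "{0 * s ^ h..<Suc 0 * s ^ h} = {..<Q}" using Q(1) by auto
    have "M (Tree q b i a 0) = [sum (v b i a) {..<Q}]" if "b < m" "i < R" "a < m" for b i a
    proof -
      have "M (Tree q b i a 0) = [\<Sum>u\<in>{0 * s ^ h..<Suc 0 * s ^ h}. if u < Q then v b i a u else 0]"
        using M Q_pos that unfolding tree_inv_def by blast
      also have "(\<Sum>u\<in>{0 * s ^ h..<Suc 0 * s ^ h}. if u < Q then v b i a u else 0) = sum (v b i a) {..<Q}"
        unfolding set by (rule sum.cong) auto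
      finally show ?thesis .
    qed
    then show "cells g M \<and> tree_total q v M" using M unfolding tree_total_def by blast
  qed
qed

text \<open>Leaf \<open>t\<close> of the second tree takes the result of the first tree for
  relabelling \<open>t\<close>; as the second tree sums over the relabellings, its own index
  \<open>i\<close> is fixed at 0.\<close>

definition move_src :: "node \<Rightarrow> node set" where
  "move_src nd = {nd'. \<exists>b a t. nd = Tree 1 b 0 a t \<and> nd' = Tree 0 b t a 0}"

definition move_round :: "node round" where
  "move_round = pull move_src (\<lambda>nd w ib. case nd of
     Tree q b i a t \<Rightarrow> if q = 1 then [if i = 0 \<and> ib (Tree 0 b t a 0) = [0] then 1 else 0] else w
     | _ \<Rightarrow> w)"

definition no_total where
  "no_total v b i a t = (if i = 0 \<and> t < R \<and> (\<Sum>u<Q. v b t a u) = (0 :: nat) then 1 else (0 :: nat))"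

lemma move_round:
  "triple (\<lambda>M. cells g M \<and> tree_total 0 v M) [move_round]
     (\<lambda>M. cells g M \<and> tree_inv 1 (no_total v) 0 M)"
proof (rule triple_single)
  fix M assume M: "\<forall>i\<in>X. ok (M i)" and "cells g M \<and> tree_total 0 v M"
  then have cells: "cells g M" and total: "tree_total 0 v M" by auto
  show "legal move_round M" unfolding move_round_def
  proof (rule legal_pullI[OF M])
    fix nd assume nd: "nd \<in> X"
    show "\<exists>Y. {nd'\<in>X. nd' \<in> move_src nd} \<subseteq> Y \<and> finite Y \<and> card Y \<le> S"
      by (rule ex_bound_one[OF _ S_pos]) (auto simp: move_src_def)
    show "\<exists>Y. {nd'\<in>X. nd \<in> move_src nd'} \<subseteq> Y \<and> finite Y \<and> card Y \<le> S"
      by (rule ex_bound_one[OF _ S_pos]) (auto simp: move_src_def)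
  qed
  have "cells g (step move_round M)"
    using cells by (rule cells_cong[rotated]) (simp add: step_pull move_round_def)
  moreover have "step move_round M (Tree 1 b i a t) = [no_total v b i a t]"
    if b: "b < m" "i < R" "a < m" "t < Q" for b i a t
  proof (cases "i = 0 \<and> t < R")
    case True
    then have "M (Tree 0 b t a 0) = [sum (v b t a) {..<Q}]" using total b unfolding tree_total_def by simp
    then show ?thesis using True b Q_pos
      unfolding step_pull move_round_def no_total_def move_src_def by simp
  next
    case False
    then show ?thesis unfolding step_pull move_round_def no_total_def by auto
  qed
  then have "tree_inv 1 (no_total v) 0 (step move_round M)" unfolding tree_inv_def by simp
  ultimately show "cells g (step move_round M) \<and> tree_inv 1 (no_total v) 0 (step move_round M)" by blast
  fix nd assume nd: "nd \<in> X"
  show "ok (step move_round M nd)"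
  proof (cases nd)
    case (Tree q b i a t)
    have "ok [x]" if "x \<le> 1" for x using that S_pos W(4) unfolding ok_def by simp
    then show ?thesis using M nd Tree unfolding step_pull move_round_def by simp
  qed (use M nd in \<open>auto simp: step_pull move_round_def\<close>)
qed

definition write_src :: "node \<Rightarrow> node set" where
  "write_src nd = {nd'. \<exists>a b. nd = Cell 1 a b 0 \<and> nd' = Tree 1 b 0 a 0}"

definition write_round :: "nat \<Rightarrow> node round" where
  "write_round \<theta> = pull write_src (\<lambda>nd w ib. case nd of
     Cell k a b t \<Rightarrow> if k = 1 \<and> t = 0
       then (if \<theta> \<le> num (ib (Tree 1 b 0 a 0)) then [1] else []) else w
     | _ \<Rightarrow> w)"

lemma write_round:
  assumes R: "0 < R" and g': "\<And>a b. a < m \<Longrightarrow> b < m \<Longrightarrow> \<theta> \<le> (\<Sum>u<Q. v b 0 a u) \<longleftrightarrow> g' a = b"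
  shows "triple (\<lambda>M. cells g M \<and> tree_total 1 v M) [write_round \<theta>] (cells (g(1 := g')))"
proof (rule triple_single)
  fix M assume M: "\<forall>i\<in>X. ok (M i)" and "cells g M \<and> tree_total 1 v M"
  then have cells: "cells g M" and total: "tree_total 1 v M" by auto
  show "legal (write_round \<theta>) M" unfolding write_round_def
  proof (rule legal_pullI[OF M])
    fix nd assume nd: "nd \<in> X"
    show "\<exists>Y. {nd'\<in>X. nd' \<in> write_src nd} \<subseteq> Y \<and> finite Y \<and> card Y \<le> S"
      by (rule ex_bound_one[OF _ S_pos]) (auto simp: write_src_def)
    show "\<exists>Y. {nd'\<in>X. nd \<in> write_src nd'} \<subseteq> Y \<and> finite Y \<and> card Y \<le> S"
      by (rule ex_bound_one[OF _ S_pos]) (auto simp: write_src_def)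
  qed
  have "step (write_round \<theta>) M (Cell k a b 0) \<noteq> [] \<longleftrightarrow> (g(1 := g')) k a = b"
    if k: "k < 3" "a < m" "b < m" for k a b
  proof (cases "k = 1")
    case True
    have "M (Tree 1 b 0 a 0) = [sum (v b 0 a) {..<Q}]" using total k R unfolding tree_total_def by simp
    then have "step (write_round \<theta>) M (Cell k a b 0) = (if \<theta> \<le> (\<Sum>u<Q. v b 0 a u) then [1] else [])"
      using True k R Q_pos unfolding step_pull write_round_def write_src_def num_def by simp
    then show ?thesis using g'[OF k(2,3)] True by simp
  next
    case False
    then show ?thesis using cells k unfolding step_pull write_round_def cells_def by simp
  qed
  then show "cells (g(1 := g')) (step (write_round \<theta>) M)" unfolding cells_def by blast
  fix nd assume nd: "nd \<in> X"
  show "ok (step (write_round \<theta>) M nd)"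
  proof (cases nd)
    case (Cell k a b t)
    have "ok [1]" "ok []" using S_pos W(4) unfolding ok_def by simp_all
    then show ?thesis using M nd Cell unfolding step_pull write_round_def by simp
  qed (use M nd in \<open>auto simp: step_pull write_round_def\<close>)
qed

definition stage :: "(nat \<Rightarrow> nat) \<Rightarrow> nat \<Rightarrow> node round list" where
  "stage \<kappa> \<theta> = replicate h bc_round @ [load_round \<kappa>] @ map sim_round [0..<rounds A] @ [report_round]
     @ replicate h (sum_round 0) @ [move_round] @ replicate h (sum_round 1) @ [write_round \<theta>]"

lemma length_stage: "length (stage \<kappa> \<theta>) = rounds A + 3 * h + 4"
  unfolding stage_def by simp

lemma stage:
  assumes R: "0 < R" and \<kappa>: "\<And>c. c < l \<Longrightarrow> \<kappa> c < 3"
    and g': "\<And>a b. a < m \<Longrightarrow> b < m \<Longrightarrow>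
      \<theta> \<le> card {i. i < R \<and> \<sigma> i ` comp_edge L a (L - 1) \<notin>
        output_tree A items (relabel (\<sigma> i) (word_graph m L l (\<lambda>c. g (\<kappa> c)) b))} \<longleftrightarrow> g' a = b"
  shows "triple (cells g) (stage \<kappa> \<theta>) (cells (g(1 := g')))"
proof -
  let ?v = "in_output g \<kappa>"
  \<comment> \<open>The same edge may be output by several machines. Hence the first sum, over the
    machines, is only tested for zero, and the second sum counts the relabellings for which it is
    zero.\<close>
  have tot: "(\<Sum>u<Q. ?v b i a u) = 0 \<longleftrightarrow> closing_edge i a \<notin> output_tree A items (instance_graph g \<kappa> b i)" for b i a
    using Q(3) unfolding in_output_def output_tree_def by (auto dest: order_less_le_trans)
  have cnt: "(\<Sum>u<Q. no_total ?v b 0 a u) = card {i. i < R \<and> closing_edge i a \<notin> output_tree A items (instance_graph g \<kappa> b i)}"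
    for a b
  proof -
    have "(\<Sum>u<Q. no_total ?v b 0 a u) = (\<Sum>u<Q. if u < R \<and> (\<Sum>u'<Q. ?v b u a u') = 0 then 1 else 0)"
      unfolding no_total_def by simp
    also have "\<dots> = card {u. u < Q \<and> u < R \<and> (\<Sum>u'<Q. ?v b u a u') = 0}"
      by (simp add: sum.If_cases Int_def)
    also have "{u. u < Q \<and> u < R \<and> (\<Sum>u'<Q. ?v b u a u') = 0} =
        {i. i < R \<and> closing_edge i a \<notin> output_tree A items (instance_graph g \<kappa> b i)}"
      unfolding tot using Q(2) by auto
    finally show ?thesis .
  qed
  have v1: "?v b i a u \<le> 1" for b i a u unfolding in_output_def by simp
  have v2: "no_total ?v b i a u \<le> 1" for b i a u unfolding no_total_def by simp
  have w: "triple (\<lambda>M. cells g M \<and> tree_total 1 (no_total ?v) M) [write_round \<theta>] (cells (g(1 := g')))"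
    using g' unfolding closing_edge_def[symmetric] instance_graph_def[symmetric]
    by (intro write_round[OF R]) (simp only: cnt)
  show ?thesis unfolding stage_def
    by (rule triple_append[OF broadcast triple_append[OF load_round[OF \<kappa>] triple_append[OF simulate
      triple_append[OF report_round triple_append[OF sum_tree[OF _ v1] triple_append[OF move_round
      triple_append[OF sum_tree[OF _ v2] w]]]]]]]) auto
qed

end

section \<open>Darts of a two-regular graph\<close>

definition nbrs :: "nat set set \<Rightarrow> nat \<Rightarrow> nat list" where
  "nbrs E u = sorted_list_of_set {v. {u, v} \<in> E}"

text \<open>
  The dart \<open>2 * u + t\<close> leaves the vertex \<open>u\<close> towards its \<open>t\<close>-th neighbour.  The next dart leaves
  that neighbour in the direction other than back to \<open>u\<close>.
\<close>

definition dart_perm :: "nat \<Rightarrow> nat set set \<Rightarrow> nat \<Rightarrow> nat" where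
  "dart_perm N E x = (if x < 4 * N
     then (let v = nbrs E (x div 2) ! (x mod 2) in if nbrs E v ! 0 = x div 2 then 2 * v + 1 else 2 * v)
     else x)"

locale two_regular =
  fixes N :: nat and E :: "nat set set"
  assumes card_nbrs: "u < 2 * N \<Longrightarrow> card {v. {u, v} \<in> E} = 2"
    and E_less: "{u, v} \<in> E \<Longrightarrow> u < 2 * N \<and> u \<noteq> v"
begin

abbreviation nb where "nb u t \<equiv> nbrs E u ! t"

lemma nbrs_props:
  assumes "u < 2 * N"
  shows "length (nbrs E u) = 2" "set (nbrs E u) = {v. {u, v} \<in> E}" "nb u 0 \<noteq> nb u 1"
    "{v. {u, v} \<in> E} = {nb u 0, nb u 1}"
proof -
  have fin: "finite {v. {u, v} \<in> E}" using card_nbrs[OF assms] by (intro card_ge_0_finite) simp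
  show len: "length (nbrs E u) = 2" unfolding nbrs_def using card_nbrs[OF assms] fin by simp
  show set: "set (nbrs E u) = {v. {u, v} \<in> E}" unfolding nbrs_def using fin by simp
  have "distinct (nbrs E u)" unfolding nbrs_def by simp
  then show "nb u 0 \<noteq> nb u 1" using len by (simp add: nth_eq_iff_index_eq)
  obtain p q where "nbrs E u = [p, q]" using len by (metis length_0_conv length_Suc_conv numeral_2_eq_2)
  then show "{v. {u, v} \<in> E} = {nb u 0, nb u 1}" using set by simp
qed

lemma nb_edge: "u < 2 * N \<Longrightarrow> t < 2 \<Longrightarrow> {u, nb u t} \<in> E"
  using nbrs_props(4)[of u] by (auto simp: less_2_cases_iff)

lemma nb_less: "u < 2 * N \<Longrightarrow> t < 2 \<Longrightarrow> nb u t < 2 * N \<and> nb u t \<noteq> u"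
  using nb_edge[of u t] E_less[of "nb u t" u] by (simp add: insert_commute)

text \<open>The first half is known to the vertex that \<open>x\<close> leaves and the second half
  to the one that \<open>y\<close> leaves: \<open>1 - y mod 2\<close> is the direction that
  \<open>y\<close> does not take, and it has to lead back. A cell of the permutation is thus settled
  by two messages.\<close>

lemma dart_perm_iff:
  assumes "x < 4 * N" "y < 4 * N"
  shows "dart_perm N E x = y \<longleftrightarrow>
     nb (x div 2) (x mod 2) = y div 2 \<and> nb (y div 2) (1 - y mod 2) = x div 2"
proof -
  define u v where "u = x div 2" and "v = nb u (x mod 2)"
  have u: "u < 2 * N" unfolding u_def using assms(1) by simp
  have v: "v < 2 * N" unfolding v_def using nb_less[OF u, of "x mod 2"] by simp
  have "{v, u} \<in> E" using nb_edge[OF u, of "x mod 2"] unfolding v_def by (simp add: insert_commute)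
  then have "u \<in> {nb v 0, nb v 1}" unfolding nbrs_props(4)[OF v, symmetric] by simp
  then have vu: "nb v 0 = u \<or> nb v 1 = u" by blast
  have ne: "nb v 0 \<noteq> nb v 1" using nbrs_props(3)[OF v] .
  have dp: "dart_perm N E x = (if nb v 0 = u then 2 * v + 1 else 2 * v)"
    unfolding dart_perm_def Let_def u_def v_def using assms(1) by simp
  have y: "y = 2 * (y div 2) + y mod 2" by simp
  have ym: "y mod 2 = 0 \<or> y mod 2 = 1" by auto
  show ?thesis
  proof
    assume "dart_perm N E x = y"
    then have "y = (if nb v 0 = u then 2 * v + 1 else 2 * v)" using dp by simp
    then have "y div 2 = v" "y mod 2 = (if nb v 0 = u then 1 else 0)" by auto
    then show "nb (x div 2) (x mod 2) = y div 2 \<and> nb (y div 2) (1 - y mod 2) = x div 2"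
      using vu unfolding u_def[symmetric] v_def[symmetric] by auto
  next
    assume "nb (x div 2) (x mod 2) = y div 2 \<and> nb (y div 2) (1 - y mod 2) = x div 2"
    then have yv: "y div 2 = v" and "nb v (1 - y mod 2) = u"
      unfolding u_def[symmetric] v_def[symmetric] by auto
    then have "y mod 2 = (if nb v 0 = u then 1 else 0)" using ym ne by auto
    then show "dart_perm N E x = y" unfolding dp using yv y by auto
  qed
qed

lemma dart_perm_less:
  assumes "x < 4 * N"
  shows "dart_perm N E x < 4 * N"
proof -
  have "nb (x div 2) (x mod 2) < 2 * N" using nb_less[of "x div 2" "x mod 2"] assms by simp
  then show ?thesis using assms unfolding dart_perm_def Let_def by simp
qed

lemma dart_perm_step:
  assumes "x < 4 * N"
  shows "dart_perm N E x div 2 = nb (x div 2) (x mod 2)"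
    "nb (dart_perm N E x div 2) (1 - dart_perm N E x mod 2) = x div 2"
  using dart_perm_iff[OF assms dart_perm_less[OF assms]] by auto

lemma dart_eqI:
  assumes "x < 4 * N" "x div 2 = y div 2" "nb (x div 2) (x mod 2) = nb (y div 2) (y mod 2)"
  shows "x = y"
proof -
  have "nb (x div 2) 0 \<noteq> nb (x div 2) 1" using nbrs_props(3) assms(1) by simp
  moreover have "x mod 2 = 0 \<or> x mod 2 = 1" "y mod 2 = 0 \<or> y mod 2 = 1" by auto
  ultimately have "x mod 2 = y mod 2" using assms(2,3) by auto
  then show ?thesis using assms(2) by (metis div_mult_mod_eq)
qed

lemma dart_perm_permutes:
  assumes "4 * N \<le> m"
  shows "dart_perm N E permutes {..<m}"
proof (rule bij_imp_permutes)
  have inj4: "x = y" if x: "x < 4 * N" and y: "y < 4 * N" and eq: "dart_perm N E x = dart_perm N E y" for x y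
  proof (rule dart_eqI[OF x])
    show "x div 2 = y div 2" using dart_perm_step(2)[OF x] dart_perm_step(2)[OF y] eq by simp
    show "nb (x div 2) (x mod 2) = nb (y div 2) (y mod 2)"
      using dart_perm_step(1)[OF x] dart_perm_step(1)[OF y] eq by simp
  qed
  have big: "dart_perm N E x = x" if "\<not> x < 4 * N" for x using that unfolding dart_perm_def by simp
  have inj: "inj_on (dart_perm N E) {..<m}"
  proof (rule inj_onI)
    fix x y assume eq: "dart_perm N E x = dart_perm N E y"
    show "x = y"
    proof (cases "x < 4 * N"; cases "y < 4 * N")
      assume "x < 4 * N" "y < 4 * N"
      then show ?thesis using inj4 eq by blast
    next
      assume "x < 4 * N" "\<not> y < 4 * N"
      then show ?thesis using dart_perm_less[of x] big[of y] eq by simp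
    next
      assume "\<not> x < 4 * N" "y < 4 * N"
      then show ?thesis using dart_perm_less[of y] big[of x] eq by simp
    next
      assume h: "\<not> x < 4 * N" "\<not> y < 4 * N"
      show ?thesis using eq unfolding big[OF h(1)] big[OF h(2)] .
    qed
  qed
  have "dart_perm N E x < m" if "x < m" for x
    using that dart_perm_less[of x] big[of x] assms by (cases "x < 4 * N") auto
  then have "dart_perm N E ` {..<m} \<subseteq> {..<m}" by auto
  then have "dart_perm N E ` {..<m} = {..<m}" using inj endo_inj_surj[of "{..<m}"] by blast
  then show "bij_betw (dart_perm N E) {..<m} {..<m}" using inj by (rule bij_betw_imageI[rotated])
next
  fix x assume "x \<notin> {..<m}"
  then show "dart_perm N E x = x" using assms unfolding dart_perm_def by simp
qed

text \<open>A dart walks around its cycle, in the direction given by \<open>\<delta> = 1\<close> or \<open>\<delta> = -1\<close> modulo the length.\<close>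

lemma dart_walk:
  assumes c: "0 < c" and \<delta>: "\<delta> \<le> c"
    and xs: "\<And>i. xs (i mod c) < 2 * N"
    and step: "\<And>i. {v. {xs (i mod c), v} \<in> E} = {xs ((i + \<delta>) mod c), xs ((i + (c - \<delta>)) mod c)}"
    and x: "x < 4 * N" "x div 2 = xs (i mod c)" "nb (x div 2) (x mod 2) = xs ((i + \<delta>) mod c)"
  shows "(dart_perm N E ^^ j) x < 4 * N \<and> (dart_perm N E ^^ j) x div 2 = xs ((i + j * \<delta>) mod c) \<and>
     nb ((dart_perm N E ^^ j) x div 2) ((dart_perm N E ^^ j) x mod 2) = xs ((i + Suc j * \<delta>) mod c)"
proof (induction j)
  case 0
  then show ?case using x by simp
next
  case (Suc j)
  define y where "y = (dart_perm N E ^^ j) x"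
  define y' where "y' = dart_perm N E y"
  have y: "y < 4 * N" "y div 2 = xs ((i + j * \<delta>) mod c)"
    "nb (y div 2) (y mod 2) = xs ((i + Suc j * \<delta>) mod c)" using Suc unfolding y_def by auto
  have y'less: "y' < 4 * N" unfolding y'_def using dart_perm_less[OF y(1)] .
  have y'div: "y' div 2 = xs ((i + Suc j * \<delta>) mod c)"
    using dart_perm_step(1)[OF y(1)] y(3) unfolding y'_def by simp
  have prev: "nb (y' div 2) (1 - y' mod 2) = xs ((i + j * \<delta>) mod c)"
    using dart_perm_step(2)[OF y(1)] y(2) unfolding y'_def by simp
  have v: "y' div 2 < 2 * N" using y'less by simp
  have "i + Suc j * \<delta> + (c - \<delta>) = i + j * \<delta> + c" using \<delta> by simp
  then have e: "(i + Suc j * \<delta> + (c - \<delta>)) mod c = (i + j * \<delta>) mod c" by (metis mod_add_self2)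
  \<comment> \<open>The neighbour that the dart does not point to is the previous vertex, so it
    points to the next one.\<close>
  have "{nb (y' div 2) 0, nb (y' div 2) 1} = {xs ((i + Suc j * \<delta> + \<delta>) mod c), xs ((i + j * \<delta>) mod c)}"
    using nbrs_props(4)[OF v] step[of "i + Suc j * \<delta>"] unfolding y'div e by simp
  moreover have "nb (y' div 2) 0 \<noteq> nb (y' div 2) 1" using nbrs_props(3)[OF v] .
  moreover have "y' mod 2 = 0 \<or> y' mod 2 = 1" by auto
  ultimately have "nb (y' div 2) (y' mod 2) = xs ((i + Suc j * \<delta> + \<delta>) mod c)"
    using prev by (auto simp: doubleton_eq_iff)
  moreover have "i + Suc j * \<delta> + \<delta> = i + Suc (Suc j) * \<delta>" by simp
  ultimately have "nb (y' div 2) (y' mod 2) = xs ((i + Suc (Suc j) * \<delta>) mod c)" by (simp only:)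
  then show ?case using y'less y'div unfolding y'_def y_def by simp
qed

text \<open>After \<open>N\<close> steps the walk has moved by \<open>N * \<delta>\<close>
  positions. For \<open>c = N\<close> these are full turns, and vertex and direction are those of
  the start. For \<open>c = 2 * N\<close> a return would make \<open>\<delta>\<close> even, but
  \<open>\<delta>\<close> is 1 or \<open>2 * N - 1\<close>.\<close>

lemma dart_return:
  assumes c: "3 \<le> c" and xs: "inj_on xs {..<c}" "\<And>i. i < c \<Longrightarrow> xs i < 2 * N"
    and i: "i < c" "xs i = 0"
    and step: "\<And>i. i < c \<Longrightarrow> {v. {xs i, v} \<in> E} = {xs (Suc i mod c), xs ((i + (c - 1)) mod c)}"
    and N: "c = N \<or> c = 2 * N"
  shows "(dart_perm N E ^^ N) 0 = 0 \<longleftrightarrow> c = N"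
proof -
  have N0: "0 < 4 * N" "0 < 2 * N" using N c by auto
  have c0: "0 < c" using c by simp
  have less: "xs (i mod c) < 2 * N" for i using xs(2) c0 by simp
  have st: "{v. {xs (i mod c), v} \<in> E} = {xs ((i + 1) mod c), xs ((i + (c - 1)) mod c)}" for i
  proof -
    have a: "Suc (i mod c) mod c = (i + 1) mod c" by (simp add: mod_Suc_eq)
    have b: "(i mod c + (c - 1)) mod c = (i + (c - 1)) mod c" by (rule mod_add_left_eq)
    show ?thesis using step[of "i mod c"] c0 unfolding a b by simp
  qed
  have "{nb 0 0, nb 0 1} = {xs ((i + 1) mod c), xs ((i + (c - 1)) mod c)}"
    using nbrs_props(4)[OF N0(2)] st[of i] i by simp
  then have "nb 0 0 = xs ((i + 1) mod c) \<or> nb 0 0 = xs ((i + (c - 1)) mod c)" by (auto simp: doubleton_eq_iff)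
  then obtain \<delta> where \<delta>: "\<delta> = 1 \<or> \<delta> = c - 1" "nb 0 0 = xs ((i + \<delta>) mod c)" by blast
  have st': "{v. {xs (i mod c), v} \<in> E} = {xs ((i + \<delta>) mod c), xs ((i + (c - \<delta>)) mod c)}" for i
    using \<delta>(1)
  proof
    assume "\<delta> = 1"
    then show ?thesis using st[of i] by (simp only:)
  next
    assume d: "\<delta> = c - 1"
    have e: "c - \<delta> = 1" using d c by simp
    show ?thesis using st[of i] unfolding e d[symmetric] by blast
  qed
  have walk: "(dart_perm N E ^^ N) 0 < 4 * N" "(dart_perm N E ^^ N) 0 div 2 = xs ((i + N * \<delta>) mod c)"
    "nb ((dart_perm N E ^^ N) 0 div 2) ((dart_perm N E ^^ N) 0 mod 2) = xs ((i + Suc N * \<delta>) mod c)"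
    using dart_walk[OF c0 _ less st' N0(1), of i N] \<delta> i c by auto
  show ?thesis
  proof
    assume z: "(dart_perm N E ^^ N) 0 = 0"
    then have "xs ((i + N * \<delta>) mod c) = xs i" using walk(2) i by simp
    then have "(i + N * \<delta>) mod c = i" by (rule inj_onD[OF xs(1)]) (use i c0 in auto)
    then have "(i + N * \<delta>) mod c = (i + 0) mod c" using i by simp
    then have "N * \<delta> mod c = 0" using mod_add_left_cancel by (metis mod_0)
    then have d: "c dvd N * \<delta>" by (rule mod_0_imp_dvd)
    have "c \<noteq> 2 * N"
    proof
      assume c2: "c = 2 * N"
      then have "2 dvd \<delta>" using d N0 by simp
      moreover have "odd \<delta>" using \<delta>(1) c2 c by auto
      ultimately show False by simp
    qed
    then show "c = N" using N by simp
  next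
    assume cN: "c = N"
    have "(i + N * \<delta>) mod c = i" using cN i by simp
    moreover have "i + Suc N * \<delta> = (i + \<delta>) + N * \<delta>" by simp
    then have "(i + Suc N * \<delta>) mod c = (i + \<delta>) mod c" unfolding cN by (simp only: mod_mult_self2)
    ultimately show "(dart_perm N E ^^ N) 0 = 0"
      using dart_eqI[OF walk(1), of 0] walk(2,3) i \<delta>(2) by simp
  qed
qed

end

text \<open>Cyclic indexing with both neighbours explicit; \<open>i + (c - 1)\<close> is the
  predecessor modulo \<open>c\<close>, written without truncated subtraction at 0.\<close>

lemma is_cycle_nbrs:
  assumes "is_cycle V C"
  obtains c xs where "3 \<le> c" "c = card V" "inj_on xs {..<c}" "xs ` {..<c} = V"
    "\<forall>i<c. {v. {xs i, v} \<in> C} = {xs (Suc i mod c), xs ((i + (c - 1)) mod c)}"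
    "\<forall>i<c. xs (Suc i mod c) \<noteq> xs ((i + (c - 1)) mod c)"
    "C = (\<lambda>i. {xs i, xs (Suc i mod c)}) ` {..<c}"
proof -
  obtain l where l: "distinct l" "set l = V" "3 \<le> length l"
    and C: "C = {{l ! i, l ! (Suc i mod length l)} | i. i < length l}"
    using assms unfolding is_cycle_def by blast
  let ?c = "length l"
  have c0: "0 < ?c" using l(3) by linarith
  have inj: "inj_on ((!) l) {..<?c}" using l(1) by (auto intro: inj_on_nth)
  have prev: "Suc j mod ?c = i \<longleftrightarrow> j = (i + (?c - 1)) mod ?c" if "i < ?c" "j < ?c" for i j
  proof (cases "i = 0")
    case True
    then show ?thesis using that l(3) by (cases "Suc j = ?c") auto
  next
    case False
    then have "i + (?c - 1) = (i - 1) + ?c" using l(3) by simp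
    then have "(i + (?c - 1)) mod ?c = i - 1" using that by (metis less_imp_diff_less mod_add_self2 mod_less)
    then show ?thesis using that False by (cases "Suc j = ?c") auto
  qed
  have ne: "l ! (Suc i mod ?c) \<noteq> l ! ((i + (?c - 1)) mod ?c)" if i: "i < ?c" for i
  proof
    assume "l ! (Suc i mod ?c) = l ! ((i + (?c - 1)) mod ?c)"
    then have "Suc i mod ?c = (i + (?c - 1)) mod ?c" by (rule inj_onD[OF inj]) (use c0 in auto)
    then have "Suc (Suc i mod ?c) mod ?c = i" using prev[OF i, of "Suc i mod ?c"] c0 by simp
    then have "(i + 2) mod ?c = (i + 0) mod ?c" using i by (simp add: mod_Suc_eq)
    then have "2 mod ?c = 0 mod ?c" by (rule mod_add_left_cancel)
    then show False using l(3) by simp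
  qed
  have nb: "{v. {l ! i, v} \<in> C} = {l ! (Suc i mod ?c), l ! ((i + (?c - 1)) mod ?c)}" if i: "i < ?c" for i
  proof (intro equalityI subsetI)
    fix v assume "v \<in> {v. {l ! i, v} \<in> C}"
    then obtain j where j: "j < ?c" "{l ! i, v} = {l ! j, l ! (Suc j mod ?c)}" unfolding C by blast
    then consider "l ! i = l ! j" "v = l ! (Suc j mod ?c)" | "l ! i = l ! (Suc j mod ?c)" "v = l ! j"
      by (auto simp: doubleton_eq_iff)
    then show "v \<in> {l ! (Suc i mod ?c), l ! ((i + (?c - 1)) mod ?c)}"
    proof cases
      case 1
      have "i = j" by (rule inj_onD[OF inj 1(1)]) (use i j(1) in auto)
      then show ?thesis using 1 by simp
    next
      case 2
      have "i = Suc j mod ?c" by (rule inj_onD[OF inj 2(1)]) (use i c0 in auto)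
      then have "j = (i + (?c - 1)) mod ?c" using prev[OF i j(1)] by simp
      then show ?thesis using 2 by simp
    qed
  next
    let ?p = "(i + (?c - 1)) mod ?c"
    fix v assume "v \<in> {l ! (Suc i mod ?c), l ! ?p}"
    moreover have "{l ! i, l ! (Suc i mod ?c)} \<in> C" unfolding C using i by blast
    moreover have p: "?p < ?c" using c0 by simp
    then have si: "Suc ?p mod ?c = i" using prev[OF i p] by blast
    have "{l ! ?p, l ! (Suc ?p mod ?c)} \<in> C" unfolding C using p by blast
    then have "{l ! ?p, l ! i} \<in> C" unfolding si .
    ultimately show "v \<in> {v. {l ! i, v} \<in> C}" by (auto simp: insert_commute)
  qed
  show ?thesis
    by (rule that[of ?c "(!) l"])
      (use l inj nb ne C in \<open>auto simp: distinct_card[OF l(1), symmetric] in_set_conv_nth image_def\<close>)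
qed

lemma is_cycle_subset:
  assumes "is_cycle V C" "{u, v} \<in> C"
  shows "u \<in> V" "u \<noteq> v"
proof -
  obtain c xs where c: "3 \<le> c" "c = card V" "inj_on xs {..<c}" "xs ` {..<c} = V"
    "\<forall>i<c. {v. {xs i, v} \<in> C} = {xs (Suc i mod c), xs ((i + (c - 1)) mod c)}"
    "\<forall>i<c. xs (Suc i mod c) \<noteq> xs ((i + (c - 1)) mod c)"
    and C: "C = (\<lambda>i. {xs i, xs (Suc i mod c)}) ` {..<c}"
    by (rule is_cycle_nbrs[OF assms(1)])
  obtain i where i: "i < c" "{u, v} = {xs i, xs (Suc i mod c)}" using assms(2) unfolding C by blast
  have s: "Suc i mod c < c" "Suc i mod c \<noteq> i" using i(1) c(1) by (auto simp: mod_Suc)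
  have ne: "xs i \<noteq> xs (Suc i mod c)"
  proof
    assume "xs i = xs (Suc i mod c)"
    then show False using inj_onD[OF c(3)] i(1) s by auto
  qed
  have "xs i \<in> V" "xs (Suc i mod c) \<in> V" using c(4) i(1) s(1) by blast+
  then show "u \<in> V" "u \<noteq> v" using i(2) ne by (auto simp: doubleton_eq_iff)
qed

lemma is_cycle_card_nbrs: "is_cycle V C \<Longrightarrow> u \<in> V \<Longrightarrow> card {v. {u, v} \<in> C} = 2"
proof (erule is_cycle_nbrs)
  fix c and xs :: "nat \<Rightarrow> nat"
  assume u: "u \<in> V" and xs: "xs ` {..<c} = V"
    and nb: "\<forall>i<c. {v. {xs i, v} \<in> C} = {xs (Suc i mod c), xs ((i + (c - 1)) mod c)}"
    and ne: "\<forall>i<c. xs (Suc i mod c) \<noteq> xs ((i + (c - 1)) mod c)"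
  obtain i where i: "i < c" "u = xs i" using u xs by blast
  show "card {v. {u, v} \<in> C} = 2" unfolding i(2) nb[rule_format, OF i(1)] using ne i(1) by simp
qed

lemma is_cycle_card: "is_cycle V C \<Longrightarrow> finite C \<and> card C \<le> card V"
proof (erule is_cycle_nbrs)
  fix c and xs :: "nat \<Rightarrow> nat"
  assume "c = card V" "C = (\<lambda>i. {xs i, xs (Suc i mod c)}) ` {..<c}"
  then show ?thesis using card_image_le[of "{..<c}" "\<lambda>i. {xs i, xs (Suc i mod c)}"] by simp
qed

lemma one_cycle_dart:
  assumes "one_cycle N E"
  shows "two_regular N E \<and> (dart_perm N E ^^ N) 0 \<noteq> 0 \<and> finite E \<and> card E \<le> 2 * N"
proof -
  have cyc: "is_cycle {..<2 * N} E" using assms unfolding one_cycle_def .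
  interpret two_regular N E
    using is_cycle_card_nbrs[OF cyc] is_cycle_subset[OF cyc] by unfold_locales auto
  obtain c xs where c: "3 \<le> c" "c = card {..<2 * N}" "inj_on xs {..<c}" "xs ` {..<c} = {..<2 * N}"
    "\<forall>i<c. {v. {xs i, v} \<in> E} = {xs (Suc i mod c), xs ((i + (c - 1)) mod c)}"
    "\<forall>i<c. xs (Suc i mod c) \<noteq> xs ((i + (c - 1)) mod c)"
    "E = (\<lambda>i. {xs i, xs (Suc i mod c)}) ` {..<c}"
    by (rule is_cycle_nbrs[OF cyc])
  have c2: "c = 2 * N" using c(2) by simp
  have "0 \<in> xs ` {..<c}" unfolding c(4) using c(1) c2 by simp
  then obtain i where i: "i < c" "xs i = 0" by auto
  have less: "xs i < 2 * N" if "i < c" for i using c(4) that by blast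
  have "(dart_perm N E ^^ N) 0 = 0 \<longleftrightarrow> c = N"
    by (rule dart_return[OF c(1,3) less i c(5)[rule_format]]) (simp_all add: c2)
  then show ?thesis using c(1) c2 two_regular_axioms is_cycle_card[OF cyc] by simp
qed

lemma two_cycles_dart:
  assumes "two_cycles N E"
  shows "two_regular N E \<and> (dart_perm N E ^^ N) 0 = 0 \<and> finite E \<and> card E \<le> 2 * N"
proof -
  obtain V1 V2 E1 E2 where V: "V1 \<union> V2 = {..<2 * N}" "V1 \<inter> V2 = {}" "card V1 = N" "card V2 = N"
    and cyc: "is_cycle V1 E1" "is_cycle V2 E2" and E: "E = E1 \<union> E2"
    using assms unfolding two_cycles_def by blast
  have nb1: "{v. {u, v} \<in> E} = {v. {u, v} \<in> E1}" if "u \<in> V1" for u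
    using is_cycle_subset(1)[OF cyc(2)] that V(2) unfolding E by blast
  have nb2: "{v. {u, v} \<in> E} = {v. {u, v} \<in> E2}" if "u \<in> V2" for u
    using is_cycle_subset(1)[OF cyc(1)] that V(2) unfolding E by blast
  interpret two_regular N E
  proof
    fix u assume "u < 2 * N"
    then have "u \<in> V1 \<or> u \<in> V2" using V(1) by blast
    then show "card {v. {u, v} \<in> E} = 2"
      using is_cycle_card_nbrs[OF cyc(1)] is_cycle_card_nbrs[OF cyc(2)] nb1 nb2 by auto
  next
    fix u v assume "{u, v} \<in> E"
    then have "u \<in> V1 \<union> V2 \<and> u \<noteq> v"
      using is_cycle_subset[OF cyc(1)] is_cycle_subset[OF cyc(2)] unfolding E by blast
    then show "u < 2 * N \<and> u \<noteq> v" unfolding V(1) by simp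
  qed
  \<comment> \<open>Dart 0 leaves vertex 0, so only the cycle through 0 matters, whichever of the
    two it is.\<close>
  have main: "(dart_perm N E ^^ N) 0 = 0"
    if V': "is_cycle V' E'" "card V' = N" "0 \<in> V'" "V' \<subseteq> {..<2 * N}"
      and nbE: "\<And>u. u \<in> V' \<Longrightarrow> {v. {u, v} \<in> E} = {v. {u, v} \<in> E'}" for V' E'
  proof -
    obtain c xs where c: "3 \<le> c" "c = card V'" "inj_on xs {..<c}" "xs ` {..<c} = V'"
      "\<forall>i<c. {v. {xs i, v} \<in> E'} = {xs (Suc i mod c), xs ((i + (c - 1)) mod c)}"
      "\<forall>i<c. xs (Suc i mod c) \<noteq> xs ((i + (c - 1)) mod c)"
      "E' = (\<lambda>i. {xs i, xs (Suc i mod c)}) ` {..<c}"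
      by (rule is_cycle_nbrs[OF V'(1)])
    have cN: "c = N" using c(2) V'(2) by simp
    have "0 \<in> xs ` {..<c}" using c(4) V'(3) by simp
    then obtain i where i: "i < c" "xs i = 0" by auto
    have mem: "xs i \<in> V'" if "i < c" for i using c(4) that by blast
    have less: "xs i < 2 * N" if "i < c" for i using mem[OF that] V'(4) by auto
    have st: "{v. {xs i, v} \<in> E} = {xs (Suc i mod c), xs ((i + (c - 1)) mod c)}" if "i < c" for i
      using c(5)[rule_format, OF that] nbE[OF mem[OF that]] by simp
    have "(dart_perm N E ^^ N) 0 = 0 \<longleftrightarrow> c = N"
      by (rule dart_return[OF c(1,3) less i st]) (simp_all add: cN)
    then show ?thesis using cN by simp
  qed
  have "3 \<le> card V1" by (rule is_cycle_nbrs[OF cyc(1)]) simp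
  then have "0 \<in> V1 \<union> V2" unfolding V(1) using V(3) by simp
  then consider "0 \<in> V1" | "0 \<in> V2" by blast
  then have "(dart_perm N E ^^ N) 0 = 0"
  proof cases
    case 1
    then show ?thesis using V(1) by (intro main[OF cyc(1) V(3) _ _ nb1]) auto
  next
    case 2
    then show ?thesis using V(1) by (intro main[OF cyc(2) V(4) _ _ nb2]) auto
  qed
  moreover have "finite E" "card E \<le> 2 * N"
    using is_cycle_card[OF cyc(1)] is_cycle_card[OF cyc(2)] V(3,4) card_Un_le[of E1 E2]
    unfolding E by auto
  ultimately show ?thesis using two_regular_axioms by blast
qed

section \<open>An algorithm for cycles\<close>

lemma pairs_concat_items:
  "(\<And>ws. ws \<in> set bs \<Longrightarrow> length ws = 2) \<Longrightarrow> pairs (concat bs) = map (\<lambda>ws. (ws ! 0, ws ! 1)) bs"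
proof (induction bs)
  case (Cons ws bs)
  then obtain a b where "ws = [a, b]" by (metis length_0_conv length_Suc_conv list.set_intros(1) numeral_2_eq_2)
  then show ?case using Cons by simp
qed simp

lemma set_pairs: "(a, b) \<in> set (pairs ws) \<Longrightarrow> a \<in> set ws \<and> b \<in> set ws"
  by (induction ws rule: pairs.induct) auto

lemma graph_inputE:
  assumes "ws \<in> graph_input E"
  obtains a b where "ws = [a, b]" "a < b" "{a, b} \<in> E"
  using assms unfolding graph_input_def by blast

lemma card_graph_input: "finite E \<Longrightarrow> finite (graph_input E) \<and> card (graph_input E) \<le> card E"
proof -
  assume E: "finite E"
  let ?f = "\<lambda>ws :: nat list. {ws ! 0, ws ! 1}"
  have inj: "inj_on ?f (graph_input E)"
    by (rule inj_onI, elim graph_inputE) (auto simp: doubleton_eq_iff)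
  have "?f ` graph_input E \<subseteq> E" by (auto elim!: graph_inputE)
  then show ?thesis using card_inj_on_le[OF inj _ E] inj_on_finite[OF inj _ E] by blast
qed

definition partners :: "nat \<Rightarrow> nat \<times> nat \<Rightarrow> nat list" where
  "partners u = (\<lambda>(a, b). if a = u then [b] else if b = u then [a] else [])"

text \<open>The word of one Horner step: \<open>k\<close> letters for the current power (number 1),
  \<open>d\<close> letters for the dart permutation (number 0), and identities (number 2) as
  padding. The fixed length \<open>2 * k\<close> lets all stages share one layout and one set of
  relabellings.\<close>

definition word_kinds :: "nat \<Rightarrow> nat \<Rightarrow> nat \<Rightarrow> nat" where
  "word_kinds k d c = (if c < k then 1 else if c < k + d then 0 else 2)"

lemma word_perm_kinds:
  assumes g: "g 0 = p" "g 1 = q" "g 2 = id" and d: "d \<le> k"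
  shows "word_perm (\<lambda>c. g (word_kinds k d c)) (2 * k) = (p ^^ d) \<circ> (q ^^ k)"
proof -
  let ?w = "word_perm (\<lambda>c. g (word_kinds k d c))"
  have 1: "?w c = q ^^ c" if "c \<le> k" for c
    using that g by (induction c) (auto simp: word_kinds_def)
  have 2: "?w (k + c) = (p ^^ c) \<circ> (q ^^ k)" if "c \<le> d" for c
    using that g 1[of k] by (induction c) (auto simp: word_kinds_def comp_assoc)
  have 3: "?w (k + d + c) = (p ^^ d) \<circ> (q ^^ k)" for c
    using g 2[of d] by (induction c) (auto simp: word_kinds_def)
  have e: "k + d + (k - d) = 2 * k" using d by simp
  show ?thesis using 3[of "k - d"] unfolding e .
qed

definition powers :: "(nat \<Rightarrow> nat) \<Rightarrow> nat \<Rightarrow> nat \<Rightarrow> nat \<Rightarrow> nat" where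
  "powers p e k = (if k = 0 then p else if k = 1 then p ^^ e else id)"

locale cycle_algorithm = simulation n m L l A N R s h Q S W items \<sigma> tc
  for n m L l A N R s h Q S W items \<sigma> tc +
  fixes k st \<theta> :: nat
  assumes mN: "4 * N \<le> m" and m0: "0 < m" and R0: "0 < R" and l_eq: "l = 2 * k"
    and k: "2 \<le> k" and st: "N < k ^ st"
    and count: "\<And>f a b. \<forall>c<l. f c permutes {..<m} \<Longrightarrow> a < m \<Longrightarrow> b < m \<Longrightarrow>
      \<theta> \<le> card {i. i < R \<and> \<sigma> i ` comp_edge L a (L - 1) \<notin>
        output_tree A items (relabel (\<sigma> i) (word_graph m L l f b))} \<longleftrightarrow> word_perm f l a = b"
begin

section \<open>Building the dart permutation from the input\<close>

definition gather_round :: "node round" where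
  "gather_round =
    (\<lambda>nd w nd'. case nd' of Home u \<Rightarrow> concat (map (partners u) (pairs w)) | _ \<Rightarrow> [],
     \<lambda>nd w ib. case nd of Home u \<Rightarrow> sorted_list_of_set (\<Union>nd'. set (ib nd')) | _ \<Rightarrow> [])"

definition homes where
  "homes E M \<longleftrightarrow> (\<forall>u<2 * N. M (Home u) = nbrs E u)"

lemma length_partners: "length (concat (map (partners u) ps)) = length (filter (\<lambda>(a, b). a = u \<or> b = u) ps)"
  by (induction ps) (auto simp: partners_def split: if_splits)

text \<open>An item of two words causes at most two words to be sent, so no machine sends more than
  it stores. As each item is on one machine only, a home receives one word per incident edge, that
  is two.\<close>

lemma gather_round:
  assumes E: "two_regular N E"
  shows "triple (input_state (graph_input E)) [gather_round] (homes E)"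
proof (rule triple_single)
  interpret two_regular N E by (rule E)
  fix M assume M: "\<forall>i\<in>X. ok (M i)" and "input_state (graph_input E) M"
  then obtain B where B0: "\<forall>i\<in>X. M i = concat (B i) \<and> distinct (B i)"
    and disj: "\<forall>i\<in>X. \<forall>j\<in>X. i \<noteq> j \<longrightarrow> set (B i) \<inter> set (B j) = {}"
    and all: "(\<Union>i\<in>X. set (B i)) = graph_input E"
    unfolding input_state_def by (elim exE conjE)
  have B: "M i = concat (B i)" "distinct (B i)" if "i \<in> X" for i using B0 that by blast+
  have item: "\<exists>a b. ws = [a, b] \<and> a < b \<and> {a, b} \<in> E" if "i \<in> X" "ws \<in> set (B i)" for i ws
  proof -
    have "ws \<in> graph_input E" using all that by blast
    then show ?thesis by (elim graph_inputE) blast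
  qed
  have prs: "pairs (M i) = map (\<lambda>ws. (ws ! 0, ws ! 1)) (B i)" if "i \<in> X" for i
    unfolding B(1)[OF that] using item[OF that] by (intro pairs_concat_items) fastforce
  define inc where "inc u i = {ws \<in> set (B i). ws ! 0 = u \<or> ws ! 1 = u}" for u i
  have len: "length (concat (map (partners u) (pairs (M i)))) = card (inc u i)" if "i \<in> X" for u i
  proof -
    have "length (concat (map (partners u) (pairs (M i)))) = length (filter (\<lambda>ws. ws ! 0 = u \<or> ws ! 1 = u) (B i))"
      unfolding length_partners prs[OF that] by (simp add: filter_map comp_def)
    also have "\<dots> = card (set (filter (\<lambda>ws. ws ! 0 = u \<or> ws ! 1 = u) (B i)))"
      using B(2)[OF that] by (intro distinct_card[symmetric]) simp
    finally show ?thesis unfolding inc_def by simp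
  qed
  have nbset: "(\<Union>nd'. set (if nd' \<in> X then concat (map (partners u) (pairs (M nd'))) else [])) = {v. {u, v} \<in> E}" for u
  proof (intro equalityI subsetI)
    fix v assume "v \<in> (\<Union>nd'. set (if nd' \<in> X then concat (map (partners u) (pairs (M nd'))) else []))"
    then obtain i where i: "i \<in> X" "v \<in> set (concat (map (partners u) (pairs (M i))))"
      by (auto split: if_splits)
    then obtain ws where "ws \<in> set (B i)" "v \<in> set (partners u (ws ! 0, ws ! 1))" unfolding prs[OF i(1)] by auto
    moreover from this item[OF i(1)] obtain a b where "ws = [a, b]" "{a, b} \<in> E" by blast
    ultimately show "v \<in> {v. {u, v} \<in> E}"
      unfolding partners_def by (auto simp: insert_commute split: if_splits)
  next
    fix v assume "v \<in> {v. {u, v} \<in> E}"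
    then have uv: "{u, v} \<in> E" "u \<noteq> v" using E_less by auto
    then have "[min u v, max u v] \<in> graph_input E"
      unfolding graph_input_def by (cases "u < v") (auto simp: insert_commute min_def max_def)
    then obtain i where i: "i \<in> X" "[min u v, max u v] \<in> set (B i)" using all by blast
    then have "(min u v, max u v) \<in> set (pairs (M i))" unfolding prs[OF i(1)] by force
    moreover have "v \<in> set (partners u (min u v, max u v))"
      unfolding partners_def using uv(2) by (auto simp: min_def max_def)
    ultimately have "v \<in> set (concat (map (partners u) (pairs (M i))))" by auto
    then show "v \<in> (\<Union>nd'. set (if nd' \<in> X then concat (map (partners u) (pairs (M nd'))) else []))"
      using i(1) by (intro UN_I[of i]) auto
  qed
  have w_set: "w \<in> set (M i)" if "w \<in> set (concat (map (partners u) (pairs (M i))))" for w u i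
    using that set_pairs[of _ _ "M i"] unfolding partners_def by (auto split: if_splits)
  show "legal gather_round M" unfolding legal_def
  proof (intro ballI conjI)
    fix nd assume nd: "nd \<in> X"
    have "(\<Sum>nd'\<in>X. length (fst gather_round nd (M nd) nd'))
        = (\<Sum>nd'\<in>Home ` {..<2 * N}. length (fst gather_round nd (M nd) nd'))"
    proof (rule sum.mono_neutral_right[OF finite_X])
      show "\<forall>i\<in>X - Home ` {..<2 * N}. length (fst gather_round nd (M nd) i) = 0"
      proof
        fix i assume "i \<in> X - Home ` {..<2 * N}"
        then show "length (fst gather_round nd (M nd) i) = 0" by (cases i) (auto simp: gather_round_def)
      qed
    qed auto
    also have "\<dots> = (\<Sum>u<2 * N. length (concat (map (partners u) (pairs (M nd)))))"
      by (subst sum.reindex) (auto simp: inj_on_def gather_round_def)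
    also have "\<dots> = (\<Sum>u<2 * N. \<Sum>ws\<in>set (B nd). if ws ! 0 = u \<or> ws ! 1 = u then 1 else 0)"
      unfolding len[OF nd] inc_def by (simp add: sum.If_cases Int_def)
    also have "\<dots> = (\<Sum>ws\<in>set (B nd). \<Sum>u<2 * N. if ws ! 0 = u \<or> ws ! 1 = u then 1 else 0)"
      by (rule sum.swap)
    also have "\<dots> \<le> (\<Sum>ws\<in>set (B nd). 2)"
    proof (rule sum_mono)
      fix ws :: "nat list"
      have "(\<Sum>u<2 * N. if ws ! 0 = u \<or> ws ! 1 = u then 1 else (0 :: nat)) = card {u. u < 2 * N \<and> (ws ! 0 = u \<or> ws ! 1 = u)}"
        by (simp add: sum.If_cases Int_def)
      also have "\<dots> \<le> card {ws ! 0, ws ! 1}" by (intro card_mono) auto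
      also have "\<dots> \<le> 2" by (simp add: card_insert_if)
      finally show "(\<Sum>u<2 * N. if ws ! 0 = u \<or> ws ! 1 = u then 1 else (0 :: nat)) \<le> 2" .
    qed
    also have "\<dots> = 2 * card (set (B nd))" by simp
    also have "\<dots> = 2 * length (pairs (M nd))" unfolding prs[OF nd] using distinct_card[OF B(2)[OF nd]] by simp
    also have "\<dots> \<le> length (M nd)" by (rule length_pairs)
    also have "\<dots> \<le> S" using M nd unfolding ok_def by blast
    finally show "(\<Sum>nd'\<in>X. length (fst gather_round nd (M nd) nd')) \<le> S" .
    show "(\<Sum>nd'\<in>X. length (fst gather_round nd' (M nd') nd)) \<le> S"
    proof (cases "\<exists>u. nd = Home u")
      case True
      then obtain u where u: "nd = Home u" by blast
      have "(\<Sum>nd'\<in>X. length (fst gather_round nd' (M nd') nd)) = (\<Sum>i\<in>X. card (inc u i))"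
        unfolding gather_round_def u using len by (intro sum.cong) auto
      also have "\<dots> = card (\<Union>i\<in>X. inc u i)"
      proof (rule card_UN_disjoint[symmetric, OF finite_X])
        show "\<forall>i\<in>X. \<forall>j\<in>X. i \<noteq> j \<longrightarrow> inc u i \<inter> inc u j = {}" using disj unfolding inc_def by blast
      qed (simp add: inc_def)
      also have "(\<Union>i\<in>X. inc u i) \<subseteq> (\<lambda>v. [min u v, max u v]) ` {v. {u, v} \<in> E}"
      proof
        fix ws assume "ws \<in> (\<Union>i\<in>X. inc u i)"
        then obtain i where i: "i \<in> X" "ws \<in> set (B i)" "ws ! 0 = u \<or> ws ! 1 = u" unfolding inc_def by blast
        obtain a b where ab: "ws = [a, b]" "a < b" "{a, b} \<in> E" using item[OF i(1,2)] by blast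
        then consider "a = u" | "b = u" using i(3) by auto
        then show "ws \<in> (\<lambda>v. [min u v, max u v]) ` {v. {u, v} \<in> E}"
        proof cases
          case 1
          then show ?thesis using ab by (intro image_eqI[of _ _ b]) auto
        next
          case 2
          then show ?thesis using ab by (intro image_eqI[of _ _ a]) (auto simp: insert_commute)
        qed
      qed
      then have "card (\<Union>i\<in>X. inc u i) \<le> card ((\<lambda>v. [min u v, max u v]) ` {v. {u, v} \<in> E})"
        using card_nbrs[of u] nd u by (intro card_mono finite_imageI card_ge_0_finite) auto
      also have "\<dots> \<le> card {v. {u, v} \<in> E}"
        using card_nbrs[of u] nd u by (intro card_image_le card_ge_0_finite) auto
      also have "\<dots> \<le> S" using card_nbrs[of u] nd u S(3) by simp
      finally show ?thesis .
    next
      case False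
      then have "fst gather_round nd' w nd = []" for nd' w by (cases nd) (auto simp: gather_round_def)
      then show ?thesis by simp
    qed
    fix nd' w assume "w \<in> set (fst gather_round nd (M nd) nd')"
    then have "w \<in> set (M nd)" using w_set unfolding gather_round_def by (auto split: node.splits)
    then show "w < W" using M nd unfolding ok_def by blast
  qed
  have stp: "step gather_round M (Home u) = nbrs E u" for u
    unfolding step_def gather_round_def nbrs_def using nbset[of u] by simp
  then show "homes E (step gather_round M)" unfolding homes_def by blast
  fix nd assume nd: "nd \<in> X"
  show "ok (step gather_round M nd)"
  proof (cases nd)
    case (Home u)
    then have u: "u < 2 * N" using nd by simp
    have "w < W" if "w \<in> set (nbrs E u)" for w
    proof -
      have "{w, u} \<in> E" using that nbrs_props(2)[OF u] by (simp add: insert_commute)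
      then show ?thesis using E_less W(5) by fastforce
    qed
    then show ?thesis unfolding Home stp ok_def using nbrs_props(1)[OF u] S(3) by simp
  qed (auto simp: step_def gather_round_def ok_def)
qed

text \<open>A home acts in two roles: for darts \<open>x\<close> that leave it, it checks the first
  half of \<open>dart_perm_iff\<close>, and for darts \<open>y\<close> that leave it, the second
  half.\<close>

definition init_sends :: "node \<Rightarrow> nat list \<Rightarrow> node \<Rightarrow> bool" where
  "init_sends nd w nd' \<longleftrightarrow> (\<exists>u x y. nd = Home u \<and> nd' = Cell 0 x y 0 \<and> x < 4 * N \<and> y < 4 * N \<and>
     (x div 2 = u \<and> w ! (x mod 2) = y div 2 \<or> y div 2 = u \<and> w ! (1 - y mod 2) = x div 2))"

definition init_round :: "node round" where
  "init_round = (\<lambda>nd w nd'. if init_sends nd w nd' then [1] else [],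
     \<lambda>nd w ib. case nd of
       Cell k x y t \<Rightarrow> if k = 0 \<and> x < 4 * N \<and> y < 4 * N
         then (if ib (Home (x div 2)) \<noteq> [] \<and> ib (Home (y div 2)) \<noteq> [] then [1] else [])
         else (if x = y then [1] else [])
       | _ \<Rightarrow> w)"

lemma init_round:
  assumes E: "two_regular N E"
  shows "triple (homes E) [init_round] (cells (powers (dart_perm N E) 0))"
proof (rule triple_single)
  interpret two_regular N E by (rule E)
  fix M assume M: "\<forall>i\<in>X. ok (M i)" and homes: "homes E M"
  have sum: "(\<Sum>nd\<in>X. length (if B nd then [1::nat] else [])) = card {nd\<in>X. B nd}" for B
    using finite_X by (simp add: if_distrib[of length] sum.If_cases Int_def)
  have le: "card Y \<le> S" if "Y \<subseteq> f ` Z" "finite Z" "card Z \<le> 8" for Y :: "node set" and f :: "'z \<Rightarrow> node" and Z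
  proof -
    have "card Y \<le> card (f ` Z)" using that by (intro card_mono) auto
    also have "\<dots> \<le> card Z" using that(2) by (rule card_image_le)
    finally show ?thesis using that(3) S(3) by linarith
  qed
  show "legal init_round M" unfolding legal_def
  proof (intro ballI conjI)
    fix nd assume nd: "nd \<in> X"
    have "card {nd'\<in>X. init_sends nd (M nd) nd'} \<le> S"
    proof (rule le)
      let ?u = "case nd of Home u \<Rightarrow> u | _ \<Rightarrow> 0"
      \<comment> \<open>Eight candidates: the role \<open>c\<close> and the parities
        \<open>a\<close> and \<open>b\<close> of \<open>x\<close> and \<open>y\<close>. The vertex
        at the other end is then given by the stored neighbours.\<close>
      let ?f = "\<lambda>(c, a, b). if c = (0::nat) then Cell 0 (2 * ?u + a) (2 * (M nd ! a) + b) 0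
          else Cell 0 (2 * (M nd ! (1 - b)) + a) (2 * ?u + b) 0"
      show "{nd'\<in>X. init_sends nd (M nd) nd'} \<subseteq> ?f ` ({..<2} \<times> {..<2} \<times> {..<2})"
      proof
        fix nd' assume "nd' \<in> {nd'\<in>X. init_sends nd (M nd) nd'}"
        then obtain u x y where *: "nd = Home u" "nd' = Cell 0 x y 0"
          "x div 2 = u \<and> M nd ! (x mod 2) = y div 2 \<or> y div 2 = u \<and> M nd ! (1 - y mod 2) = x div 2"
          unfolding init_sends_def by blast
        have xy: "x = 2 * (x div 2) + x mod 2" "y = 2 * (y div 2) + y mod 2" by simp_all
        from *(3) show "nd' \<in> ?f ` ({..<2} \<times> {..<2} \<times> {..<2})"
        proof
          assume h: "x div 2 = u \<and> M nd ! (x mod 2) = y div 2"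
          have "nd' = ?f (0, x mod 2, y mod 2)" using h xy * by simp
          then show ?thesis by (intro image_eqI[of _ _ "(0, x mod 2, y mod 2)"]) auto
        next
          assume h: "y div 2 = u \<and> M nd ! (1 - y mod 2) = x div 2"
          have "nd' = ?f (1, x mod 2, y mod 2)" using h xy * by simp
          then show ?thesis by (intro image_eqI[of _ _ "(1, x mod 2, y mod 2)"]) auto
        qed
      qed
    qed (simp_all add: card_cartesian_product)
    then show "(\<Sum>nd'\<in>X. length (fst init_round nd (M nd) nd')) \<le> S"
      unfolding init_round_def fst_conv sum .
    have "card {nd'\<in>X. init_sends nd' (M nd') nd} \<le> S"
    proof (rule le)
      let ?f = "\<lambda>z. case nd of Cell k x y t \<Rightarrow> Home (if z = (0::nat) then x div 2 else y div 2) | _ \<Rightarrow> Out"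
      show "{nd'\<in>X. init_sends nd' (M nd') nd} \<subseteq> ?f ` {0, 1}" unfolding init_sends_def by auto
    qed simp_all
    then show "(\<Sum>nd'\<in>X. length (fst init_round nd' (M nd') nd)) \<le> S"
      unfolding init_round_def fst_conv sum .
    show "w < W" if "w \<in> set (fst init_round nd (M nd) nd')" for w nd'
      using that W(4) unfolding init_round_def by (auto split: if_splits)
  qed
  have "step init_round M (Cell k x y 0) \<noteq> [] \<longleftrightarrow> powers (dart_perm N E) 0 k x = y"
    if kxy: "k < 3" "x < m" "y < m" for k x y
  proof (cases "k = 0 \<and> x < 4 * N \<and> y < 4 * N")
    case True
    let ?u = "x div 2" and ?v = "y div 2"
    have uv: "?u < 2 * N" "?v < 2 * N" using True by auto
    have Mu: "M (Home ?u) = nbrs E ?u" "M (Home ?v) = nbrs E ?v" using homes uv unfolding homes_def by auto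
    \<comment> \<open>The home could answer in the wrong role only if \<open>?u = ?v\<close>, and
      then a positive answer would require a loop.\<close>
    have s1: "init_sends (Home ?u) (nbrs E ?u) (Cell 0 x y 0) \<longleftrightarrow> nb ?u (x mod 2) = ?v"
    proof -
      have "nb ?u (1 - y mod 2) \<noteq> ?u" using nb_less[OF uv(1), of "1 - y mod 2"] by simp
      then show ?thesis unfolding init_sends_def using True by auto
    qed
    have s2: "init_sends (Home ?v) (nbrs E ?v) (Cell 0 x y 0) \<longleftrightarrow> nb ?v (1 - y mod 2) = ?u"
    proof -
      have "nb ?v (x mod 2) \<noteq> ?v" using nb_less[OF uv(2), of "x mod 2"] by simp
      then show ?thesis unfolding init_sends_def using True by auto
    qed
    have "step init_round M (Cell k x y 0) \<noteq> [] \<longleftrightarrow> nb ?u (x mod 2) = ?v \<and> nb ?v (1 - y mod 2) = ?u"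
      unfolding step_def init_round_def using True uv by (simp add: Mu s1 s2)
    also have "\<dots> \<longleftrightarrow> dart_perm N E x = y" using dart_perm_iff True by simp
    finally show ?thesis using True unfolding powers_def by simp
  next
    case False
    have "powers (dart_perm N E) 0 k x = y \<longleftrightarrow> x = y"
    proof (cases "k = 0")
      case True
      then have "\<not> (x < 4 * N \<and> y < 4 * N)" using False by simp
      then show ?thesis using dart_perm_less[of x] True unfolding powers_def
        by (cases "x < 4 * N") (auto simp: dart_perm_def)
    next
      case False
      then show ?thesis unfolding powers_def by simp
    qed
    then show ?thesis using False unfolding step_def init_round_def by auto
  qed
  then show "cells (powers (dart_perm N E) 0) (step init_round M)" unfolding cells_def by blast
  fix nd assume nd: "nd \<in> X"
  show "ok (step init_round M nd)"
  proof (cases nd)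
    case (Cell k x y t)
    have "ok [1]" "ok []" using S_pos W(4) unfolding ok_def by simp_all
    then show ?thesis using Cell unfolding step_def init_round_def by simp
  qed (use M nd in \<open>auto simp: step_def init_round_def\<close>)
qed

definition out_round :: "node round" where
  "out_round = pull (\<lambda>nd. if nd = Out then {Cell 1 0 0 0} else {})
     (\<lambda>nd w ib. if nd = Out then (if ib (Cell 1 0 0 0) \<noteq> [] then [0] else [1]) else w)"

lemma out_round: "triple (cells g) [out_round] (\<lambda>M. M Out = [if g 1 0 = 0 then 0 else 1])"
proof (rule triple_single)
  fix M assume M: "\<forall>i\<in>X. ok (M i)" and cells: "cells g M"
  show "legal out_round M" unfolding out_round_def
  proof (rule legal_pullI[OF M])
    fix nd assume "nd \<in> X"
    show "\<exists>Y. {nd'\<in>X. nd' \<in> (if nd = Out then {Cell 1 0 0 0} else {})} \<subseteq> Y \<and> finite Y \<and> card Y \<le> S"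
      by (rule ex_bound_one[OF _ S_pos]) (auto split: if_splits)
    show "\<exists>Y. {nd'\<in>X. nd \<in> (if nd' = Out then {Cell 1 0 0 0} else {})} \<subseteq> Y \<and> finite Y \<and> card Y \<le> S"
      by (rule ex_bound_one[OF _ S_pos]) (auto split: if_splits)
  qed
  show "step out_round M Out = [if g 1 0 = 0 then 0 else 1]"
    using cells m0 Q_pos unfolding cells_def out_round_def step_pull by auto
  fix nd assume nd: "nd \<in> X"
  have "ok [0]" "ok [1]" using S_pos W(4) unfolding ok_def by simp_all
  then show "ok (step out_round M nd)" using M nd unfolding out_round_def step_pull by auto
qed

text \<open>Digits of \<open>N\<close> in base \<open>k\<close>, most significant first, padded to
  \<open>st\<close> digits.\<close>

definition digit :: "nat \<Rightarrow> nat" where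
  "digit j = (N div k ^ (st - Suc j)) mod k"

definition program :: "node round list" where
  "program = [gather_round] @ [init_round]
     @ concat (map (\<lambda>j. stage (word_kinds k (digit j)) \<theta>) [0..<st]) @ [out_round]"

lemma length_program: "length program = 3 + st * (rounds A + 3 * h + 4)"
proof -
  have "length (concat (map (\<lambda>j. stage (word_kinds k (digit j)) \<theta>) [0..<t])) = t * (rounds A + 3 * h + 4)" for t
    by (induction t) (auto simp: length_stage)
  then show ?thesis unfolding program_def by simp
qed

lemma program:
  assumes E: "two_regular N E"
  shows "triple (input_state (graph_input E)) program
     (\<lambda>M. M Out = [if (dart_perm N E ^^ N) 0 = 0 then 0 else 1])"
proof -
  let ?p = "dart_perm N E"
  \<comment> \<open>The number formed by the first \<open>j\<close> digits: 0 at the start, as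
    \<open>N < k ^ st\<close>, and \<open>N\<close> at the end. Appending a digit is one Horner
    step.\<close>
  define e where "e j = N div k ^ (st - j)" for j
  interpret two_regular N E by (rule E)
  have p: "?p permutes {..<m}" using dart_perm_permutes mN by blast
  have pe: "(?p ^^ i) permutes {..<m}" for i
  proof (induction i)
    case 0
    show ?case unfolding funpow.simps by (rule permutes_id)
  next
    case (Suc i)
    then show ?case unfolding funpow.simps using p by (rule permutes_compose)
  qed
  have step: "triple (cells (powers ?p (e j))) (stage (word_kinds k (digit j)) \<theta>) (cells (powers ?p (e (Suc j))))"
    if j: "j < st" for j
  proof -
    let ?g = "powers ?p (e j)"
    let ?f = "\<lambda>c. ?g (word_kinds k (digit j) c)"
    have "k ^ (st - j) = k ^ (st - Suc j) * k" using j by (metis Suc_diff_Suc power_Suc2)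
    then have "e j = e (Suc j) div k" unfolding e_def by (simp add: div_mult2_eq)
    then have "e (Suc j) = digit j + e j * k"
      unfolding digit_def e_def[of "Suc j", symmetric] by (metis add.commute div_mult_mod_eq)
    moreover have "digit j < k" unfolding digit_def using k by simp
    then have "word_perm ?f l = (?p ^^ digit j) \<circ> ((?p ^^ e j) ^^ k)"
      unfolding l_eq by (intro word_perm_kinds) (auto simp: powers_def)
    ultimately have wp: "word_perm ?f l = ?p ^^ e (Suc j)"
      by (simp add: funpow_add funpow_mult mult.commute)
    have "?g c permutes {..<m}" for c
      unfolding powers_def using p pe permutes_id by auto
    then have "triple (cells ?g) (stage (word_kinds k (digit j)) \<theta>) (cells (?g(1 := word_perm ?f l)))"
      using count[of ?f] by (intro stage[OF R0]) (auto simp: word_kinds_def)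
    moreover have "?g(1 := ?p ^^ e (Suc j)) = powers ?p (e (Suc j))" unfolding powers_def by auto
    ultimately show ?thesis unfolding wp by simp
  qed
  have "triple (cells (powers ?p (e 0))) (concat (map (\<lambda>j. stage (word_kinds k (digit j)) \<theta>) [0..<st]))
     (cells (powers ?p (e st)))"
    by (rule triple_iter[where P = "\<lambda>j. cells (powers ?p (e j))"]) (rule step)
  moreover have "e 0 = 0" "e st = N" unfolding e_def using st by auto
  ultimately have loop: "triple (cells (powers ?p 0))
     (concat (map (\<lambda>j. stage (word_kinds k (digit j)) \<theta>) [0..<st])) (cells (powers ?p N))" by simp
  have "triple (input_state (graph_input E)) program (\<lambda>M. M Out = [if powers ?p N 1 0 = 0 then 0 else 1])"
    unfolding program_def
    by (rule triple_append[OF gather_round[OF E] triple_append[OF init_round[OF E] triple_append[OF loop out_round]]])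
  then show ?thesis unfolding powers_def by simp
qed

theorem ex_cycle_mpc:
  "\<exists>C. distinguishes_cycles N C \<and> machines C = card X \<and> local_space C = S \<and> word_bound C = W \<and>
     rounds C = 3 + st * (rounds A + 3 * h + 4)"
proof -
  obtain enc0 where enc0: "bij_betw enc0 X {..<card X}"
    using ex_bij_betw_finite_nat[OF finite_X] by (auto simp: atLeast0LessThan)
  have outX: "Out \<in> X" by simp
  then have less: "enc0 Out < card X" using enc0 bij_betwE by blast
  \<comment> \<open>The answer is read from machine 0, so the number of \<open>Out\<close> is
    exchanged with 0.\<close>
  define enc where "enc = Transposition.transpose (enc0 Out) 0 \<circ> enc0"
  have "bij_betw (Transposition.transpose (enc0 Out) 0) {..<card X} {..<card X}"
    using less by (intro bij_betw_byWitness[of _ "Transposition.transpose (enc0 Out) 0"])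
      (auto simp: Transposition.transpose_def)
  then have enc: "bij_betw enc X {..<card X}" unfolding enc_def using enc0 bij_betw_trans by blast
  have e0: "enc Out = 0" unfolding enc_def by simp
  have cX: "2 * N \<le> card X"
  proof -
    have "card (Home ` {..<2 * N}) \<le> card X" using finite_X by (intro card_mono) auto
    then show ?thesis by (simp add: card_image inj_on_def)
  qed
  have sol: "solves (to_mpc enc program) (graph_input E) (\<lambda>out. out 0 = [if (dart_perm N E ^^ N) 0 = 0 then 0 else 1])"
    if E: "two_regular N E" "finite E" "card E \<le> 2 * N" for E
  proof (rule solves_to_mpc[OF enc outX e0 program[OF E(1)]])
    show "finite (graph_input E)" "card (graph_input E) \<le> card X" using card_graph_input[OF E(2)] E(3) cX by auto
    fix ws assume "ws \<in> graph_input E"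
    then obtain a b where ab: "ws = [a, b]" "{a, b} \<in> E" by (rule graph_inputE)
    have "a < 2 * N" "b < 2 * N" 
      using two_regular.E_less[OF E(1), of a b] two_regular.E_less[OF E(1), of b a] ab(2)
      by (simp_all add: insert_commute[of b a])
    then show "ok ws" unfolding ab(1) ok_def using S(3) W(5) by simp
  qed
  have "distinguishes_cycles N (to_mpc enc program)"
    unfolding distinguishes_cycles_def
  proof (intro allI conjI impI)
    fix E assume "one_cycle N E"
    then show "solves (to_mpc enc program) (graph_input E) (\<lambda>out. out 0 = [1])"
      using one_cycle_dart[of N E] sol[of E] by simp
  next
    fix E assume "two_cycles N E"
    then show "solves (to_mpc enc program) (graph_input E) (\<lambda>out. out 0 = [0])"
      using two_cycles_dart[of N E] sol[of E] by simp
  qed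
  then show ?thesis using length_program by (intro exI[of _ "to_mpc enc program"]) simp
qed

end

section \<open>From spanning tree algorithms to cycle algorithms\<close>

text \<open>Correctness covers every arrangement of the input, so one can be chosen: an arrangement
  for the empty graph, with the distances overwritten for other graphs. Placement is then
  independent of \<open>H\<close>, and the output is a function of \<open>H\<close>.\<close>

lemma metric_input_dist_of:
  assumes n: "3 \<le> n"
    and solves: "\<And>H. H \<subseteq> complete_edges n \<Longrightarrow>
      solves A (metric_input n (dist_of H)) (\<lambda>out. \<exists>T. outputs_edges (machines A) out T \<and> approx_mst \<epsilon> n (dist_of H) T)"
    and wb: "n \<le> word_bound A"
  obtains items where
    "\<And>j x y. j < machines A \<Longrightarrow> (x, y) \<in> set (items j) \<Longrightarrow> x < y \<and> y < n"
    "\<And>j. j < machines A \<Longrightarrow> 3 * length (items j) \<le> local_space A"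
    "\<And>H. H \<subseteq> complete_edges n \<Longrightarrow> obeys_limits A (metric_state items H)"
    "\<And>H. H \<subseteq> complete_edges n \<Longrightarrow> approx_mst \<epsilon> n (dist_of H) (output_tree A items H)"
proof -
  let ?I = "\<lambda>H. metric_input n (dist_of H)"
  obtain m0 where "distribution A (?I {}) m0" using solves[of "{}"] unfolding solves_def by auto
  then obtain B where B: "\<And>j. j < machines A \<Longrightarrow> m0 j = concat (B j) \<and> fits A (m0 j)"
    and dist: "distinct (concat (map B [0..<machines A]))"
    and set: "set (concat (map B [0..<machines A])) = ?I {}"
    unfolding distribution_def by blast
  define items where "items j = map (\<lambda>ws. (ws ! 0, ws ! 1)) (B j)" for j
  have item: "\<exists>x y. ws = [x, y, 2] \<and> x < y \<and> y < n" if "ws \<in> ?I {}" for ws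
    using that unfolding metric_input_def dist_of_def by auto
  have itemB: "\<exists>x y. ws = [x, y, 2] \<and> x < y \<and> y < n" if "j < machines A" "ws \<in> set (B j)" for j ws
  proof (rule item)
    have "ws \<in> set (concat (map B [0..<machines A]))" using that by auto
    then show "ws \<in> ?I {}" unfolding set .
  qed
  have items1: "x < y \<and> y < n" if "j < machines A" "(x, y) \<in> set (items j)" for j x y
    using that(2) itemB[OF that(1)] unfolding items_def by fastforce
  have len3: "length (concat zs) = 3 * length zs" if "\<And>ws. ws \<in> set zs \<Longrightarrow> length ws = 3" for zs :: "nat list list"
    using that by (induction zs) auto
  have items2: "3 * length (items j) \<le> local_space A" if j: "j < machines A" for j
  proof -
    have "length (concat (B j)) = 3 * length (B j)" using itemB[OF j] by (intro len3) fastforce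
    moreover have "length (m0 j) \<le> local_space A" using B[OF j] unfolding fits_def by blast
    moreover have "m0 j = concat (B j)" using B[OF j] by blast
    ultimately show ?thesis unfolding items_def by simp
  qed
  have distr: "distribution A (?I H) (metric_state items H)" for H
  proof -
    define \<phi> where "\<phi> ws = [ws ! 0, ws ! 1, dist_of H (ws ! 0) (ws ! 1)]" for ws :: "nat list"
    have ms: "metric_state items H j = concat (map \<phi> (B j))" for j
      unfolding metric_state_def items_def \<phi>_def by (simp add: comp_def)
    have c: "concat (map (\<lambda>j. map \<phi> (B j)) [0..<p]) = map \<phi> (concat (map B [0..<p]))" for p
      by (induction p) auto
    have "inj_on \<phi> (?I {})"
    proof (rule inj_onI)
      fix ws ws' assume "ws \<in> ?I {}" "ws' \<in> ?I {}" "\<phi> ws = \<phi> ws'"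
      then show "ws = ws'" using item[of ws] item[of ws'] unfolding \<phi>_def by auto
    qed
    then have d: "distinct (concat (map (\<lambda>j. map \<phi> (B j)) [0..<machines A]))"
      unfolding c using dist set by (simp add: distinct_map)
    have "\<phi> ` ?I {} = ?I H"
    proof (intro equalityI subsetI)
      fix ws assume "ws \<in> \<phi> ` ?I {}"
      then obtain ws' where ws': "ws' \<in> ?I {}" "ws = \<phi> ws'" by blast
      obtain x y where "ws' = [x, y, 2]" "x < y" "y < n" using item[OF ws'(1)] by blast
      then show "ws \<in> ?I H" unfolding ws'(2) \<phi>_def metric_input_def by auto
    next
      fix ws assume "ws \<in> ?I H"
      then obtain x y where xy: "ws = [x, y, dist_of H x y]" "x < y" "y < n" unfolding metric_input_def by blast
      then have "[x, y, 2] \<in> ?I {}" unfolding metric_input_def dist_of_def by auto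
      moreover have "ws = \<phi> [x, y, 2]" unfolding \<phi>_def xy(1) by simp
      ultimately show "ws \<in> \<phi> ` ?I {}" by (rule rev_image_eqI)
    qed
    then have s: "set (concat (map (\<lambda>j. map \<phi> (B j)) [0..<machines A])) = ?I H"
      unfolding c set_map set .
    have f: "fits A (metric_state items H j)" if j: "j < machines A" for j
      unfolding fits_def
    proof
      have "length (concat (map \<phi> (B j))) = 3 * length (items j)"
        unfolding items_def by (subst len3) (auto simp: \<phi>_def)
      then show "length (metric_state items H j) \<le> local_space A" using items2[OF j] unfolding ms by simp
      show "\<forall>w\<in>set (metric_state items H j). w < word_bound A"
      proof
        fix w assume "w \<in> set (metric_state items H j)"
        then obtain x y where xy: "(x, y) \<in> set (items j)" "w = x \<or> w = y \<or> w = dist_of H x y"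
          unfolding metric_state_def by auto
        then show "w < word_bound A" using items1[OF j xy(1)] n wb unfolding dist_of_def by auto
      qed
    qed
    show ?thesis unfolding distribution_def
      by (intro exI[of _ "\<lambda>j. map \<phi> (B j)"]) (use ms f d s in blast)
  qed
  have ok: "obeys_limits A (metric_state items H) \<and> approx_mst \<epsilon> n (dist_of H) (output_tree A items H)"
    if H: "H \<subseteq> complete_edges n" for H
  proof -
    obtain T where T: "obeys_limits A (metric_state items H)"
      "outputs_edges (machines A) (memory A (metric_state items H) (rounds A)) T" "approx_mst \<epsilon> n (dist_of H) T"
      using solves[OF H] distr[of H] unfolding solves_def by blast
    have "T = output_tree A items H" unfolding output_tree_def using outputs_edges_edge_set[OF T(2)] .
    then show ?thesis using T by simp
  qed
  show ?thesis by (rule that[of items]) (use items1 items2 ok in auto)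
qed

lemma computes_approx_mst_dist_of:
  assumes comp: "computes_approx_mst P \<epsilon> n A" and P: "P \<in> {is_metric, is_one_two_metric}" and n: "3 \<le> n"
  shows "solves A (metric_input n (dist_of H)) (\<lambda>out. \<exists>T. outputs_edges (machines A) out T \<and> approx_mst \<epsilon> n (dist_of H) T)"
proof -
  have "P n (dist_of H)" using P dist_of_one_two_metric[of n H] unfolding is_one_two_metric_def by auto
  moreover have "dist_of H i j < word_bound A" for i j
    using comp n unfolding computes_approx_mst_def dist_of_def by auto
  ultimately show ?thesis using comp unfolding computes_approx_mst_def by blast
qed

lemma ex_cycle_mpc_of_approx_mst:
  fixes A :: mpc and n N k st s h :: nat and \<epsilon> :: real
  defines "L \<equiv> 2 * Suc (2 * k)"
  defines "m \<equiv> n div L" and "R \<equiv> 80 * L * n\<^sup>2" and "Q \<equiv> s ^ h"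
  assumes comp: "computes_approx_mst P \<epsilon> n A" and P: "P \<in> {is_metric, is_one_two_metric}"
    and eps: "0 \<le> \<epsilon>" "32 * \<epsilon> * real n * real L \<le> real m - 1"
    and k: "2 \<le> k" and N: "4 * N \<le> m" "0 < N" and st: "N < k ^ st" and s: "0 < s"
    and Q: "m * R * machines A * n * n \<le> Q" "R \<le> Q" "machines A \<le> Q"
  shows "\<exists>C. distinguishes_cycles N C \<and>
     machines C \<le> 2 * N + 3 * m\<^sup>2 * Q + m * R * machines A + 2 * m\<^sup>2 * R * Q + 1 \<and>
     local_space C = local_space A + s + 8 \<and> word_bound C = word_bound A + Q + 2 * N + 3 \<and>
     rounds C = 3 + st * (rounds A + 3 * h + 4)"
proof -
  have m4: "4 \<le> m" using N by simp
  have L0: "0 < L" unfolding L_def by simp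
  have mL: "m * L \<le> n" unfolding m_def by (rule div_times_less_eq_dividend)
  have "4 * 1 \<le> m * L" using m4 L0 by (intro mult_le_mono) auto
  then have n3: "3 \<le> n" and n0: "0 < n" using mL by auto
  have wb: "n \<le> word_bound A" using comp unfolding computes_approx_mst_def by simp
  obtain items where items:
    "\<And>j x y. j < machines A \<Longrightarrow> (x, y) \<in> set (items j) \<Longrightarrow> x < y \<and> y < n"
    "\<And>j. j < machines A \<Longrightarrow> 3 * length (items j) \<le> local_space A"
    "\<And>H. H \<subseteq> complete_edges n \<Longrightarrow> obeys_limits A (metric_state items H)"
    and mst: "\<And>H. H \<subseteq> complete_edges n \<Longrightarrow> approx_mst \<epsilon> n (dist_of H) (output_tree A items H)"
    using metric_input_dist_of[OF n3 computes_approx_mst_dist_of[OF comp P n3] wb] by blast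
  interpret at: approx_tree n m L "2 * k" "output_tree A items" \<epsilon>
  proof
    show "3 \<le> L" "Suc (2 * k) < L" unfolding L_def using k by auto
    show "m * L \<le> n" by (rule mL)
    fix H assume H: "H \<subseteq> complete_edges n"
    show "acyclic_edges (output_tree A items H)"
      using mst[OF H] unfolding approx_mst_def spanning_tree_alt by blast
    show "real (card (H - output_tree A items H)) \<le>
        real (card H) + real (card (roots n H)) - real n + 2 * \<epsilon> * real n"
      by (rule approx_mst_dropped[OF mst[OF H] H n0 eps(1)])
  qed (use eps m4 in auto)
  obtain \<sigma> where \<sigma>: "\<forall>i<R. \<sigma> i permutes {..<n}"
    and cnt: "\<forall>f a b. (\<forall>c<2 * k. f c permutes {..<m}) \<longrightarrow> a < m \<longrightarrow> b < m \<longrightarrow>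
        20 * n\<^sup>2 \<le> card {i. i < R \<and>
            \<sigma> i ` comp_edge L a (L - 1) \<notin> output_tree A items (relabel (\<sigma> i) (word_graph m L (2 * k) f b))}
        \<longleftrightarrow> word_perm f (2 * k) a = b"
    using at.ex_relabellings_word[OF L_def[THEN meta_eq_to_obj_eq]] unfolding R_def by (elim exE conjE)
  \<comment> \<open>All lookups of bits: a block together with an ordered pair of points.\<close>
  let ?Z = "{..<m} \<times> {..<R} \<times> {..<machines A} \<times> {..<n} \<times> {..<n}"
  have "finite ?Z" by simp
  then obtain tc where tc: "bij_betw tc ?Z {0..<card ?Z}" using ex_bij_betw_finite_nat by blast
  have cZ: "card ?Z \<le> Q" using Q(1) by (simp add: card_cartesian_product mult.assoc)
  interpret ca: cycle_algorithm n m L "2 * k" A N R s h Q "local_space A + s + 8"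
    "word_bound A + Q + 2 * N + 3" items \<sigma> tc k st "20 * n\<^sup>2"
  proof
    show "L = 2 * Suc (2 * k)" unfolding L_def ..
    show "inj_on tc ?Z" using tc unfolding bij_betw_def by blast
    show "tc z < Q" if "z \<in> ?Z" for z using bij_betwE[OF tc] that cZ by (meson atLeastLessThan_iff order_less_le_trans)
    show "Q = s ^ h" unfolding Q_def ..
    show "0 < R" unfolding R_def using L0 n0 by simp
    show "0 < m" using m4 by simp
  qed (use items \<sigma> Q s wb N k st cnt in auto)
  show ?thesis using ca.ex_cycle_mpc ca.card_X by metis
qed

text \<open>Two triples \<open>x y 1 x' y' 1\<close> are read as the pairs \<open>(x, y)\<close>,
  \<open>(1, x')\<close>, \<open>(y', 1)\<close>, so the first of the two items survives as a pair.
  A last single triple cannot occur, as it would leave a word without partner.\<close>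

lemma pairs_concat_triples:
  assumes "\<And>ws. ws \<in> set bs \<Longrightarrow> \<exists>x y. ws = [x, y, 1 :: nat]"
    "concat bs = concat (map (\<lambda>(u, v). [u, v]) es)" "distinct bs"
  shows "\<exists>J\<subseteq>set bs. length bs \<le> 2 * card J \<and> (\<forall>ws\<in>J. (ws ! 0, ws ! 1) \<in> set es)"
  using assms
proof (induction "length bs" arbitrary: bs es rule: less_induct)
  case less
  show ?case
  proof (cases bs)
    case Nil
    then show ?thesis by auto
  next
    case (Cons b1 bs1)
    obtain x y where b1: "b1 = [x, y, 1]" using less.prems(1)[of b1] Cons by auto
    have "es \<noteq> []" using less.prems(2) Cons b1 by auto
    then obtain p es1 where es: "es = p # es1" by (cases es) auto
    have p: "p = (x, y)" using less.prems(2) unfolding Cons b1 es by (cases p) auto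
    have eq: "1 # concat bs1 = concat (map (\<lambda>(u, v). [u, v]) es1)"
      using less.prems(2) unfolding Cons b1 es p by simp
    then obtain q es2 where es1: "es1 = q # es2" by (cases es1) auto
    obtain v where q: "q = (1, v)" using eq unfolding es1 by (cases q) auto
    have eq2: "concat bs1 = v # concat (map (\<lambda>(u, v). [u, v]) es2)" using eq unfolding es1 q by simp
    then obtain b2 bs2 where bs1: "bs1 = b2 # bs2" by (cases bs1) auto
    obtain x' y' where b2: "b2 = [x', y', 1]" using less.prems(1)[of b2] Cons bs1 by auto
    have eq3: "y' # 1 # concat bs2 = concat (map (\<lambda>(u, v). [u, v]) es2)" using eq2 unfolding bs1 b2 by simp
    then obtain r es3 where es2: "es2 = r # es3" by (cases es2) auto
    have eq4: "concat bs2 = concat (map (\<lambda>(u, v). [u, v]) es3)" using eq3 unfolding es2 by (cases r) auto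
    have "\<exists>J\<subseteq>set bs2. length bs2 \<le> 2 * card J \<and> (\<forall>ws\<in>J. (ws ! 0, ws ! 1) \<in> set es3)"
      using less.prems Cons bs1 by (intro less.hyps eq4) auto
    then obtain J where J: "J \<subseteq> set bs2" "length bs2 \<le> 2 * card J" "\<forall>ws\<in>J. (ws ! 0, ws ! 1) \<in> set es3" by blast
    have "b1 \<notin> J" using less.prems(3) J(1) unfolding Cons bs1 by auto
    moreover have "finite J" using J(1) finite_subset by blast
    ultimately have "length bs \<le> 2 * card (insert b1 J)" using J(2) unfolding Cons bs1 by simp
    moreover have "\<forall>ws\<in>insert b1 J. (ws ! 0, ws ! 1) \<in> set es" using J(3) unfolding b1 es p es1 es2 by auto
    moreover have "insert b1 J \<subseteq> set bs" using J(1) unfolding Cons bs1 by auto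
    ultimately show ?thesis by blast
  qed
qed

text \<open>
  Without communication the output is the input, read as pairs of words.  On every machine every
  second item \<open>[x, y, 1]\<close> then becomes the edge \<open>{x, y}\<close>, which is too many for a tree.
\<close>

lemma rounds_pos:
  assumes comp: "computes_approx_mst P \<epsilon> n A" and P: "P \<in> {is_metric, is_one_two_metric}" and n: "5 \<le> n"
  shows "0 < rounds A"
proof (rule ccontr)
  assume "\<not> 0 < rounds A"
  then have r0: "rounds A = 0" by simp
  let ?H = "complete_edges n"
  let ?I = "metric_input n (dist_of ?H)"
  have n3: "3 \<le> n" using n by simp
  obtain m0 T where m0: "distribution A ?I m0" and out: "outputs_edges (machines A) m0 T"
    and mst: "approx_mst \<epsilon> n (dist_of ?H) T"
    using computes_approx_mst_dist_of[OF comp P n3, of ?H] unfolding solves_def r0 by auto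
  obtain B where B: "\<And>j. j < machines A \<Longrightarrow> m0 j = concat (B j)"
    and dist: "distinct (concat (map B [0..<machines A]))"
    and set: "set (concat (map B [0..<machines A])) = ?I"
    using m0 unfolding distribution_def by blast
  obtain es where es: "\<And>j. j < machines A \<Longrightarrow> m0 j = concat (map (\<lambda>(u, v). [u, v]) (es j))"
    and T: "T = (\<Union>j<machines A. {{u, v} | u v. (u, v) \<in> set (es j)})"
    using out unfolding outputs_edges_def by blast
  have item: "\<exists>x y. ws = [x, y, 1] \<and> x < y \<and> y < n" if ws: "ws \<in> ?I" for ws
  proof -
    obtain x y where xy: "ws = [x, y, dist_of ?H x y]" "x < y" "y < n" using ws unfolding metric_input_def by blast
    have "{x, y} \<in> ?H" unfolding complete_edges_def using xy by (intro CollectI exI[of _ x] exI[of _ y]) auto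
    then show ?thesis using xy unfolding dist_of_def by auto
  qed
  have sub: "set (B j) \<subseteq> ?I" if "j < machines A" for j using set that by auto
  have "\<exists>J\<subseteq>set (B j). length (B j) \<le> 2 * card J \<and> (\<forall>ws\<in>J. (ws ! 0, ws ! 1) \<in> set (es j))"
    if j: "j < machines A" for j
  proof (rule pairs_concat_triples)
    show "concat (B j) = concat (map (\<lambda>(u, v). [u, v]) (es j))" using B[OF j] es[OF j] by simp
    show "distinct (B j)" using distinct_concat_map_upt(1)[OF dist j] .
    show "\<exists>x y. ws = [x, y, 1]" if "ws \<in> set (B j)" for ws using item sub[OF j] that by blast
  qed
  then obtain J where J: "\<And>j. j < machines A \<Longrightarrow> J j \<subseteq> set (B j)"
    "\<And>j. j < machines A \<Longrightarrow> length (B j) \<le> 2 * card (J j)"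
    "\<And>j ws. j < machines A \<Longrightarrow> ws \<in> J j \<Longrightarrow> (ws ! 0, ws ! 1) \<in> set (es j)"
    by metis
  let ?J = "\<Union>j<machines A. J j"
  have TT: "spanning_tree n T" using mst unfolding approx_mst_def by blast
  have finT: "finite T" using TT finite_subset[OF _ finite_complete_edges] unfolding spanning_tree_alt by blast
  let ?f = "\<lambda>ws :: nat list. {ws ! 0, ws ! 1}"
  have JI: "?J \<subseteq> ?I" using J(1) sub by blast
  have "inj_on ?f ?I"
  proof (rule inj_onI)
    fix ws ws' assume "ws \<in> ?I" "ws' \<in> ?I" "?f ws = ?f ws'"
    then show "ws = ws'" using item[of ws] item[of ws'] by (auto simp: doubleton_eq_iff)
  qed
  then have inj: "inj_on ?f ?J" using JI by (rule inj_on_subset)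
  have "?f ` ?J \<subseteq> T" unfolding T using J(3) by blast
  then have "card ?J \<le> card T" using card_inj_on_le[OF inj _ finT] by blast
  moreover have "card T = n - 1" using spanning_tree_card[OF TT] n by simp
  moreover have "card ?J = (\<Sum>j<machines A. card (J j))"
  proof (rule card_UN_disjoint)
    show "\<forall>j\<in>{..<machines A}. finite (J j)" using J(1) finite_subset by blast
    show "\<forall>j\<in>{..<machines A}. \<forall>j'\<in>{..<machines A}. j \<noteq> j' \<longrightarrow> J j \<inter> J j' = {}"
      using J(1) distinct_concat_map_upt(2)[OF dist] by blast
  qed simp
  moreover have "card ?I \<le> 2 * (\<Sum>j<machines A. card (J j))"
  proof -
    have "card ?I = length (concat (map B [0..<machines A]))" using distinct_card[OF dist] set by simp
    also have "\<dots> = (\<Sum>j<machines A. length (B j))" by (rule length_concat_upt)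
    also have "\<dots> \<le> (\<Sum>j<machines A. 2 * card (J j))" using J(2) by (intro sum_mono) auto
    finally show ?thesis by (simp add: sum_distrib_left)
  qed
  moreover have "2 * (n - 1) < card ?I"
  proof -
    let ?g = "\<lambda>(i, j). [i, j, dist_of ?H i j]"
    \<comment> \<open>The pairs with smaller point 0, 1 or 2. Their number \<open>3 * n - 6\<close>
      exceeds \<open>2 * (n - 1)\<close> from \<open>n = 5\<close> on.\<close>
    let ?Z = "Pair (0 :: nat) ` {1..<n} \<union> Pair 1 ` {2..<n} \<union> Pair 2 ` {3..<n}"
    have "?I \<subseteq> (\<lambda>(i, j). [i, j, dist_of ?H i j]) ` ({..<n} \<times> {..<n})" unfolding metric_input_def by auto
    then have finI: "finite ?I" using finite_subset by blast
    have "card ?Z = (n - 1) + (n - 2) + (n - 3)"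
    proof -
      have "card (Pair (0 :: nat) ` {1..<n} \<union> Pair 1 ` {2..<n}) = (n - 1) + (n - 2)"
        by (subst card_Un_disjoint) (auto simp: card_image inj_on_def)
      then show ?thesis by (subst card_Un_disjoint) (auto simp: card_image inj_on_def)
    qed
    moreover have "card ?Z = card (?g ` ?Z)" by (rule card_image[symmetric]) (auto simp: inj_on_def)
    moreover have "?g ` ?Z \<subseteq> ?I" unfolding metric_input_def by auto
    then have "card (?g ` ?Z) \<le> card ?I" using finI card_mono by blast
    ultimately show ?thesis using n by linarith
  qed
  ultimately show False by linarith
qed

section \<open>Parameters and asymptotics\<close>

text \<open>Some machine has to hold an item. This turns the bound on total space into one on the
  number of machines.\<close>

lemma local_space_pos:
  assumes comp: "computes_approx_mst P \<epsilon> n A" and P: "P \<in> {is_metric, is_one_two_metric}" and n: "3 \<le> n"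
  shows "0 < local_space A"
proof -
  obtain m0 where "distribution A (metric_input n (dist_of {})) m0"
    using computes_approx_mst_dist_of[OF comp P n, of "{}"] unfolding solves_def by blast
  then obtain B where B: "\<forall>j<machines A. m0 j = concat (B j) \<and> fits A (m0 j)"
    and set: "set (concat (map B [0..<machines A])) = metric_input n (dist_of {})"
    unfolding distribution_def by blast
  have "[0, 1, dist_of {} 0 1] \<in> metric_input n (dist_of {})"
    unfolding metric_input_def using n by force
  then obtain j where j: "j < machines A" "[0, 1, dist_of {} 0 1] \<in> set (B j)"
    unfolding set[symmetric] by auto
  then have "m0 j \<noteq> []" using B by fastforce
  then show ?thesis using B j(1) unfolding fits_def by (metis gr0I le_zero_eq length_0_conv)
qed

lemma floor_powr_bounds:
  fixes x :: real
  assumes "0 \<le> x"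
  shows "real (nat \<lfloor>x\<rfloor>) \<le> x" "x - 1 < real (nat \<lfloor>x\<rfloor>)"
  using assms by linarith+

text \<open>With \<open>x = n powr \<beta>\<close> and \<open>y = n powr (1 - 2 * \<beta>)\<close>
  one has \<open>n = y * x * x\<close>, and \<open>N\<close> is about \<open>y\<close>. One factor
  \<open>x\<close> pays for the component length \<open>L\<close>, since \<open>k \<le> x\<close>;
  the other, at least 100, pays for the constants in \<open>4 * N \<le> m\<close>.\<close>

lemma ex_fast_cycle_mpc:
  fixes A :: mpc and n N k k1 k2 h :: nat and \<epsilon> \<delta> \<beta> :: real
  assumes comp: "computes_approx_mst P \<epsilon> n A" and P: "P \<in> {is_metric, is_one_two_metric}"
    and \<delta>: "0 < \<delta>" "\<delta> \<le> 1 / 2" and \<beta>: "\<beta> = \<delta> / 8"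
    and eps: "1 / real n \<le> \<epsilon>" "\<epsilon> \<le> 1"
    and space: "real (local_space A) \<le> real n powr (1 - \<delta>)"
    and total: "machines A * local_space A \<le> n ^ k1" and words: "word_bound A \<le> n ^ k2"
    and large: "100 \<le> real n powr \<beta>" and N: "N = nat \<lfloor>real n powr (1 - 2 * \<beta>)\<rfloor>"
    and k: "k = nat \<lfloor>(1 / \<epsilon>) powr \<beta>\<rfloor>" "40 \<le> k" and h: "h = 2 * (k1 + 8)"
  shows "\<exists>C. distinguishes_cycles N C \<and> machines C \<le> N ^ (2 * (h + k1 + 12)) \<and>
     real (local_space C) \<le> real N powr (1 - \<delta> / 4) \<and> word_bound C \<le> N ^ (2 * (h + k2 + 2)) \<and>
     real (rounds C) \<le> 3 + (ln (real N) / ln (real k) + 1) * (real (rounds A) + 3 * real h + 4)"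
    and "n \<le> N ^ 2"
proof -
  have \<beta>0: "0 < \<beta>" "\<beta> \<le> 1 / 16" using \<delta> \<beta> by auto
  have n0: "0 < n" using large by (cases "n = 0") auto
  have n1: "1 \<le> real n" using n0 by simp
  have pw: "real n powr a \<le> real n powr b" if "a \<le> b" for a b using that n1 by (intro powr_mono)
  define x y where "x = real n powr \<beta>" and "y = real n powr (1 - 2 * \<beta>)"
  have x: "100 \<le> x" unfolding x_def by (rule large)
  have "x \<le> y" unfolding x_def y_def using \<beta>0 by (intro pw) simp
  then have y: "100 \<le> y" using x by simp
  have nyx: "real n = y * x * x" unfolding x_def y_def using n0 by (simp flip: powr_add)
  have xn: "x \<le> real n" unfolding x_def using pw[of \<beta> 1] \<beta>0 n0 by simp
  then have n100: "100 \<le> real n" using x by simp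
  have Ny: "real N \<le> y" "y - 1 < real N"
    unfolding N y_def by (rule floor_powr_bounds, simp)+
  have N0: "0 < N" using Ny y by linarith
  have yx: "real n powr (1 - 3 * \<beta>) = y / x"
    unfolding x_def y_def using n0 by (simp flip: powr_diff)
  have "y / x \<le> y / 100" using x y by (intro divide_left_mono) auto
  then have Nlow: "real n powr (1 - 3 * \<beta>) \<le> real N" unfolding yx using Ny(2) y by linarith
  show nN: "n \<le> N ^ 2"
  proof -
    have "real n powr (1 / 2) \<le> real n powr (1 - 3 * \<beta>)" using \<beta>0 by (intro pw) simp
    then have "real n powr (1 / 2) \<le> real N" using Nlow by simp
    then have "(real n powr (1 / 2)) ^ 2 \<le> real N ^ 2" by (intro power_mono) auto
    then have "real n \<le> real (N ^ 2)" using n0 by (simp add: powr_half_sqrt)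
    then show ?thesis by (rule of_nat_le_iff[THEN iffD1])
  qed
  have eps0: "0 < \<epsilon>" using eps(1) n0 by (meson divide_pos_pos less_le_trans of_nat_0_less_iff zero_less_one)
  have e1: "1 \<le> 1 / \<epsilon>" using eps(2) eps0 by simp
  have en: "1 / \<epsilon> \<le> real n" using eps(1) eps0 n0 by (simp add: field_simps)
  have kle: "real k \<le> (1 / \<epsilon>) powr \<beta>" unfolding k(1) by (rule floor_powr_bounds) simp
  also have "\<dots> \<le> x" unfolding x_def using en eps0 \<beta>0 by (intro powr_mono2) auto
  finally have kx: "real k \<le> x" .
  \<comment> \<open>This holds as \<open>4 * \<beta> \<le> 1\<close>. With \<open>40 \<le> k\<close>
    it gives \<open>\<epsilon> * k^2 \<le> 1 / 1600\<close>.\<close>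
  have k4: "\<epsilon> * real k ^ 4 \<le> 1"
  proof -
    have "real k ^ 4 \<le> ((1 / \<epsilon>) powr \<beta>) ^ 4" using kle by (intro power_mono) auto
    also have "\<dots> = (1 / \<epsilon>) powr (4 * \<beta>)" using eps0 by (simp add: powr_power mult.commute)
    also have "\<dots> \<le> (1 / \<epsilon>) powr 1" using e1 \<beta>0 by (intro powr_mono) auto
    also have "\<dots> = 1 / \<epsilon>" using eps0 by simp
    finally show ?thesis using eps0 by (simp add: field_simps)
  qed
  define L m where "L = 2 * Suc (2 * k)" and "m = n div L"
  have L0: "0 < L" unfolding L_def by simp
  have L5: "real L \<le> 5 * real k" unfolding L_def using k(2) by simp
  have "real n / real L < real m + 1"
  proof -
    have "n < (m + 1) * L" unfolding m_def using dividend_less_div_times[OF L0, of n] by simp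
    then have "real n < (real m + 1) * real L" by (metis of_nat_1 of_nat_add of_nat_less_iff of_nat_mult)
    then show ?thesis using L0 by (simp add: field_simps)
  qed
  then have mlow: "real n / real L - 1 < real m" by simp
  have nL: "y * x / 5 \<le> real n / real L"
  proof -
    have "y * x / 5 * real L \<le> y * x / 5 * (5 * x)" using L5 kx x y by (intro mult_left_mono) auto
    also have "\<dots> = real n" unfolding nyx by simp
    finally show ?thesis using L0 by (simp add: field_simps)
  qed
  have "y * 100 \<le> y * x" using x y by (intro mult_left_mono) auto
  then have "20 * y \<le> y * x / 5" by simp
  then have yx20: "20 * y \<le> real n / real L" using nL by (rule order_trans)
  have "4 * real N \<le> real m" using yx20 mlow Ny(1) y by linarith
  then have N4: "4 * N \<le> m" by linarith
  \<comment> \<open>The left side is \<open>32 * \<epsilon> * L^2\<close> times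
    \<open>n / L\<close>. By \<open>L \<le> 5 * k\<close> the first factor is at most
    \<open>32 * 25 / 1600 = 1 / 2\<close>, and half of \<open>n / L\<close> is below
    \<open>m - 1\<close>.\<close>
  have eps2: "32 * \<epsilon> * real n * real L \<le> real m - 1"
  proof -
    have "\<epsilon> * real L ^ 2 \<le> \<epsilon> * (5 * real k) ^ 2" using L5 eps0 by (intro mult_left_mono power_mono) auto
    also have "\<dots> = 25 * (\<epsilon> * real k ^ 2)" by (simp add: power2_eq_square)
    finally have 1: "\<epsilon> * real L ^ 2 \<le> 25 * (\<epsilon> * real k ^ 2)" .
    have "1600 \<le> real k ^ 2" using power_mono[of 40 "real k" 2] k(2) by simp
    then have "(\<epsilon> * real k ^ 2) * 1600 \<le> (\<epsilon> * real k ^ 2) * real k ^ 2" using eps0 by (intro mult_left_mono) auto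
    also have "\<dots> = \<epsilon> * real k ^ 4" by (simp add: power2_eq_square power4_eq_xxxx)
    finally have "(\<epsilon> * real k ^ 2) * 1600 \<le> 1" using k4 by simp
    then have 2: "32 * (\<epsilon> * real L ^ 2) \<le> 1 / 2" using 1 by simp
    have "32 * \<epsilon> * real n * real L = 32 * (\<epsilon> * real L ^ 2) * (real n / real L)"
      using L0 by (simp add: power2_eq_square)
    also have "\<dots> \<le> 1 / 2 * (real n / real L)" using 2 by (intro mult_right_mono) auto
    also have "\<dots> \<le> real m - 1" using mlow yx20 y by linarith
    finally show ?thesis .
  qed
  \<comment> \<open>The arity of the trees is as large as the space allows. By
    \<open>\<delta> \<le> 1 / 2\<close> it satisfies \<open>n \<le> s^2\<close>, so the constant
    height \<open>h = 2 * (k1 + 8)\<close> suffices for \<open>n ^ (k1 + 8)\<close> copies.\<close>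
  define s where "s = nat \<lceil>real n powr (1 - \<delta>)\<rceil>"
  have slow: "real n powr (1 - \<delta>) \<le> real s" unfolding s_def by linarith
  have shigh: "real s \<le> real n powr (1 - \<delta>) + 1"
    unfolding s_def using powr_ge_zero[of "real n" "1 - \<delta>"] by linarith
  have "1 \<le> real n powr (1 - \<delta>)" using n1 \<delta> by (simp add: ge_one_powr_ge_zero)
  then have s0: "0 < s" using slow by linarith
  have sn: "s \<le> n"
  proof -
    have "real n powr (1 - \<delta>) \<le> real n" using pw[of "1 - \<delta>" 1] \<delta> n0 by simp
    then have "\<lceil>real n powr (1 - \<delta>)\<rceil> \<le> int n" by (simp add: ceiling_le_iff)
    then show ?thesis unfolding s_def by (simp only: nat_le_iff)
  qed
  have ns: "n \<le> s ^ 2"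
  proof -
    have "real n powr (1 / 2) \<le> real n powr (1 - \<delta>)" using \<delta> by (intro pw) simp
    then have "real n powr (1 / 2) \<le> real s" using slow by simp
    then have "(real n powr (1 / 2)) ^ 2 \<le> real s ^ 2" by (intro power_mono) auto
    then have "real n \<le> real (s ^ 2)" using n0 by (simp add: powr_half_sqrt)
    then show ?thesis by (rule of_nat_le_iff[THEN iffD1])
  qed
  define R Q where "R = 80 * L * n\<^sup>2" and "Q = s ^ h"
  have n100': "100 \<le> n" using n100 by simp
  have Ln: "L \<le> n"
  proof -
    have "real L \<le> 5 * x" using L5 kx by simp
    also have "\<dots> \<le> y * x * x" using x y mult_mono[of 5 y x "x * x"] mult_mono[of 1 x x x] by (simp add: mult.assoc)
    finally show ?thesis unfolding nyx[symmetric] by simp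
  qed
  have mn: "m \<le> n" unfolding m_def by simp
  have Rn: "R \<le> n ^ 4"
  proof -
    have "R \<le> n * n * n\<^sup>2" unfolding R_def using Ln n100' by (intro mult_le_mono) auto
    also have "\<dots> = n ^ 4" by (simp add: power2_eq_square power4_eq_xxxx)
    finally show ?thesis .
  qed
  have pn: "machines A \<le> n ^ k1"
  proof -
    have "0 < local_space A" using local_space_pos[OF comp P] n100' by simp
    then have "machines A * 1 \<le> machines A * local_space A" by (intro mult_le_mono2) simp
    then have "machines A \<le> machines A * local_space A" by (simp only: mult_1_right)
    then show ?thesis using total by (rule order_trans)
  qed
  have nQ: "n ^ (k1 + 8) \<le> Q"
  proof -
    have "n ^ (k1 + 8) \<le> (s ^ 2) ^ (k1 + 8)" using ns by (rule power_mono) simp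
    then show ?thesis unfolding Q_def h power_mult .
  qed
  have Qn: "Q \<le> n ^ h" unfolding Q_def using sn by (intro power_mono) auto
  have np: "n ^ a \<le> n ^ b" if "a \<le> b" for a b using that n0 by (intro power_increasing) auto
  have Q1: "m * R * machines A * n * n \<le> Q"
  proof -
    have "m * R * machines A * n * n \<le> n * n ^ 4 * n ^ k1 * n * n" using mn Rn pn by (intro mult_le_mono) auto
    also have "\<dots> = n ^ (k1 + 7)" by (simp add: power_add eval_nat_numeral)
    also have "\<dots> \<le> n ^ (k1 + 8)" by (intro np) simp
    finally show ?thesis using nQ by simp
  qed
  have Q2: "R \<le> Q" using Rn np[of 4 "k1 + 8"] nQ by linarith
  have Q3: "machines A \<le> Q" using pn np[of k1 "k1 + 8"] nQ by linarith
  define st where "st = nat \<lfloor>ln (real N) / ln (real k)\<rfloor> + 1"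
  have lnk: "0 < ln (real k)" using k(2) by simp
  have lnN: "0 \<le> ln (real N)" using N0 by simp
  have st: "N < k ^ st"
  proof -
    have "ln (real N) / ln (real k) < real st" unfolding st_def by linarith
    then have "ln (real N) < real st * ln (real k)" using lnk by (simp add: field_simps)
    also have "\<dots> = ln (real k ^ st)" using k(2) by (simp add: ln_realpow)
    finally have "real N < real k ^ st" using N0 k(2) by simp
    then show ?thesis using of_nat_less_iff[of N "k ^ st", where 'a = real] by simp
  qed
  have stle: "real st \<le> ln (real N) / ln (real k) + 1"
    unfolding st_def using lnk lnN by (simp add: floor_powr_bounds)
  obtain C where C: "distinguishes_cycles N C"
     "machines C \<le> 2 * N + 3 * m\<^sup>2 * Q + m * R * machines A + 2 * m\<^sup>2 * R * Q + 1"
     "local_space C = local_space A + s + 8" "word_bound C = word_bound A + Q + 2 * N + 3"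
     "rounds C = 3 + st * (rounds A + 3 * h + 4)"
    using ex_cycle_mpc_of_approx_mst[OF comp P less_imp_le[OF eps0], of k N st s h,
        folded L_def, folded m_def R_def Q_def, OF eps2 _ N4 N0 st s0 Q1 Q2 Q3] k(2) by auto
  have Nn: "N \<le> n" using N4 mn by linarith
  \<comment> \<open>Polynomial bounds in \<open>n\<close> become polynomial bounds in
    \<open>N\<close>.\<close>
  have nNp: "n ^ a \<le> N ^ (2 * a)" for a
    unfolding power_mult using nN by (intro power_mono) auto
  have "machines C \<le> N ^ (2 * (h + k1 + 12))"
  proof -
    have m2: "m\<^sup>2 \<le> n ^ 2" using mn by (intro power_mono) auto
    have a: "2 * N \<le> n ^ (h + 10)"
    proof -
      have "2 * N \<le> n * n" using Nn n100' by (intro mult_le_mono) auto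
      also have "\<dots> = n ^ 2" by (simp add: power2_eq_square)
      also have "\<dots> \<le> n ^ (h + 10)" by (intro np) simp
      finally show ?thesis .
    qed
    have b: "3 * m\<^sup>2 * Q \<le> n ^ (h + 10)"
    proof -
      have "3 * m\<^sup>2 * Q \<le> n * n ^ 2 * n ^ h" using m2 Qn n100' by (intro mult_le_mono) auto
      also have "\<dots> = n ^ (h + 3)" by (simp add: power_add eval_nat_numeral)
      also have "\<dots> \<le> n ^ (h + 10)" by (intro np) simp
      finally show ?thesis .
    qed
    have c: "m * R * machines A \<le> n ^ (k1 + 5)"
    proof -
      have "m * R * machines A \<le> n * n ^ 4 * n ^ k1" using mn Rn pn by (intro mult_le_mono) auto
      also have "\<dots> = n ^ (k1 + 5)" by (simp add: power_add eval_nat_numeral)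
      finally show ?thesis .
    qed
    have d: "2 * m\<^sup>2 * R * Q \<le> n ^ (h + 10)"
    proof -
      have "2 * m\<^sup>2 * R * Q \<le> n * n ^ 2 * n ^ 4 * n ^ h" using m2 Rn Qn n100' by (intro mult_le_mono) auto
      also have "\<dots> = n ^ (h + 7)" by (simp add: power_add eval_nat_numeral)
      also have "\<dots> \<le> n ^ (h + 10)" by (intro np) simp
      finally show ?thesis .
    qed
    have e: "n ^ (h + 10) \<le> n ^ (h + k1 + 11)" "n ^ (k1 + 5) \<le> n ^ (h + k1 + 11)" "1 \<le> n ^ (h + k1 + 11)"
      using np[of 0 "h + k1 + 11"] by (auto intro: np)
    have "machines C \<le> 100 * n ^ (h + k1 + 11)" using C(2) a b c d e by linarith
    also have "\<dots> \<le> n * n ^ (h + k1 + 11)" using n100' by (intro mult_le_mono1)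
    also have "\<dots> = n ^ (h + k1 + 12)" by (simp add: power_add eval_nat_numeral)
    also have "\<dots> \<le> N ^ (2 * (h + k1 + 12))" by (rule nNp)
    finally show ?thesis .
  qed
  moreover have "word_bound C \<le> N ^ (2 * (h + k2 + 2))"
  proof -
    have "n ^ k2 \<le> n ^ (h + k2 + 1)" "n ^ h \<le> n ^ (h + k2 + 1)" "n ^ 1 \<le> n ^ (h + k2 + 1)" "n ^ 0 \<le> n ^ (h + k2 + 1)"
      by (rule np, simp)+
    then have "word_bound C \<le> 100 * n ^ (h + k2 + 1)"
      using C(4) words Qn Nn unfolding power_one_right power_0 by linarith
    also have "\<dots> \<le> n * n ^ (h + k2 + 1)" using n100' by (intro mult_le_mono1)
    also have "\<dots> = n ^ (h + k2 + 2)" by (simp add: power_add eval_nat_numeral)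
    also have "\<dots> \<le> N ^ (2 * (h + k2 + 2))" by (rule nNp)
    finally show ?thesis .
  qed
  moreover have "real (local_space C) \<le> real N powr (1 - \<delta> / 4)"
  proof -
    \<comment> \<open>Two summands \<open>n powr (1 - \<delta>)\<close> and the constant
      \<open>1 + 8\<close>. The factor 11 is absorbed by \<open>x\<close>; the exponent
      \<open>1 - 7 * \<delta> / 8\<close> reached then leaves room for the passage from
      \<open>n\<close> to \<open>N\<close>.\<close>
    have "real (local_space C) \<le> 11 * real n powr (1 - \<delta>)"
      unfolding C(3) using space shigh \<open>1 \<le> real n powr (1 - \<delta>)\<close> by simp
    also have "\<dots> \<le> x * real n powr (1 - \<delta>)" using x by (intro mult_right_mono) auto
    also have "\<dots> = real n powr (\<beta> + (1 - \<delta>))" unfolding x_def by (simp add: powr_add)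
    also have "\<dots> \<le> real n powr ((1 - 3 * \<beta>) * (1 - \<delta> / 4))"
    proof (rule pw)
      have "(1 - 3 * \<beta>) * (1 - \<delta> / 4) = 1 - 5 * \<delta> / 8 + 3 * \<delta>\<^sup>2 / 32"
        unfolding \<beta> by (simp add: field_simps power2_eq_square)
      moreover have "0 \<le> 3 * \<delta>\<^sup>2 / 32" by simp
      moreover have "\<beta> + (1 - \<delta>) \<le> 1 - 5 * \<delta> / 8" unfolding \<beta> using \<delta> by simp
      ultimately show "\<beta> + (1 - \<delta>) \<le> (1 - 3 * \<beta>) * (1 - \<delta> / 4)" by linarith
    qed
    also have "\<dots> = (real n powr (1 - 3 * \<beta>)) powr (1 - \<delta> / 4)" by (simp add: powr_powr)
    also have "\<dots> \<le> real N powr (1 - \<delta> / 4)" using Nlow \<delta> by (intro powr_mono2) auto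
    finally show ?thesis .
  qed
  moreover have "real (rounds C) \<le> 3 + (ln (real N) / ln (real k) + 1) * (real (rounds A) + 3 * real h + 4)"
    unfolding C(5) using mult_right_mono[OF stle, of "real (rounds A) + 3 * real h + 4"] by simp
  ultimately show "\<exists>C. distinguishes_cycles N C \<and> machines C \<le> N ^ (2 * (h + k1 + 12)) \<and>
     real (local_space C) \<le> real N powr (1 - \<delta> / 4) \<and> word_bound C \<le> N ^ (2 * (h + k2 + 2)) \<and>
     real (rounds C) \<le> 3 + (ln (real N) / ln (real k) + 1) * (real (rounds A) + 3 * real h + 4)"
    using C(1) by blast
qed

text \<open>There are about \<open>lN / lk\<close> stages of at most
  \<open>2 * c * \<Lambda>\<close> rounds, and \<open>lk\<close> is at least of order
  \<open>\<Lambda>\<close>, so \<open>\<Lambda>\<close> cancels. The remaining terms are multiples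
  of \<open>c * \<Lambda>\<close>, hence of \<open>c * lN\<close>.\<close>

lemma rounds_bound:
  fixes \<beta> c \<Lambda> lk lN r H :: real
  assumes "0 < \<beta>" "0 < c" "0 \<le> r" "0 \<le> H" and \<Lambda>: "6 \<le> c * \<Lambda>" "\<Lambda> \<le> 2 * lN"
    and lk: "\<beta> / 2 * \<Lambda> \<le> lk" and r: "r \<le> c * \<Lambda>" "H \<le> c * \<Lambda>"
  shows "3 + (lN / lk + 1) * (r + H) \<le> (4 / \<beta> + 5) * c * lN"
proof -
  have "0 < c * \<Lambda>" using \<Lambda>(1) by simp
  then have \<Lambda>0: "0 < \<Lambda>" using assms(2) zero_less_mult_pos by blast
  have lN0: "0 < lN" using \<Lambda>(2) \<Lambda>0 by simp
  have b0: "0 < \<beta> / 2 * \<Lambda>" using assms(1) \<Lambda>0 by simp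
  have "lN / lk \<le> lN / (\<beta> / 2 * \<Lambda>)" using lk b0 lN0 by (intro divide_left_mono) auto
  moreover have "0 < lk" using lk b0 by simp
  then have "0 \<le> lN / lk" using lN0 by simp
  ultimately have "(lN / lk) * (r + H) \<le> (lN / (\<beta> / 2 * \<Lambda>)) * (2 * c * \<Lambda>)"
    using r assms(3,4) by (intro mult_mono) auto
  also have "\<dots> = 4 / \<beta> * c * lN" using \<Lambda>0 assms(1) by (simp add: field_simps)
  finally have 1: "(lN / lk) * (r + H) \<le> 4 / \<beta> * c * lN" .
  have 2: "c * \<Lambda> \<le> c * (2 * lN)" using \<Lambda>(2) assms(2) by (intro mult_left_mono) auto
  have "3 + (lN / lk + 1) * (r + H) = 3 + (lN / lk) * (r + H) + (r + H)" by (simp add: algebra_simps)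
  also have "\<dots> \<le> c * lN + 4 / \<beta> * c * lN + 4 * (c * lN)" using 1 2 r \<Lambda>(1) by linarith
  also have "\<dots> = (4 / \<beta> + 5) * c * lN" by (simp add: algebra_simps)
  finally show ?thesis .
qed

section \<open>Passing from numbers of points to lengths of cycles\<close>

definition size_map :: "real \<Rightarrow> nat \<Rightarrow> nat" where
  "size_map \<gamma> n = nat \<lfloor>real n powr \<gamma>\<rfloor>"

lemma size_map_le:
  assumes "0 < \<gamma>" "\<gamma> \<le> 1"
  shows "size_map \<gamma> n \<le> n"
proof (cases "n = 0")
  case True
  then show ?thesis unfolding size_map_def by simp
next
  case False
  have "real (size_map \<gamma> n) \<le> real n powr \<gamma>"
    unfolding size_map_def by (rule floor_powr_bounds) simp
  also have "\<dots> \<le> real n powr 1" using assms False by (intro powr_mono) auto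
  finally show ?thesis using False by simp
qed

lemma powr_add_one_le:
  fixes x \<gamma> :: real
  assumes "0 < x" "0 < \<gamma>" "\<gamma> \<le> 1"
  shows "(x + 1) powr \<gamma> \<le> x powr \<gamma> + 1"
proof -
  have e: "z powr \<gamma> = z * z powr (\<gamma> - 1)" if "0 < z" for z :: real
    using that powr_add[of z 1 "\<gamma> - 1"] by simp
  have "(x + 1) powr \<gamma> = x * (x + 1) powr (\<gamma> - 1) + (x + 1) powr (\<gamma> - 1)"
    using e[of "x + 1"] assms(1) by (simp add: distrib_right)
  also have "\<dots> \<le> x * x powr (\<gamma> - 1) + (x + 1) powr 0"
  proof (rule add_mono)
    show "x * (x + 1) powr (\<gamma> - 1) \<le> x * x powr (\<gamma> - 1)"
      using assms by (intro mult_left_mono powr_mono2') auto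
    show "(x + 1) powr (\<gamma> - 1) \<le> (x + 1) powr 0" using assms by (intro powr_mono) auto
  qed
  also have "\<dots> = x powr \<gamma> + 1" using e[of x] assms(1) by simp
  finally show ?thesis .
qed

text \<open>By \<open>\<gamma> \<le> 1\<close> the power \<open>n powr \<gamma>\<close> grows by at
  most 1 per step, so its integer part skips no value. Refuting the conjecture on all sizes requires
  an algorithm for every large cycle length.\<close>

lemma surj_size_map:
  assumes \<gamma>: "0 < \<gamma>" "\<gamma> \<le> 1"
  shows "range (size_map \<gamma>) = UNIV"
proof -
  have "\<exists>n. size_map \<gamma> n = N" for N
  proof (cases "N = 0")
    case True
    then show ?thesis unfolding size_map_def by (intro exI[of _ 0]) simp
  next
    case False
    define x where "x = real N powr (1 / \<gamma>)"
    define n where "n = nat \<lceil>x\<rceil>"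
    have x0: "0 < x" unfolding x_def using False by simp
    have xN: "x powr \<gamma> = real N" unfolding x_def using \<gamma> False by (simp add: powr_powr)
    have n: "x \<le> real n" "real n < x + 1" unfolding n_def using x0 by linarith+
    have "real N \<le> real n powr \<gamma>" unfolding xN[symmetric] using n(1) x0 \<gamma> by (intro powr_mono2) auto
    moreover have "real n powr \<gamma> < (x + 1) powr \<gamma>" using n x0 \<gamma> by (intro powr_less_mono2) auto
    then have "real n powr \<gamma> < real N + 1" using powr_add_one_le[OF x0 \<gamma>] xN by simp
    ultimately have "\<lfloor>real n powr \<gamma>\<rfloor> = int N" by (simp add: floor_eq_iff)
    then show ?thesis unfolding size_map_def by (intro exI[of _ n]) simp
  qed
  then show ?thesis by (metis UNIV_eq_I rangeI)
qed

lemma infinite_size_map: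
  assumes \<gamma>: "0 < \<gamma>" and Z: "infinite Z"
  shows "infinite (size_map \<gamma> ` Z)"
proof
  assume "finite (size_map \<gamma> ` Z)"
  then obtain b where b: "\<And>n. n \<in> Z \<Longrightarrow> size_map \<gamma> n \<le> b" using finite_nat_set_iff_bounded_le by auto
  have "Z \<subseteq> {..nat \<lceil>(real b + 1) powr (1 / \<gamma>)\<rceil>}"
  proof
    fix n assume n: "n \<in> Z"
    have "real n powr \<gamma> < real (size_map \<gamma> n) + 1"
      using floor_powr_bounds(2)[of "real n powr \<gamma>"] unfolding size_map_def by simp
    then have "real n powr \<gamma> \<le> real b + 1" using b[OF n] by (smt (verit) of_nat_le_iff)
    then have "(real n powr \<gamma>) powr (1 / \<gamma>) \<le> (real b + 1) powr (1 / \<gamma>)" using \<gamma> by (intro powr_mono2) auto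
    then have "real n \<le> (real b + 1) powr (1 / \<gamma>)" using \<gamma> by (cases "n = 0") (auto simp: powr_powr)
    then show "n \<in> {..nat \<lceil>(real b + 1) powr (1 / \<gamma>)\<rceil>}" by simp linarith
  qed
  then show False using Z finite_subset by blast
qed

lemma eventually_on_iff:
  "eventually Q (inf sequentially (principal Z)) \<longleftrightarrow> (\<exists>n0. \<forall>n\<ge>n0. n \<in> Z \<longrightarrow> Q (n :: nat))"
  unfolding eventually_inf_principal eventually_sequentially ..

text \<open>The exponent \<open>\<gamma>\<close> depends only on the space bound and not on the set
  \<open>Z\<close> of sizes with few rounds, so both forms of the conjecture are handled by choosing
  \<open>Z\<close> afterwards.\<close>

lemma not_no_fast_cycle_algorithm_on:
  fixes A :: "nat \<Rightarrow> mpc" and \<epsilon> :: "nat \<Rightarrow> real"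
  assumes eps: "\<And>n. n > 0 \<Longrightarrow> 1 / real n \<le> \<epsilon> n \<and> \<epsilon> n \<le> 1"
    and P: "P \<in> {is_metric, is_one_two_metric}"
    and space: "sublinear_space sequentially A"
    and total_space: "poly_bounded sequentially (\<lambda>n. machines (A n) * local_space (A n))"
    and words: "poly_bounded sequentially (\<lambda>n. word_bound (A n))"
    and correct: "\<forall>\<^sub>F n in sequentially. computes_approx_mst P (\<epsilon> n) n (A n)"
  shows "\<exists>\<gamma>. 0 < \<gamma> \<and> \<gamma> \<le> 1 \<and> (\<forall>Z.
     (\<lambda>n. real (rounds (A n))) \<in> o[inf sequentially (principal Z)](\<lambda>n. ln (1 / \<epsilon> n)) \<longrightarrow>
     \<not> no_fast_cycle_algorithm_on (size_map \<gamma> ` Z))"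
proof -
  obtain \<delta>0 where \<delta>0: "0 < \<delta>0" "\<forall>\<^sub>F n in sequentially. real (local_space (A n)) \<le> real n powr (1 - \<delta>0)"
    using space unfolding sublinear_space_def by blast
  obtain k1 where k1: "\<forall>\<^sub>F n in sequentially. machines (A n) * local_space (A n) \<le> n ^ k1"
    using total_space unfolding poly_bounded_def by blast
  obtain k2 where k2: "\<forall>\<^sub>F n in sequentially. word_bound (A n) \<le> n ^ k2"
    using words unfolding poly_bounded_def by blast
  define \<delta> where "\<delta> = min \<delta>0 (1 / 2)"
  define \<beta> where "\<beta> = \<delta> / 8"
  define \<gamma> where "\<gamma> = 1 - 2 * \<beta>"
  define h where "h = 2 * (k1 + 8)"
  have \<delta>: "0 < \<delta>" "\<delta> \<le> 1 / 2" "\<delta> \<le> \<delta>0" unfolding \<delta>_def using \<delta>0(1) by auto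
  have \<beta>: "0 < \<beta>" "\<beta> \<le> 1 / 16" unfolding \<beta>_def using \<delta> by auto
  have \<gamma>: "0 < \<gamma>" "\<gamma> \<le> 1" unfolding \<gamma>_def using \<beta> by auto
  define k where "k n = nat \<lfloor>(1 / \<epsilon> n) powr \<beta>\<rfloor>" for n
  define \<Lambda> where "\<Lambda> n = ln (1 / \<epsilon> n)" for n
  define f where "f = size_map \<gamma>"
  have sp: "\<forall>\<^sub>F n in sequentially. real (local_space (A n)) \<le> real n powr (1 - \<delta>)"
    using \<delta>0(2) eventually_ge_at_top[of "1::nat"]
  proof eventually_elim
    case (elim n)
    then have "real n powr (1 - \<delta>0) \<le> real n powr (1 - \<delta>)" using \<delta>(3) by (intro powr_mono) auto
    then show ?case using elim(1) by simp
  qed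
  have large: "\<forall>\<^sub>F n in sequentially. 100 \<le> real n powr \<beta>"
    using eventually_ge_at_top[of "nat \<lceil>100 powr (1 / \<beta>)\<rceil>"]
  proof eventually_elim
    case (elim n)
    then have "100 powr (1 / \<beta>) \<le> real n" by linarith
    then have "(100 powr (1 / \<beta>)) powr \<beta> \<le> real n powr \<beta>" using \<beta> by (intro powr_mono2) auto
    then show ?case using \<beta> by (simp add: powr_powr)
  qed
  have base: "\<forall>\<^sub>F n in sequentially. 5 \<le> n \<and> computes_approx_mst P (\<epsilon> n) n (A n) \<and>
      real (local_space (A n)) \<le> real n powr (1 - \<delta>) \<and> machines (A n) * local_space (A n) \<le> n ^ k1 \<and>
      word_bound (A n) \<le> n ^ k2 \<and> 100 \<le> real n powr \<beta> \<and> 1 \<le> real (rounds (A n))"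
    using eventually_ge_at_top[of "5::nat"] correct sp k1 k2 large
  proof eventually_elim
    case (elim n)
    then show ?case using rounds_pos[OF elim(2) P elim(1)] by simp
  qed
  have \<Lambda>0: "0 \<le> \<Lambda> n" "\<Lambda> n \<le> ln (real n)" "0 < \<epsilon> n" "1 \<le> 1 / \<epsilon> n" if "0 < n" for n
  proof -
    have "0 < 1 / real n" using that by simp
    then show e0: "0 < \<epsilon> n" using eps[OF that] by linarith
    show e1: "1 \<le> 1 / \<epsilon> n" using e0 eps[OF that] by simp
    then show "0 \<le> \<Lambda> n" unfolding \<Lambda>_def by (rule ln_ge_zero)
    have "1 / \<epsilon> n \<le> real n" using eps[OF that] e0 that by (simp add: field_simps)
    then show "\<Lambda> n \<le> ln (real n)" 
      unfolding \<Lambda>_def using ln_le_cancel_iff[of "1 / \<epsilon> n" "real n"] e0 that by simp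
  qed
  have "\<not> no_fast_cycle_algorithm_on (f ` Z)"
    if small: "(\<lambda>n. real (rounds (A n))) \<in> o[inf sequentially (principal Z)](\<lambda>n. ln (1 / \<epsilon> n))" for Z
  proof -
    let ?F = "inf sequentially (principal Z)" and ?F' = "inf sequentially (principal (f ` Z))"
    have baseF: "\<forall>\<^sub>F n in ?F. 5 \<le> n \<and> computes_approx_mst P (\<epsilon> n) n (A n) \<and>
      real (local_space (A n)) \<le> real n powr (1 - \<delta>) \<and> machines (A n) * local_space (A n) \<le> n ^ k1 \<and>
      word_bound (A n) \<le> n ^ k2 \<and> 100 \<le> real n powr \<beta> \<and> 1 \<le> real (rounds (A n))"
      by (rule filter_leD[OF inf_le1 base])
    have r_small: "\<forall>\<^sub>F n in ?F. real (rounds (A n)) \<le> c * \<Lambda> n" if "0 < c" for c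
      using landau_o.smallD[OF small that] baseF
    proof eventually_elim
      case (elim n)
      then show ?case using \<Lambda>0(1)[of n] unfolding \<Lambda>_def by simp
    qed
    \<comment> \<open>At least one round is used, so \<open>o(\<Lambda>)\<close> rounds force
      \<open>\<Lambda>\<close> to tend to infinity along \<open>Z\<close>.\<close>
    have \<Lambda>_large: "\<forall>\<^sub>F n in ?F. K \<le> \<Lambda> n" if "0 < K" for K
    proof -
      have "0 < 1 / K" using that by simp
      from r_small[OF this] baseF show ?thesis
      proof eventually_elim
        case (elim n)
        then have "1 \<le> 1 / K * \<Lambda> n" by linarith
        then show ?case using that by (simp add: field_simps)
      qed
    qed
    have k_large: "\<forall>\<^sub>F n in ?F. 40 \<le> k n \<and> \<beta> / 2 * \<Lambda> n \<le> ln (real (k n))"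
    proof -
      have "0 < ln 41 / \<beta>" using \<beta> by simp
      from \<Lambda>_large[OF this] baseF show ?thesis
      proof eventually_elim
        case (elim n)
        then have n: "0 < n" by simp
        \<comment> \<open>\<open>u\<close> is the square root of
          \<open>(1 / \<epsilon> n) powr \<beta>\<close>. From \<open>2 \<le> u\<close> and
          \<open>u * u - 1 < k n\<close> follows \<open>u \<le> k n\<close>, so rounding costs at
          most half of the logarithm.\<close>
        define u where "u = exp (\<beta> / 2 * \<Lambda> n)"
        have "(1 / \<epsilon> n) powr \<beta> = exp (\<beta> * \<Lambda> n)"
          unfolding powr_def \<Lambda>_def using \<Lambda>0(3)[OF n] by simp
        also have "\<dots> = u * u" unfolding u_def by (simp flip: exp_add)
        finally have E: "(1 / \<epsilon> n) powr \<beta> = u * u" .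
        have "ln 41 \<le> \<beta> * \<Lambda> n" using elim(1) \<beta> by (simp add: field_simps)
        then have "exp (ln 41) \<le> exp (\<beta> * \<Lambda> n)" by (simp only: exp_le_cancel_iff)
        then have E41: "41 \<le> u * u" using \<open>exp (\<beta> * \<Lambda> n) = u * u\<close> by simp
        have kl: "u * u - 1 < real (k n)" unfolding k_def E by (rule floor_powr_bounds) simp
        then have "40 \<le> k n" using E41 by linarith
        moreover have u0: "0 < u" unfolding u_def by simp
        have "2 \<le> u"
        proof (rule ccontr)
          assume "\<not> 2 \<le> u"
          then have "u * u \<le> 2 * 2" using u0 by (intro mult_mono) auto
          then show False using E41 by simp
        qed
        then have "2 * u \<le> u * u" by (intro mult_right_mono) auto
        then have "u \<le> real (k n)" using kl \<open>2 \<le> u\<close> by linarith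
        then have "ln u \<le> ln (real (k n))" using u0 by simp
        then have "\<beta> / 2 * \<Lambda> n \<le> ln (real (k n))" unfolding u_def by simp
        ultimately show ?case by simp
      qed
    qed
    define good where "good n C \<longleftrightarrow> distinguishes_cycles (f n) C \<and> machines C \<le> f n ^ (2 * (h + k1 + 12)) \<and>
       real (local_space C) \<le> real (f n) powr (1 - \<delta> / 4) \<and> word_bound C \<le> f n ^ (2 * (h + k2 + 2)) \<and>
       real (rounds C) \<le> 3 + (ln (real (f n)) / ln (real (k n)) + 1) * (real (rounds (A n)) + 3 * real h + 4)"
      for n C
    have ex: "\<forall>\<^sub>F n in ?F. (\<exists>C. good n C) \<and> n \<le> f n ^ 2"
      using baseF k_large
    proof eventually_elim
      case (elim n)
      have n: "0 < n" using elim by simp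
      have fn: "f n = nat \<lfloor>real n powr (1 - 2 * \<beta>)\<rfloor>" unfolding f_def size_map_def \<gamma>_def ..
      have "\<exists>C. good n C" unfolding good_def
        by (rule ex_fast_cycle_mpc(1)[OF _ P \<delta>(1,2) \<beta>_def _ _ _ _ _ _ fn k_def _ h_def])
          (use elim eps[OF n] in auto)
      moreover have "n \<le> f n ^ 2"
        by (rule ex_fast_cycle_mpc(2)[OF _ P \<delta>(1,2) \<beta>_def _ _ _ _ _ _ fn k_def _ h_def])
          (use elim eps[OF n] in auto)
      ultimately show ?case by blast
    qed
    \<comment> \<open>Several numbers of points may belong to one cycle length; one of them in
      \<open>Z\<close> is picked.\<close>
    define g where "g N = (SOME n. n \<in> Z \<and> f n = N)" for N
    have g: "g N \<in> Z \<and> f (g N) = N" if "N \<in> f ` Z" for N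
      unfolding g_def by (rule someI_ex) (use that in blast)
    have pull: "\<forall>\<^sub>F N in ?F'. Q (g N) \<and> f (g N) = N" if ev: "eventually Q ?F" for Q
    proof -
      obtain n0 where n0: "\<forall>n\<ge>n0. n \<in> Z \<longrightarrow> Q n" using ev unfolding eventually_on_iff by blast
      have "\<forall>N\<ge>n0. N \<in> f ` Z \<longrightarrow> Q (g N) \<and> f (g N) = N"
      proof (intro allI impI)
        fix N assume N: "n0 \<le> N" "N \<in> f ` Z"
        \<comment> \<open>As \<open>f\<close> never increases, a large \<open>N\<close> has a large
          preimage, so what holds eventually along \<open>Z\<close> holds for \<open>g N\<close>
          eventually along the image.\<close>
        have "f (g N) \<le> g N" unfolding f_def by (rule size_map_le[OF \<gamma>])
        then have "n0 \<le> g N" using N g[OF N(2)] by simp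
        then show "Q (g N) \<and> f (g N) = N" using n0 g[OF N(2)] by blast
      qed
      then show ?thesis unfolding eventually_on_iff by blast
    qed
    define C where "C N = (SOME C. good (g N) C)" for N
    have C: "\<forall>\<^sub>F N in ?F'. good (g N) (C N) \<and> g N \<le> N ^ 2 \<and> f (g N) = N"
      using pull[OF ex]
    proof eventually_elim
      case (elim N)
      then have "\<exists>C. good (g N) C" and le: "g N \<le> f (g N) ^ 2" and fg: "f (g N) = N" by blast+
      then have "good (g N) (C N)" unfolding C_def by (intro someI_ex[of "good (g N)"])
      moreover have "g N \<le> N ^ 2" using le unfolding fg .
      ultimately show ?case using fg by blast
    qed
    have c1: "sublinear_space ?F' C"
      unfolding sublinear_space_def
    proof (intro exI[of _ "\<delta> / 4"] conjI)
      show "\<forall>\<^sub>F N in ?F'. real (local_space (C N)) \<le> real N powr (1 - \<delta> / 4)"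
        using C by eventually_elim (auto simp: good_def)
    qed (use \<delta> in simp)
    have c2: "poly_bounded ?F' (\<lambda>N. machines (C N))"
      unfolding poly_bounded_def
    proof (intro exI[of _ "2 * (h + k1 + 12)"])
      show "\<forall>\<^sub>F N in ?F'. machines (C N) \<le> N ^ (2 * (h + k1 + 12))"
        using C by eventually_elim (auto simp: good_def)
    qed
    have c3: "poly_bounded ?F' (\<lambda>N. word_bound (C N))"
      unfolding poly_bounded_def
    proof (intro exI[of _ "2 * (h + k2 + 2)"])
      show "\<forall>\<^sub>F N in ?F'. word_bound (C N) \<le> N ^ (2 * (h + k2 + 2))"
        using C by eventually_elim (auto simp: good_def)
    qed
    have c4: "\<forall>\<^sub>F N in ?F'. distinguishes_cycles N (C N)"
      using C by eventually_elim (auto simp: good_def)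
    have c5: "(\<lambda>N. real (rounds (C N))) \<in> o[?F'](\<lambda>N. ln (real N))"
    proof (rule landau_o.smallI)
      fix c :: real assume c: "0 < c"
      define c' where "c' = c / (4 / \<beta> + 5)"
      have b5: "0 < 4 / \<beta> + 5" using \<beta> by (intro add_pos_pos) auto
      have c': "0 < c'" "(4 / \<beta> + 5) * c' = c" unfolding c'_def using c b5 by auto
      \<comment> \<open>\<open>3 * h + 10\<close> is above both the fixed cost
        \<open>3 * h + 4\<close> of a stage and the 6 that \<open>rounds_bound\<close> asks
        for.\<close>
      have "0 < (3 * real h + 10) / c'" using c' by (intro divide_pos_pos) auto
      note ev = eventually_conj[OF baseF eventually_conj[OF k_large eventually_conj[OF r_small[OF c'(1)] \<Lambda>_large[OF this]]]]
      show "\<forall>\<^sub>F N in ?F'. norm (real (rounds (C N))) \<le> c * norm (ln (real N))"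
        using C pull[OF ev]
      proof eventually_elim
        case (elim N)
        let ?n = "g N"
        have n: "5 \<le> ?n" and klow: "\<beta> / 2 * \<Lambda> ?n \<le> ln (real (k ?n))"
          and r: "real (rounds (A ?n)) \<le> c' * \<Lambda> ?n" and \<Lambda>: "(3 * real h + 10) / c' \<le> \<Lambda> ?n"
          and good: "good ?n (C N)" and nN: "?n \<le> N ^ 2" and fN: "f ?n = N" using elim by auto
        have \<Lambda>': "3 * real h + 10 \<le> c' * \<Lambda> ?n" using \<Lambda> c'(1) by (simp add: field_simps)
        have N0: "0 < N" using nN n by (cases "N = 0") auto
        have "\<Lambda> ?n \<le> ln (real ?n)" using \<Lambda>0(2)[of ?n] n by simp
        also have "\<dots> \<le> ln (real (N ^ 2))" using nN n N0 by (subst ln_le_cancel_iff) (auto simp flip: of_nat_power)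
        also have "\<dots> = 2 * ln (real N)" using N0 by (simp add: ln_realpow)
        finally have \<Lambda>N: "\<Lambda> ?n \<le> 2 * ln (real N)" .
        have "real (rounds (C N)) \<le> 3 + (ln (real N) / ln (real (k ?n)) + 1) * (real (rounds (A ?n)) + (3 * real h + 4))"
          using good fN unfolding good_def by (simp add: add.assoc)
        also have "\<dots> \<le> (4 / \<beta> + 5) * c' * ln (real N)"
          using \<beta> c' \<Lambda>' \<Lambda>N klow r by (intro rounds_bound[where \<Lambda> = "\<Lambda> ?n"]) auto
        also have "\<dots> = c * ln (real N)" unfolding c'(2) ..
        finally have "real (rounds (C N)) \<le> c * ln (real N)" .
        moreover have "0 \<le> ln (real N)" using N0 by simp
        ultimately show ?case by simp
      qed
    qed
    show ?thesis unfolding no_fast_cycle_algorithm_on_def Let_def not_not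
      by (intro exI[of _ C] conjI c1 c2 c3 c4 c5)
  qed
  then show ?thesis using \<gamma> unfolding f_def by (intro exI[of _ \<gamma>] conjI allI impI)
qed

text \<open>For every constant the lower bound fails at arbitrarily large sizes. Taking a failure
  beyond \<open>i\<close> for the constant \<open>1 / Suc i\<close> gives a sequence along which
  \<open>r\<close> is \<open>o(\<Lambda>)\<close>.\<close>

lemma ex_infinite_smallo:
  fixes r \<Lambda> :: "nat \<Rightarrow> real"
  assumes "r \<notin> \<Omega>(\<Lambda>)"
  shows "\<exists>Z. infinite Z \<and> r \<in> o[inf sequentially (principal Z)](\<Lambda>)"
proof -
  have ex: "\<exists>n\<ge>n0. norm (r n) < c * norm (\<Lambda> n)" if "0 < c" for c n0
  proof (rule ccontr)
    assume "\<not> (\<exists>n\<ge>n0. norm (r n) < c * norm (\<Lambda> n))"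
    then have "\<forall>\<^sub>F n in sequentially. c * norm (\<Lambda> n) \<le> norm (r n)"
      unfolding eventually_sequentially by (meson linorder_not_less)
    then show False using assms landau_omega.bigI[OF that] by blast
  qed
  have "\<forall>i. \<exists>n\<ge>i. norm (r n) < 1 / real (Suc i) * norm (\<Lambda> n)" by (intro allI ex) simp
  then obtain u where u: "\<And>i. i \<le> u i" "\<And>i. norm (r (u i)) < 1 / real (Suc i) * norm (\<Lambda> (u i))" by metis
  have "infinite (range u)"
    unfolding infinite_nat_iff_unbounded_le using u(1) by blast
  moreover have "r \<in> o[inf sequentially (principal (range u))](\<Lambda>)"
  proof (rule landau_o.smallI)
    fix c :: real assume c: "0 < c"
    obtain I where I: "1 / real (Suc I) < c" using nat_approx_posE[OF c] by blast
    \<comment> \<open>\<open>n0\<close> exceeds all \<open>u i\<close> with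
      \<open>i \<le> I\<close>, so an element of the range from \<open>n0\<close> on has an index
      above \<open>I\<close>.\<close>
    define n0 where "n0 = Suc (\<Sum>i\<le>I. u i)"
    have "norm (r n) \<le> c * norm (\<Lambda> n)" if n: "n0 \<le> n" "n \<in> range u" for n
    proof -
      obtain i where i: "n = u i" using n(2) by blast
      have "I < i"
      proof (rule ccontr)
        assume "\<not> I < i"
        then have "u i \<le> (\<Sum>i\<le>I. u i)" by (intro member_le_sum) auto
        then show False using n(1) i unfolding n0_def by simp
      qed
      then have "1 / real (Suc i) \<le> 1 / real (Suc I)" by (simp add: field_simps)
      then have "1 / real (Suc i) \<le> c" using I by simp
      then have "1 / real (Suc i) * norm (\<Lambda> n) \<le> c * norm (\<Lambda> n)" by (intro mult_right_mono) auto
      then show ?thesis using u(2)[of i] i by simp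
    qed
    then show "\<forall>\<^sub>F n in inf sequentially (principal (range u)). norm (r n) \<le> c * norm (\<Lambda> n)"
      unfolding eventually_on_iff by blast
  qed
  ultimately show ?thesis by blast
qed

theorem theorem2:
  fixes A :: "nat \<Rightarrow> mpc" and \<epsilon> :: "nat \<Rightarrow> real"
    and P :: "nat \<Rightarrow> (nat \<Rightarrow> nat \<Rightarrow> nat) \<Rightarrow> bool"
  assumes eps: "\<And>n. n > 0 \<Longrightarrow> 1 / real n \<le> \<epsilon> n \<and> \<epsilon> n \<le> 1"
    and P: "P \<in> {is_metric, is_one_two_metric}"
    and space: "sublinear_space sequentially A"
    and total_space: "poly_bounded sequentially (\<lambda>n. machines (A n) * local_space (A n))"
    and words: "poly_bounded sequentially (\<lambda>n. word_bound (A n))"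
    and correct: "\<forall>\<^sub>F n in sequentially. computes_approx_mst P (\<epsilon> n) n (A n)"
  shows "(one_vs_two_cycle_conjecture \<longrightarrow>
            (\<lambda>n. real (rounds (A n))) \<notin> o(\<lambda>n. ln (1 / \<epsilon> n))) \<and>
         (one_vs_two_cycle_conjecture_all_sizes \<longrightarrow>
            (\<lambda>n. real (rounds (A n))) \<in> \<Omega>(\<lambda>n. ln (1 / \<epsilon> n)))"
proof -
  have "\<exists>\<gamma>. 0 < \<gamma> \<and> \<gamma> \<le> 1 \<and> (\<forall>Z.
     (\<lambda>n. real (rounds (A n))) \<in> o[inf sequentially (principal Z)](\<lambda>n. ln (1 / \<epsilon> n)) \<longrightarrow>
     \<not> no_fast_cycle_algorithm_on (size_map \<gamma> ` Z))"
    by (rule not_no_fast_cycle_algorithm_on[OF _ P space total_space words correct]) (rule eps)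
  then obtain \<gamma> where \<gamma>: "0 < \<gamma>" "\<gamma> \<le> 1"
    and fast: "\<forall>Z. (\<lambda>n. real (rounds (A n))) \<in> o[inf sequentially (principal Z)](\<lambda>n. ln (1 / \<epsilon> n)) \<longrightarrow>
      \<not> no_fast_cycle_algorithm_on (size_map \<gamma> ` Z)"
    by (elim exE conjE)
  show ?thesis
  proof (intro conjI impI)
    \<comment> \<open>Here \<open>Z\<close> is the set of all sizes, and its image under
      \<open>size_map\<close> is again all of them.\<close>
    assume "one_vs_two_cycle_conjecture"
    then show "(\<lambda>n. real (rounds (A n))) \<notin> o(\<lambda>n. ln (1 / \<epsilon> n))"
      using fast[rule_format, of UNIV] surj_size_map[OF \<gamma>] unfolding one_vs_two_cycle_conjecture_def by auto
  next
    assume conj: "one_vs_two_cycle_conjecture_all_sizes"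
    show "(\<lambda>n. real (rounds (A n))) \<in> \<Omega>(\<lambda>n. ln (1 / \<epsilon> n))"
    proof (rule ccontr)
      assume "(\<lambda>n. real (rounds (A n))) \<notin> \<Omega>(\<lambda>n. ln (1 / \<epsilon> n))"
      \<comment> \<open>The rounds are few on an infinite set of sizes; the image of this set is
        infinite, which is all that the stronger conjecture asks of it.\<close>
      then obtain Z where Z: "infinite Z"
        "(\<lambda>n. real (rounds (A n))) \<in> o[inf sequentially (principal Z)](\<lambda>n. ln (1 / \<epsilon> n))"
        using ex_infinite_smallo by blast
      then show False using fast[rule_format, OF Z(2)] infinite_size_map[OF \<gamma>(1) Z(1)] conj
        unfolding one_vs_two_cycle_conjecture_all_sizes_def by blast
    qed
  qed
qed

end
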